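(* Let $p\in\{1,\dots,n\}$ and let $C\in\mathbf{Ca}(n,p)$ be an admissible column of height $p$. Then the element $G(C)$ of the canonical (lower global) basis of the fundamental $U_q(sp_{2n})$-module $V(\Lambda_p)\subset W(\Lambda_p)$ expands on the basis $\{v_D\mid D\in\mathbf{C}(n,p)\}$ of $W(\Lambda_p)$ as $$G(C)=\sum_{X\subset K_C}q^{\mathrm{card}(X)}\,v_{C_X}.$$
   Context: **Quantum group.** $n$ is a positive integer. $U_q(sp_{2n})$ is the associative $\mathbb{C}(q)$-algebra generated by $e_i,f_i,q^{h_i},q^{-h_i}$ ($1\le i\le n$) with relations: $q^{h_i}q^{-h_i}=q^{-h_i}q^{h_i}=1$; the $q^{\pm h_i}$ commute; $q^{h_i}e_jq^{-h_i}=q^{a_{i,j}}e_j$; $q^{h_i}f_jq^{-h_i}=q^{-a_{i,j}}f_j$; $[e_i,f_j]=\delta_{i,j}\frac{t_i-t_i^{-1}}{q_i-q_i^{-1}}$; and for $i\ne j$, $\sum_{k=0}^{1-a_{i,j}}(-1)^k e_i^{(k)}e_je_i^{(1-a_{i,j}-k)}=0=\sum_{k=0}^{1-a_{i,j}}(-1)^k f_i^{(k)}f_jf_i^{(1-a_{i,j}-k)}$. Here $a_{i,i}=2$, $a_{n-1,n}=-2$, $a_{i,j}=-1$ for all other pairs with $|i-j|=1$, and $a_{i,j}=0$ if $|i-j|\ge2$; $q_i=q$, $t_i=q^{h_i}$ for $i<n$; $q_n=q^2$, $t_n=q^{2h_n}$; $[m]_i=\frac{q_i^m-q_i^{-m}}{q_i-q_i^{-1}}$,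 $[m]_i!=[m]_i\cdots[1]_i$, $e_i^{(m)}=e_i^m/[m]_i!$, $f_i^{(m)}=f_i^m/[m]_i!$. $\Lambda_1,\dots,\Lambda_n$ are the fundamental weights. **Columns.** $\mathcal{C}_n=\{1<\dots<n<\overline n<\dots<\overline1\}$ is a totally ordered alphabet; letters $\le n$ are called unbarred. A column of height $p$ is a subset of $\mathcal{C}_n$ of cardinality $p$ (written as a vertical strip strictly increasing from top to bottom); $\mathbf{C}(n,p)$ is the set of all of them. Write $C-\{a\}+\{b\}=(C\setminus\{a\})\cup\{b\}$. **Admissible columns.** For a column $C$ let $I_C=\{z_1>\dots>z_r\}$ be the set of unbarred $z$ with $z\in C$ and $\overline z\in C$. $C$ is admissible if there exist unbarred letters $t_1>\dots>t_r$ such that $t_1$ is the greatest letter with $t_1<z_1$, $t_1\notin C$, $\overline{t_1}\notin C$, and for $i\ge2$, $t_i$ is the greatest letter with $t_i<\min(t_{i-1},z_i)$, $t_i\notin C$, $\overline{t_i}\notin C$. $\mathbf{Ca}(n,p)$ is the set of admissible columns of height $p$. **The module $W(\Lambda_p)$.** It is the $\mathbb{C}(q)$-vector space with basis $\{v_C\mid C\in\mathbf{C}(n,p)\}$ and the following action. For $i<n$ put $E=C\cap\{i,i+1,\overline{i+1},\overline i\}$. Then $q^{h_i}v_C=q^{m}v_C$ with $m=|C\cap\{i,\overline{i+1}\}|-|C\cap\{i+1,\overline i\}|$, and: - $f_iv_C=v_{C-\{i\}+\{i+1\}}$ if $E=\{i\}$, $\{\overline{i+1},\overline i,i\}$ or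 $\{\overline i,i\}$; $f_iv_C=v_{C-\{\overline{i+1}\}+\{\overline i\}}$ if $E=\{\overline{i+1}\}$ or $\{\overline{i+1},i,i+1\}$; $f_iv_C=q^{-1}v_{C-\{\overline{i+1}\}+\{\overline i\}}$ if $E=\{\overline{i+1},i+1\}$; $f_iv_C=v_{C-\{i\}+\{i+1\}}+q\,v_{C-\{\overline{i+1}\}+\{\overline i\}}$ if $E=\{\overline{i+1},i\}$; $f_iv_C=0$ otherwise. - $e_iv_C=v_{C-\{i+1\}+\{i\}}$ if $E=\{i+1\}$ or $\{\overline{i+1},\overline i,i+1\}$; $e_iv_C=v_{C-\{\overline i\}+\{\overline{i+1}\}}$ if $E=\{\overline i\}$, $\{\overline i,i,i+1\}$ or $\{\overline i,i\}$; $e_iv_C=q^{-1}v_{C-\{i+1\}+\{i\}}$ if $E=\{\overline{i+1},i+1\}$; $e_iv_C=v_{C-\{\overline i\}+\{\overline{i+1}\}}+q\,v_{C-\{i+1\}+\{i\}}$ if $E=\{\overline i,i+1\}$; $e_iv_C=0$ otherwise. For $i=n$: $q^{h_n}v_C=q^{m}v_C$ with $m=|C\cap\{n\}|-|C\cap\{\overline n\}|$; $f_nv_C=v_{C-\{n\}+\{\overline n\}}$ if $n\in C,\overline n\notin C$, and $0$ otherwise; $e_nv_C=v_{C-\{\overline n\}+\{n\}}$ if $\overline n\in C,n\notin C$, and $0$ otherwise. **$V(\Lambda_p)$ and its canonical basis.** Let $C_p^0=\{1,\dots,p\}$ and $v_{\Lambda_p}=v_{C_p^0}$, a highest weight vector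 of weight $\Lambda_p$; $V(\Lambda_p)=U_q(sp_{2n})v_{\Lambda_p}\subset W(\Lambda_p)$ is the irreducible module of highest weight $\Lambda_p$. The bar involution of $U_q(sp_{2n})$ is the ($\mathbb{C}$-linear) ring automorphism with $\overline q=q^{-1}$, $\overline{q^{h_i}}=q^{-h_i}$, $\overline{e_i}=e_i$, $\overline{f_i}=f_i$; on $V(\Lambda_p)$ it is $\overline{Fv_{\Lambda_p}}=\overline F v_{\Lambda_p}$. Let $U^-_{\mathbb{Q}}$ be the $\mathbb{Q}[q,q^{-1}]$-subalgebra generated by all $f_i^{(k)}$, and $V_{\mathbb{Q}}(\Lambda_p)=U^-_{\mathbb{Q}}v_{\Lambda_p}$. Let $A\subset\mathbb{C}(q)$ be the ring of rational functions without pole at $q=0$ and $\mathcal{L}_p=\bigoplus_{C\in\mathbf{C}(n,p)}A\,v_C$. The canonical basis is the unique $\mathbb{Q}[q,q^{-1}]$-basis $\{G(C)\mid C\in\mathbf{Ca}(n,p)\}$ of $V_{\mathbb{Q}}(\Lambda_p)$ with $\overline{G(C)}=G(C)$ and $G(C)\equiv v_C \bmod q\mathcal{L}_p$ (existence and uniqueness: Kashiwara). **$K_C$ and $C_X$.** For admissible $C$, $K_C=\{x_1<\dots<x_r\}$ is the set of unbarred letters $x$ with $x\in C$ and $\overline x\in C$. Define $u_1,\dots,u_r$ successively: $u_i$ is the largest unbarred letter with $u_i<x_i$, $u_i\notin C$, $\overline{u_i}\notin C$ and $u_i\notin\{u_1,\dots,u_{i-1}\}$ (these exist when $C$ is admissible).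 For $X\subset K_C$, $C_X$ is the column obtained from $C$ by replacing, for every $x_i\in X$, the pair $(x_i,\overline{x_i})$ by $(u_i,\overline{u_i})$. *)

theory Defs
  imports
    Complex_Main
    "HOL-Library.Poly_Mapping"
    "HOL-Library.FuncSet"
    "HOL-Computational_Algebra.Computational_Algebra"
    "HOL-Computational_Algebra.Field_as_Ring"
    "HOL-Algebra.QuotRing"
    "HOL-Algebra.Generated_Rings"
begin

section \<open>The ground field of rational functions in q\<close>

type_synonym cq = "complex poly fract"

definition qv :: cq where
  "qv = to_fract [:0, 1:]"

definition subst_inv :: "complex poly \<Rightarrow> cq" where
  "subst_inv P = poly (map_poly (\<lambda>c. to_fract [:c:]) P) (inverse qv)"

text \<open>The \<open>\<complex>\<close>-linear field automorphism sending q to its inverse.\<close>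

definition bar_cq :: "cq \<Rightarrow> cq" where
  "bar_cq x = subst_inv (fst (quot_of_fract x)) / subst_inv (snd (quot_of_fract x))"

text \<open>The subring \<open>\<rat>[q, q\<^sup>-\<^sup>1]\<close>, and the local ring of functions without pole at \<open>q = 0\<close>.\<close>

definition rat_laurent :: "cq set" where
  "rat_laurent = {to_fract (map_poly of_rat P) / qv ^ k | (P :: rat poly) (k :: nat). True}"

definition regular_at_0 :: "cq set" where
  "regular_at_0 = {Fract P Q | P Q. poly Q 0 \<noteq> 0}"

definition qi :: "nat \<Rightarrow> nat \<Rightarrow> cq" where
  "qi n i = (if i = n then qv ^ 2 else qv)"

definition qint :: "nat \<Rightarrow> nat \<Rightarrow> nat \<Rightarrow> cq" where
  "qint n i m = (qi n i ^ m - inverse (qi n i) ^ m) / (qi n i - inverse (qi n i))"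

definition qfact :: "nat \<Rightarrow> nat \<Rightarrow> nat \<Rightarrow> cq" where
  "qfact n i m = (\<Prod>k\<in>{1..m}. qint n i k)"

definition cartan :: "nat \<Rightarrow> nat \<Rightarrow> nat \<Rightarrow> int" where
  "cartan n i j =
    (if i = j then 2
     else if i + 1 = n \<and> j = n then -2
     else if i + 1 = j \<or> j + 1 = i then -1
     else 0)"


section \<open>The quantum group\<close>

text \<open>
  The free associative algebra over an alphabet is the monoid algebra of the free monoid,
  written additively because this is what the product on finitely supported functions
  requires: \<open>+\<close> is concatenation of words and \<open>0\<close> is the empty word.
\<close>

datatype 'a fmon = Word (letters: "'a list")

instantiation fmon :: (type) monoid_add
begin

definition zero_fmon :: "'a fmon" where
  "zero_fmon = Word []"

definition plus_fmon :: "'a fmon \<Rightarrow> 'a fmon \<Rightarrow> 'a fmon" where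
  "plus_fmon v w = Word (letters v @ letters w)"

instance
  by standard (simp_all add: zero_fmon_def plus_fmon_def)

end

text \<open>\<open>GenH i\<close> and \<open>GenHinv i\<close> stand for \<open>q\<close> to the power \<open>h\<^sub>i\<close> and \<open>-h\<^sub>i\<close>.\<close>

datatype gen = GenE nat | GenF nat | GenH nat | GenHinv nat

type_synonym free_elt = "gen fmon \<Rightarrow>\<^sub>0 cq"

definition gens :: "nat \<Rightarrow> gen set" where
  "gens n = (\<Union>i\<in>{1..n}. {GenE i, GenF i, GenH i, GenHinv i})"

definition free_alg :: "nat \<Rightarrow> free_elt ring" where
  "free_alg n =
    \<lparr>carrier = {x. \<forall>w\<in>Poly_Mapping.keys x. set (letters w) \<subseteq> gens n},
     mult = (*), one = 1, zero = 0, add = (+)\<rparr>"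

definition scal :: "cq \<Rightarrow> free_elt" where
  "scal c = Poly_Mapping.single 0 c"

definition gelt :: "gen \<Rightarrow> free_elt" where
  "gelt g = Poly_Mapping.single (Word [g]) 1"

definition tgen :: "nat \<Rightarrow> nat \<Rightarrow> free_elt" where
  "tgen n i = (if i = n then gelt (GenH i) ^ 2 else gelt (GenH i))"

definition tgen_inv :: "nat \<Rightarrow> nat \<Rightarrow> free_elt" where
  "tgen_inv n i = (if i = n then gelt (GenHinv i) ^ 2 else gelt (GenHinv i))"

definition divpow :: "nat \<Rightarrow> nat \<Rightarrow> free_elt \<Rightarrow> nat \<Rightarrow> free_elt" where
  "divpow n i x m = scal (inverse (qfact n i m)) * x ^ m"

definition serre :: "nat \<Rightarrow> (nat \<Rightarrow> gen) \<Rightarrow> nat \<Rightarrow> nat \<Rightarrow> free_elt" where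
  "serre n g i j =
    (let b = nat (1 - cartan n i j) in
     \<Sum>k\<in>{0..b}. (- 1) ^ k * divpow n i (gelt (g i)) k * gelt (g j) * divpow n i (gelt (g i)) (b - k))"

definition relators :: "nat \<Rightarrow> free_elt set" where
  "relators n =
    (\<Union>i\<in>{1..n}. {gelt (GenH i) * gelt (GenHinv i) - 1, gelt (GenHinv i) * gelt (GenH i) - 1})
    \<union> (\<Union>i\<in>{1..n}. \<Union>j\<in>{1..n}.
        {gelt g * gelt h - gelt h * gelt g | g h. g \<in> {GenH i, GenHinv i} \<and> h \<in> {GenH j, GenHinv j}})
    \<union> (\<Union>i\<in>{1..n}. \<Union>j\<in>{1..n}.
        {gelt (GenH i) * gelt (GenE j) * gelt (GenHinv i) - scal (qv powi cartan n i j) * gelt (GenE j),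
         gelt (GenH i) * gelt (GenF j) * gelt (GenHinv i) - scal (qv powi (- cartan n i j)) * gelt (GenF j)})
    \<union> (\<Union>i\<in>{1..n}. \<Union>j\<in>{1..n}.
        {gelt (GenE i) * gelt (GenF j) - gelt (GenF j) * gelt (GenE i)
          - (if i = j then scal (inverse (qi n i - inverse (qi n i))) * (tgen n i - tgen_inv n i) else 0)})
    \<union> (\<Union>i\<in>{1..n}. \<Union>j\<in>{1..n} - {i}. {serre n GenE i j, serre n GenF i j})"

definition rel_ideal :: "nat \<Rightarrow> free_elt set" where
  "rel_ideal n = genideal (free_alg n) (relators n)"

definition Uq :: "nat \<Rightarrow> free_elt set ring" where
  "Uq n = free_alg n Quot rel_ideal n"

definition cls :: "nat \<Rightarrow> free_elt \<Rightarrow> free_elt set" where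
  "cls n x = a_r_coset (free_alg n) (rel_ideal n) x"

text \<open>
  The bar involution of the free algebra is semilinear, fixes the e and f generators and
  exchanges \<open>GenH i\<close> with \<open>GenHinv i\<close>. It preserves the ideal of relations, so that the
  induced map of the quotient sends a coset to its image.
\<close>

fun bar_gen :: "gen \<Rightarrow> gen" where
  "bar_gen (GenE i) = GenE i"
| "bar_gen (GenF i) = GenF i"
| "bar_gen (GenH i) = GenHinv i"
| "bar_gen (GenHinv i) = GenH i"

definition bar_free :: "free_elt \<Rightarrow> free_elt" where
  "bar_free x =
    (\<Sum>w\<in>Poly_Mapping.keys x.
      Poly_Mapping.single (Word (map bar_gen (letters w))) (bar_cq (Poly_Mapping.lookup x w)))"

definition bar_Uq :: "free_elt set \<Rightarrow> free_elt set" where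
  "bar_Uq u = bar_free ` u"

text \<open>The \<open>\<rat>[q, q\<^sup>-\<^sup>1]\<close>-subalgebra generated by the divided powers of the f generators.\<close>

definition UminusQ :: "nat \<Rightarrow> free_elt set set" where
  "UminusQ n = generate_ring (Uq n)
    ({cls n (scal a) | a. a \<in> rat_laurent}
     \<union> {cls n (divpow n i (gelt (GenF i)) k) | i k. i \<in> {1..n}})"


section \<open>Columns\<close>

text \<open>
  \<open>Unb i\<close> is the unbarred letter i and \<open>Bar i\<close> is the barred letter i. A column is determined by
  its set of letters, and only the order of unbarred letters, that of their indices, is used.
\<close>

datatype letter = Unb nat | Bar nat

definition alphabet :: "nat \<Rightarrow> letter set" where
  "alphabet n = Unb ` {1..n} \<union> Bar ` {1..n}"

definition columns :: "nat \<Rightarrow> nat \<Rightarrow> letter set set" where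
  "columns n p = {C. C \<subseteq> alphabet n \<and> card C = p}"

definition repl :: "letter set \<Rightarrow> letter \<Rightarrow> letter \<Rightarrow> letter set" where
  "repl C a b = (C - {a}) \<union> {b}"

text \<open>The indices \<open>x\<close> such that both \<open>x\<close> and its barred version lie in \<open>C\<close>: this is
  \<open>I\<^sub>C\<close> and also \<open>K\<^sub>C\<close>.\<close>

definition pairs :: "letter set \<Rightarrow> nat set" where
  "pairs C = {x. Unb x \<in> C \<and> Bar x \<in> C}"

definition free_below :: "letter set \<Rightarrow> nat \<Rightarrow> nat set" where
  "free_below C m = {t. 1 \<le> t \<and> t < m \<and> Unb t \<notin> C \<and> Bar t \<notin> C}"

text \<open>In the list \<open>zs\<close>, the doubled letters are in decreasing order.\<close>

definition admissible :: "letter set \<Rightarrow> bool" where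
  "admissible C \<longleftrightarrow>
    (let zs = rev (sorted_list_of_set (pairs C)) in
     \<exists>ts :: nat list. length ts = length zs \<and>
       (\<forall>i < length zs.
          let S = free_below C (if i = 0 then zs ! 0 else min (ts ! (i - 1)) (zs ! i))
          in S \<noteq> {} \<and> ts ! i = Max S))"

definition adm_columns :: "nat \<Rightarrow> nat \<Rightarrow> letter set set" where
  "adm_columns n p = {C \<in> columns n p. admissible C}"

text \<open>\<open>u_of C x\<^sub>i\<close> is \<open>u\<^sub>i\<close>, where \<open>x\<^sub>1 < \<dots> < x\<^sub>r\<close> are the elements of \<open>pairs C\<close>.\<close>

function u_of :: "letter set \<Rightarrow> nat \<Rightarrow> nat" where
  "u_of C x = Max (free_below C x - (\<Union>y\<in>{y \<in> pairs C. y < x}. {u_of C y}))"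
  by pat_completeness auto
termination
  by (relation "measure snd") auto

declare u_of.simps [simp del]

definition col_subst :: "letter set \<Rightarrow> nat set \<Rightarrow> letter set" where
  "col_subst C X =
    (C - (\<Union>x\<in>X. {Unb x, Bar x})) \<union> (\<Union>x\<in>X. {Unb (u_of C x), Bar (u_of C x)})"


section \<open>The module W and its highest weight submodule V\<close>

type_synonym wvec = "letter set \<Rightarrow>\<^sub>0 cq"

definition smul :: "cq \<Rightarrow> wvec \<Rightarrow> wvec" where
  "smul c w = Poly_Mapping.map (\<lambda>x. c * x) w"

definition vb :: "letter set \<Rightarrow> wvec" where
  "vb C = Poly_Mapping.single C 1"

definition Wmod :: "nat \<Rightarrow> nat \<Rightarrow> wvec set" where
  "Wmod n p = {w. Poly_Mapping.keys w \<subseteq> columns n p}"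

definition f_col :: "nat \<Rightarrow> nat \<Rightarrow> letter set \<Rightarrow> wvec" where
  "f_col n i C =
    (if i = n then
       (if Unb n \<in> C \<and> Bar n \<notin> C then vb (repl C (Unb n) (Bar n)) else 0)
     else
       (let a = Unb i; b = Unb (i + 1); b' = Bar (i + 1); a' = Bar i;
            E = C \<inter> {a, b, b', a'}
        in if E = {a} \<or> E = {b', a', a} \<or> E = {a', a} then vb (repl C a b)
           else if E = {b'} \<or> E = {b', a, b} then vb (repl C b' a')
           else if E = {b', b} then smul (inverse qv) (vb (repl C b' a'))
           else if E = {b', a} then vb (repl C a b) + smul qv (vb (repl C b' a'))
           else 0))"

definition e_col :: "nat \<Rightarrow> nat \<Rightarrow> letter set \<Rightarrow> wvec" where
  "e_col n i C =
    (if i = n then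
       (if Bar n \<in> C \<and> Unb n \<notin> C then vb (repl C (Bar n) (Unb n)) else 0)
     else
       (let a = Unb i; b = Unb (i + 1); b' = Bar (i + 1); a' = Bar i;
            E = C \<inter> {a, b, b', a'}
        in if E = {b} \<or> E = {b', a', b} then vb (repl C b a)
           else if E = {a'} \<or> E = {a', a, b} \<or> E = {a', a} then vb (repl C a' b')
           else if E = {b', b} then smul (inverse qv) (vb (repl C b a))
           else if E = {a', b} then vb (repl C a' b') + smul qv (vb (repl C b a))
           else 0))"

definition h_wt :: "nat \<Rightarrow> nat \<Rightarrow> letter set \<Rightarrow> int" where
  "h_wt n i C =
    (if i = n then int (card (C \<inter> {Unb n})) - int (card (C \<inter> {Bar n}))
     else int (card (C \<inter> {Unb i, Bar (i + 1)})) - int (card (C \<inter> {Unb (i + 1), Bar i})))"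

fun gen_col :: "nat \<Rightarrow> gen \<Rightarrow> letter set \<Rightarrow> wvec" where
  "gen_col n (GenE i) C = e_col n i C"
| "gen_col n (GenF i) C = f_col n i C"
| "gen_col n (GenH i) C = smul (qv powi h_wt n i C) (vb C)"
| "gen_col n (GenHinv i) C = smul (qv powi (- h_wt n i C)) (vb C)"

definition gen_act :: "nat \<Rightarrow> gen \<Rightarrow> wvec \<Rightarrow> wvec" where
  "gen_act n g w = (\<Sum>C\<in>Poly_Mapping.keys w. smul (Poly_Mapping.lookup w C) (gen_col n g C))"

definition word_act :: "nat \<Rightarrow> gen fmon \<Rightarrow> wvec \<Rightarrow> wvec" where
  "word_act n m w = foldr (gen_act n) (letters m) w"

definition free_act :: "nat \<Rightarrow> free_elt \<Rightarrow> wvec \<Rightarrow> wvec" where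
  "free_act n x w = (\<Sum>m\<in>Poly_Mapping.keys x. smul (Poly_Mapping.lookup x m) (word_act n m w))"

text \<open>All representatives of an element of \<open>Uq n\<close> act in the same way on \<open>Wmod n p\<close>, since the
  action of the free algebra satisfies the defining relations.\<close>

definition act :: "nat \<Rightarrow> free_elt set \<Rightarrow> wvec \<Rightarrow> wvec" where
  "act n u w = the_elem ((\<lambda>x. free_act n x w) ` u)"

definition hw_vec :: "nat \<Rightarrow> wvec" where
  "hw_vec p = vb (Unb ` {1..p})"

definition Vmod :: "nat \<Rightarrow> nat \<Rightarrow> wvec set" where
  "Vmod n p = (\<lambda>u. act n u (hw_vec p)) ` carrier (Uq n)"

definition VQ :: "nat \<Rightarrow> nat \<Rightarrow> wvec set" where
  "VQ n p = (\<lambda>u. act n u (hw_vec p)) ` UminusQ n"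

definition crystal_lattice :: "nat \<Rightarrow> nat \<Rightarrow> wvec set" where
  "crystal_lattice n p = {w \<in> Wmod n p. \<forall>C. Poly_Mapping.lookup w C \<in> regular_at_0}"


section \<open>The canonical basis\<close>

text \<open>The second condition determines \<open>\<beta>\<close> on \<open>Vmod n p\<close>; its values elsewhere play no role.\<close>

definition is_bar_involution :: "nat \<Rightarrow> nat \<Rightarrow> (wvec \<Rightarrow> wvec) \<Rightarrow> bool" where
  "is_bar_involution n p \<beta> \<longleftrightarrow>
    \<beta> \<in> Vmod n p \<rightarrow> Vmod n p \<and>
    (\<forall>u\<in>carrier (Uq n). \<beta> (act n u (hw_vec p)) = act n (bar_Uq u) (hw_vec p))"

definition is_canonical_basis ::
    "nat \<Rightarrow> nat \<Rightarrow> (wvec \<Rightarrow> wvec) \<Rightarrow> (letter set \<Rightarrow> wvec) \<Rightarrow> bool" where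
  "is_canonical_basis n p \<beta> G \<longleftrightarrow>
    (\<forall>C\<in>adm_columns n p. G C \<in> VQ n p) \<and>
    (\<forall>w\<in>VQ n p. \<exists>!a. a \<in> adm_columns n p \<rightarrow>\<^sub>E rat_laurent \<and>
        w = (\<Sum>C\<in>adm_columns n p. smul (a C) (G C))) \<and>
    (\<forall>C\<in>adm_columns n p. \<beta> (G C) = G C) \<and>
    (\<forall>C\<in>adm_columns n p. G C - vb C \<in> smul qv ` crystal_lattice n p)"

end

theory Submission
  imports Defs
begin

text \<open>
  Read a column as a word over the positions \<open>1, \<dots>, n\<close>, each of which carries nothing, an unbarred
  letter, a barred letter or both; write \<open>0\<close> and \<open>P\<close> for the first and the last possibility. The
  definition of \<open>u\<^sub>i\<close> is parenthesis matching: a \<open>0\<close> opens, a \<open>P\<close> closes, and \<open>u\<^sub>i\<close> is the partner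
  of \<open>x\<^sub>i\<close>. The claimed vector thus puts \<open>v\<^sub>0\<^sub>P + q v\<^sub>P\<^sub>0\<close> on each arc of a noncrossing matching,
  as in the Temperley-Lieb calculus. On such vectors \<open>f\<^sub>i\<close> acts diagrammatically, by moving a
  single letter, creating an arc, joining two arcs, or contracting an arc with factor \<open>q + q\<^sup>-\<^sup>1\<close>;
  hence every divided power of \<open>f\<^sub>i\<close> maps a diagram vector to \<open>0\<close>, \<open>1\<close> or \<open>q + q\<^sup>-\<^sup>1\<close> times a
  diagram vector. As the highest weight vector is a diagram vector, \<open>G(C)\<close> is a Laurent
  combination of diagram vectors, and the bar involution conjugates its coefficients. Each diagram
  vector is a distinct \<open>v\<^sub>D\<close> modulo \<open>q\<close>, so these coefficients are bar invariant and regular at \<open>q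
  = 0\<close>, therefore constant, and reduction modulo \<open>q\<close> leaves a single diagram.
\<close>

text \<open>The obstacle is that the bar involution of V is known only through representatives in
  the quantum group. It is met by carrying a free algebra element x together with its bar image: a
  divided power sends a diagram vector to a bar invariant multiple of a diagram vector, so x and its
  bar image, applied to the highest weight vector, give conjugate coefficients. This presupposes
  that every relator and its bar image act by zero on W, hence the case analysis of the relations.

  Divided powers behave well because the square of \<open>f_i\<close> is nonzero on a diagram only
  if it first creates an arc at i, i + 1 and then contracts it; for i < n the resulting factor q +
  q^-1 is exactly [2]_i!, while for i = n the square is zero.

  The passage from vectors to coefficients rests on a statistic, the sum of the doubled positions.
  Moving a pair from the right to the left end of an arc lowers it, so the lookups at leading
  columns form a unitriangular system. That the leading column determines the diagram requires that
  no unmatched empty position lies below an arc.\<close>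

section \<open>The ground field\<close>

lemma qv_nonzero [simp]: "qv \<noteq> 0"
  by (simp add: qv_def)

lemma qv_power: "qv ^ k = to_fract (Polynomial.monom 1 k)"
  by (induction k) (simp_all add: qv_def monom_Suc monom_0 pCons_one flip: to_fract_mult)

lemma to_fract_const_1 [simp]: "to_fract [:1:] = 1"
  by (simp flip: one_pCons)

section \<open>The bar automorphism of the ground field\<close>

lemma subst_inv_0 [simp]: "subst_inv 0 = 0"
  by (simp add: subst_inv_def)

lemma subst_inv_pCons: "subst_inv (pCons a P) = to_fract [:a:] + inverse qv * subst_inv P"
  by (simp add: subst_inv_def map_poly_pCons)

lemma subst_inv_add [simp]: "subst_inv (P + Q) = subst_inv P + subst_inv Q"
proof (induction P Q rule: poly_induct2)
  case (pCons a p b q)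
  have "to_fract [:a + b:] = to_fract [:a:] + to_fract [:b:]"
    by (simp flip: to_fract_add)
  with pCons show ?case
    by (simp add: subst_inv_pCons algebra_simps)
qed simp

lemma subst_inv_smult: "subst_inv (Polynomial.smult c P) = to_fract [:c:] * subst_inv P"
  by (induction P) (auto simp: subst_inv_pCons algebra_simps simp flip: to_fract_mult pCons_one)

lemma subst_inv_mult [simp]: "subst_inv (P * Q) = subst_inv P * subst_inv Q"
  by (induction P) (auto simp: subst_inv_pCons subst_inv_smult algebra_simps)

lemma subst_inv_const [simp]: "subst_inv [:c:] = to_fract [:c:]"
  by (simp add: subst_inv_pCons)

lemma subst_inv_1 [simp]: "subst_inv 1 = 1"
  by (simp add: one_pCons)

text \<open>Translates statements about q^-1 into statements about polynomials: that no nonzero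
  polynomial vanishes at q^-1, and later that a bar invariant polynomial is constant.\<close>

lemma subst_inv_reflect: "qv ^ degree P * subst_inv P = to_fract (reflect_poly P)"
proof -
  have *: "qv ^ N * subst_inv P = to_fract (Polynomial.monom 1 (N - degree P) * reflect_poly P)"
    if "degree P \<le> N" for N
    using that
  proof (induction P arbitrary: N)
    case (pCons a P)
    show ?case
    proof (cases "P = 0")
      case False
      then obtain M where N: "N = Suc M" "degree P \<le> M"
        using pCons.prems by (cases N) auto
      have "qv ^ N * subst_inv (pCons a P) = qv ^ N * to_fract [:a:] + qv ^ M * subst_inv P"
        by (simp add: subst_inv_pCons N algebra_simps)
      also have "\<dots> = to_fract (Polynomial.monom 1 N * [:a:] + Polynomial.monom 1 (M - degree P) *
          reflect_poly P)"
        using pCons.IH[OF N(2)] unfolding to_fract_add to_fract_mult qv_power by simp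
      also have "Polynomial.monom 1 N * [:a:] + Polynomial.monom 1 (M - degree P) * reflect_poly P
          = Polynomial.monom 1 (N - degree (pCons a P)) * reflect_poly (pCons a P)"
        using False N
        by (auto simp: reflect_poly_pCons' algebra_simps mult_monom monom_0 smult_monom)
      finally show ?thesis .
    qed (auto simp: subst_inv_pCons qv_power simp flip: to_fract_mult pCons_one)
  qed simp
  show ?thesis using *[of "degree P"] by simp
qed

lemma subst_inv_eq_0_iff [simp]: "subst_inv P = 0 \<longleftrightarrow> P = 0"
  using subst_inv_reflect[of P]
  by (metis mult_eq_0_iff power_not_zero qv_nonzero reflect_poly_eq_0_iff subst_inv_0
      to_fract_eq_0_iff)

text \<open>\<open>bar_cq\<close> is defined through the normalised fraction. Two representations of
  one fraction satisfy P b = a Q, and \<open>subst_inv\<close> is multiplicative with trivial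
  kernel. From here on any representation may be used, which gives the laws of a field
  automorphism.\<close>

lemma bar_cq_divide:
  assumes "Q \<noteq> 0"
  shows "bar_cq (to_fract P / to_fract Q) = subst_inv P / subst_inv Q"
proof -
  define x where "x = to_fract P / to_fract Q"
  define a b where "a = fst (quot_of_fract x)" and "b = snd (quot_of_fract x)"
  have b: "b \<noteq> 0"
    by (simp add: b_def)
  have "x = to_fract a / to_fract b"
    unfolding a_def b_def by (simp add: Fract_conv_to_fract[symmetric] Fract_quot_of_fract)
  then have "to_fract (P * b) = to_fract (a * Q)"
    using assms b unfolding x_def to_fract_mult by (simp add: field_simps)
  then have "P * b = a * Q"
    by (simp only: to_fract_eq_iff)
  then have "subst_inv P * subst_inv b = subst_inv a * subst_inv Q"
    by (metis subst_inv_mult)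
  then show ?thesis
    using assms b unfolding bar_cq_def x_def[symmetric] a_def[symmetric] b_def[symmetric]
    by (simp add: field_simps)
qed

lemma cq_cases:
  obtains P Q where "x = to_fract P / to_fract Q" "Q \<noteq> (0 :: complex poly)"
  by (cases x) (auto simp: Fract_conv_to_fract)

lemma bar_cq_to_fract: "bar_cq (to_fract P) = subst_inv P"
  using bar_cq_divide[of 1 P] by simp

lemma bar_cq_mult [simp]: "bar_cq (x * y) = bar_cq x * bar_cq y"
proof -
  obtain P Q where x: "x = to_fract P / to_fract Q" "Q \<noteq> 0" by (rule cq_cases)
  obtain R S where y: "y = to_fract R / to_fract S" "S \<noteq> 0" by (rule cq_cases)
  have "x * y = to_fract (P * R) / to_fract (Q * S)" using x y by simp
  then show ?thesis
    using x y by (simp add: bar_cq_divide del: to_fract_mult)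
qed

lemma bar_cq_add [simp]: "bar_cq (x + y) = bar_cq x + bar_cq y"
proof -
  obtain P Q where x: "x = to_fract P / to_fract Q" "Q \<noteq> 0" by (rule cq_cases)
  obtain R S where y: "y = to_fract R / to_fract S" "S \<noteq> 0" by (rule cq_cases)
  have "x + y = to_fract (P * S + R * Q) / to_fract (Q * S)"
    using x y by (simp add: add_frac_eq)
  then show ?thesis
    using x y by (simp add: bar_cq_divide add_frac_eq del: to_fract_mult to_fract_add)
qed

lemma bar_cq_0 [simp]: "bar_cq 0 = 0"
  using bar_cq_to_fract[of 0] by simp

lemma bar_cq_1 [simp]: "bar_cq 1 = 1"
  using bar_cq_to_fract[of 1] by simp

lemma bar_cq_uminus [simp]: "bar_cq (- x) = - bar_cq x"
  using bar_cq_add[of x "- x"] by (simp add: eq_neg_iff_add_eq_0 add.commute del: bar_cq_add)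

lemma bar_cq_diff [simp]: "bar_cq (x - y) = bar_cq x - bar_cq y"
  using bar_cq_add[of x "- y"] by (simp del: bar_cq_add)

lemma bar_cq_inverse [simp]: "bar_cq (inverse x) = inverse (bar_cq x)"
proof (cases "x = 0")
  case False
  then have "bar_cq x * bar_cq (inverse x) = 1"
    by (simp flip: bar_cq_mult)
  then show ?thesis
    by (metis inverse_unique)
qed simp

lemma bar_cq_power [simp]: "bar_cq (x ^ k) = bar_cq x ^ k"
  by (induction k) auto

lemma bar_cq_qv [simp]: "bar_cq qv = inverse qv"
  by (simp add: qv_def bar_cq_to_fract subst_inv_pCons)

lemma bar_cq_divide' [simp]: "bar_cq (x / y) = bar_cq x / bar_cq y"
  by (simp add: divide_inverse)

lemma bar_cq_qi: "bar_cq (qi n i) = inverse (qi n i)"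
  by (simp add: qi_def power_inverse)

text \<open>Numerator and denominator both change sign. This is why divided powers of the e and f
  generators are fixed by the bar involution.\<close>

lemma bar_cq_qint [simp]: "bar_cq (qint n i m) = qint n i m"
  by (simp add: qint_def bar_cq_qi)
     (metis (no_types, opaque_lifting) minus_diff_eq minus_divide_divide)

lemma bar_cq_prod: "bar_cq (\<Prod>x\<in>S. g x) = (\<Prod>x\<in>S. bar_cq (g x))"
  by (induction S rule: infinite_finite_induct) auto

lemma bar_cq_qfact [simp]: "bar_cq (qfact n i m) = qfact n i m"
  by (simp add: qfact_def bar_cq_prod)

lemma qv_power_neq_1: "0 < k \<Longrightarrow> qv ^ k \<noteq> 1"
proof
  assume k: "0 < k" and "qv ^ k = 1"
  then have "Polynomial.monom (1::complex) k = 1"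
    by (metis qv_power to_fract_1 to_fract_eq_iff)
  then show False
    using k by (metis degree_1 degree_monom_eq neq0_conv zero_neq_one)
qed

lemma qi_nonzero [simp]: "qi n i \<noteq> 0"
  by (simp add: qi_def)

text \<open>The exponents 2 and 4 belong to the two values \<open>qv\<close> and
  \<open>qv ^ 2\<close> of \<open>qi n i\<close>.\<close>

lemma qi_power2_neq_1: "qi n i ^ 2 \<noteq> 1"
  using qv_power_neq_1[of 2] qv_power_neq_1[of 4] by (simp add: qi_def flip: power_mult)

lemma qi_neq_inverse [simp]: "qi n i \<noteq> inverse (qi n i)"
proof
  assume "qi n i = inverse (qi n i)"
  then have "qi n i * qi n i = 1"
    by (metis qi_nonzero right_inverse)
  then show False
    using qi_power2_neq_1[of n i] by (simp add: power2_eq_square)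
qed

lemma qint_1 [simp]: "qint n i (Suc 0) = 1"
  by (simp add: qint_def)

lemma qint_2: "qint n i 2 = qi n i + inverse (qi n i)"
proof -
  have "qi n i ^ 2 - inverse (qi n i) ^ 2 = (qi n i + inverse (qi n i)) * (qi n i - inverse (qi n
      i))"
    by (simp add: power2_eq_square algebra_simps)
  then show ?thesis
    unfolding qint_def by (metis eq_iff_diff_eq_0 nonzero_mult_div_cancel_right qi_neq_inverse)
qed

lemma qfact_0 [simp]: "qfact n i 0 = 1"
  by (simp add: qfact_def)

lemma qfact_1 [simp]: "qfact n i (Suc 0) = 1"
  by (simp add: qfact_def)

lemma qfact_2: "qfact n i 2 = qi n i + inverse (qi n i)"
  using qint_2[of n i] by (simp add: qfact_def numeral_2_eq_2 atLeastAtMostSuc_conv)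

text \<open>Otherwise q would be a fourth root of unity. The inverse of this element is the
  coefficient in a second divided power with i < n.\<close>

lemma qv_add_inverse_nonzero [simp]: "qv + inverse qv \<noteq> 0"
proof
  assume "qv + inverse qv = 0"
  then have "qv * qv = - 1"
    by (metis add_eq_0_iff2 left_inverse minus_mult_right mult.commute qv_nonzero)
  then have "(qv * qv) * (qv * qv) = (- 1) * (- 1)"
    by (simp only:)
  then have "qv ^ 4 = 1"
    by (simp add: power4_eq_xxxx mult.assoc)
  then show False
    using qv_power_neq_1[of 4] by simp
qed

subsection \<open>Laurent polynomials and regular functions\<close>

lemma rat_laurent_0 [simp]: "0 \<in> rat_laurent"
  unfolding rat_laurent_def by (auto intro!: exI[of _ 0])

lemma rat_laurent_1 [simp]: "1 \<in> rat_laurent"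
  unfolding rat_laurent_def by (rule CollectI, rule exI[of _ 1], rule exI[of _ 0]) simp

lemma map_poly_of_rat_add:
  "map_poly (of_rat :: rat \<Rightarrow> complex) (P + Q) = map_poly of_rat P + map_poly of_rat Q"
  by (simp add: poly_eq_iff coeff_map_poly of_rat_add)

lemma map_poly_of_rat_mult:
  "map_poly (of_rat :: rat \<Rightarrow> complex) (P * Q) = map_poly of_rat P * map_poly of_rat Q"
  by (simp add: poly_eq_iff coeff_map_poly coeff_mult of_rat_sum of_rat_mult)

lemma map_poly_of_rat_monom: "map_poly (of_rat :: rat \<Rightarrow> complex) (Polynomial.monom 1 k) =
    Polynomial.monom 1 k"
  by (simp add: map_poly_monom)

lemma rat_laurent_mult: "x \<in> rat_laurent \<Longrightarrow> y \<in> rat_laurent \<Longrightarrow> x * y \<in> rat_laurent"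
proof -
  assume "x \<in> rat_laurent" "y \<in> rat_laurent"
  then obtain P k Q l where "x = to_fract (map_poly of_rat P) / qv ^ k" "y = to_fract (map_poly
      of_rat Q) / qv ^ l"
    unfolding rat_laurent_def by blast
  then have "x * y = to_fract (map_poly of_rat (P * Q)) / qv ^ (k + l)"
    by (simp add: map_poly_of_rat_mult power_add)
  then show ?thesis
    unfolding rat_laurent_def by blast
qed

lemma rat_laurent_add: "x \<in> rat_laurent \<Longrightarrow> y \<in> rat_laurent \<Longrightarrow> x + y \<in> rat_laurent"
proof -
  assume "x \<in> rat_laurent" "y \<in> rat_laurent"
  then obtain P k Q l where "x = to_fract (map_poly of_rat P) / qv ^ k" "y = to_fract (map_poly
      of_rat Q) / qv ^ l"
    unfolding rat_laurent_def by blast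
  then have "x + y = to_fract (map_poly of_rat (P * Polynomial.monom 1 l + Q * Polynomial.monom 1
      k)) / qv ^ (k + l)"
    by (simp add: map_poly_of_rat_mult map_poly_of_rat_add map_poly_of_rat_monom power_add
        add_frac_eq mult.commute flip: qv_power)
  then show ?thesis
    unfolding rat_laurent_def by blast
qed

lemma rat_laurent_minus_1: "- 1 \<in> rat_laurent"
proof -
  have "map_poly (of_rat :: rat \<Rightarrow> complex) (- 1) = - 1"
    by (simp add: poly_eq_iff coeff_map_poly of_rat_minus)
  then have "- 1 = to_fract (map_poly of_rat (- 1 :: rat poly)) / qv ^ 0"
    by simp
  then show ?thesis
    unfolding rat_laurent_def by blast
qed

lemma qv_in_rat_laurent: "qv \<in> rat_laurent"
  unfolding rat_laurent_def
  by (rule CollectI) (intro exI[of _ "Polynomial.monom 1 1"] exI[of _ 0], simp add: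
      map_poly_of_rat_monom flip: qv_power)

lemma inverse_qv_in_rat_laurent: "inverse qv \<in> rat_laurent"
  unfolding rat_laurent_def
  by (rule CollectI) (intro exI[of _ 1] exI[of _ 1], simp add: divide_inverse)

lemma rat_laurent_sum: "(\<And>x. x \<in> S \<Longrightarrow> g x \<in> rat_laurent) \<Longrightarrow> (\<Sum>x\<in>S. g x) \<in> rat_laurent"
  by (induction S rule: infinite_finite_induct) (auto intro: rat_laurent_add)

lemma regular_at_0_iff:
  "x \<in> regular_at_0 \<longleftrightarrow> (\<exists>P Q. x = to_fract P / to_fract Q \<and> poly Q 0 \<noteq> 0)"
  by (auto simp: regular_at_0_def Fract_conv_to_fract)

lemma regular_at_0_to_fract: "to_fract P \<in> regular_at_0"
  unfolding regular_at_0_iff by (rule exI[of _ P], rule exI[of _ 1]) simp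

lemma regular_at_0_add: "x \<in> regular_at_0 \<Longrightarrow> y \<in> regular_at_0 \<Longrightarrow> x + y \<in> regular_at_0"
  unfolding regular_at_0_iff
proof (elim exE conjE, goal_cases)
  case (1 P R Q S)
  then have "x + y = to_fract (P * S + R * Q) / to_fract (Q * S)" "poly (Q * S) 0 \<noteq> 0"
  proof -
    have "Q \<noteq> 0" "S \<noteq> 0" using 1 by auto
    then show "x + y = to_fract (P * S + R * Q) / to_fract (Q * S)"
      using 1 by (simp add: add_frac_eq)
  qed (use 1 in auto)
  then show ?case by blast
qed

lemma regular_at_0_mult: "x \<in> regular_at_0 \<Longrightarrow> y \<in> regular_at_0 \<Longrightarrow> x * y \<in> regular_at_0"
  unfolding regular_at_0_iff
proof (elim exE conjE, goal_cases)
  case (1 P R Q S)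
  then have "x * y = to_fract (P * R) / to_fract (Q * S)" "poly (Q * S) 0 \<noteq> 0"
    by auto
  then show ?case by blast
qed

lemma regular_at_0_0 [simp]: "0 \<in> regular_at_0"
  using regular_at_0_to_fract[of 0] by simp

lemma regular_at_0_1 [simp]: "1 \<in> regular_at_0"
  using regular_at_0_to_fract[of 1] by simp

lemma regular_at_0_qv [simp]: "qv \<in> regular_at_0"
  unfolding qv_def by (rule regular_at_0_to_fract)

lemma regular_at_0_uminus: "x \<in> regular_at_0 \<Longrightarrow> - x \<in> regular_at_0"
  using regular_at_0_mult[OF regular_at_0_to_fract[of "-1"]] by simp

text \<open>Evaluation at q = 0 kills q x, because x has a denominator that does not vanish there.
  Constants therefore survive reduction modulo q.\<close>

lemma regular_const_mod_qv:
  assumes "x \<in> regular_at_0" "to_fract [:c:] = qv * x"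
  shows "c = 0"
proof -
  obtain P Q where x: "x = to_fract P / to_fract Q" "poly Q 0 \<noteq> 0"
    using assms(1) regular_at_0_iff by auto
  then have "Q \<noteq> 0" by auto
  then have "to_fract ([:c:] * Q) = to_fract ([:0, 1:] * P)"
    using assms(2) x unfolding to_fract_mult by (simp add: qv_def field_simps)
  then have "[:c:] * Q = [:0, 1:] * P"
    using to_fract_eq_iff by blast
  then have "poly ([:c:] * Q) 0 = poly ([:0, 1:] * P) 0" by simp
  then show ?thesis using x by simp
qed

text \<open>A denominator q^k would be a pole at 0, so x is a polynomial in q; invariance makes it a
  polynomial in q^-1 as well.\<close>

lemma bar_invariant_regular_laurent:
  assumes "x \<in> rat_laurent" "x \<in> regular_at_0" "bar_cq x = x"
  shows "\<exists>c. x = to_fract [:c:]"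
proof -
  obtain P0 k where "x = to_fract (map_poly of_rat P0) / qv ^ k"
    using assms(1) unfolding rat_laurent_def by blast
  then obtain P where P: "x = to_fract P / qv ^ k" by blast
  obtain R Q where x: "x = to_fract R / to_fract Q" "poly Q 0 \<noteq> 0"
    using assms(2) regular_at_0_iff by auto
  then have "Q \<noteq> 0" by auto
  then have "to_fract (P * Q) = to_fract (Polynomial.monom 1 k * R)"
    using x P unfolding to_fract_mult qv_power[symmetric] by (simp add: field_simps)
  then have "P * Q = Polynomial.monom 1 k * R" using to_fract_eq_iff by blast
  \<comment> \<open>Since Q does not vanish at 0, it is coprime to q, and q^k must divide P: the
    pole cancels.\<close>
  then have "Polynomial.monom 1 k dvd P * Q" by simp
  moreover have "coprime (Polynomial.monom 1 k) Q"
  proof -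
    have "coprime [:0, 1:] Q"
    proof (rule prime_elem_imp_coprime)
      show "prime_elem [:0, 1::complex:]"
        by (intro irreducible_imp_prime_elem irreducible_linear_field_poly) simp
      show "\<not> [:0, 1:] dvd Q"
        using x(2) poly_eq_0_iff_dvd[of Q 0] by simp
    qed
    then show ?thesis
      by (simp add: monom_altdef)
  qed
  ultimately have "Polynomial.monom 1 k dvd P"
    by (simp add: coprime_dvd_mult_left_iff)
  then obtain S where "P = Polynomial.monom 1 k * S" by blast
  then have xS: "x = to_fract S"
    using P by (simp add: qv_power)
  have "qv ^ degree S * to_fract S = to_fract (reflect_poly S)"
    using subst_inv_reflect[of S] assms(3) by (simp add: xS bar_cq_to_fract)
  then have "to_fract (Polynomial.monom 1 (degree S) * S) = to_fract (reflect_poly S)"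
    by (simp add: qv_power)
  then have "Polynomial.monom 1 (degree S) * S = reflect_poly S" using to_fract_eq_iff by blast
  \<comment> \<open>For nonzero S the product has twice the degree of S, while reversing the
    coefficients never raises the degree.\<close>
  then have "degree (Polynomial.monom 1 (degree S) * S) \<le> degree S"
    by (metis degree_reflect_poly_le)
  then have "degree S = 0"
    by (cases "S = 0") (auto simp: degree_mult_eq degree_monom_eq)
  then show ?thesis
    using xS degree_eq_zeroE by blast
qed

section \<open>Linear operators and the action of the free algebra\<close>

lemma lookup_smul [simp]: "Poly_Mapping.lookup (smul c w) D = c * Poly_Mapping.lookup w D"
  by (simp add: smul_def map.rep_eq when_def)

lemma smul_0_left [simp]: "smul 0 w = 0" and smul_0_right [simp]: "smul c 0 = 0"
  and smul_1 [simp]: "smul 1 w = w" and smul_smul [simp]: "smul a (smul b w) = smul (a * b) w"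
  by (rule poly_mapping_eqI; simp)+

lemma smul_add_right: "smul c (v + w) = smul c v + smul c w"
  by (rule poly_mapping_eqI) (simp add: lookup_add algebra_simps)

lemma smul_add_left: "smul (a + b) w = smul a w + smul b w"
  by (rule poly_mapping_eqI) (simp add: lookup_add algebra_simps)

lemma smul_diff_right: "smul c (v - w) = smul c v - smul c w"
  by (rule poly_mapping_eqI) (simp add: lookup_minus algebra_simps)

lemma smul_diff_left: "smul (a - b) w = smul a w - smul b w"
  by (rule poly_mapping_eqI) (simp add: lookup_minus algebra_simps)

lemma smul_minus_left: "smul (- a) w = - smul a w"
  by (rule poly_mapping_eqI) simp

lemma smul_sum_right: "smul c (\<Sum>x\<in>S. g x) = (\<Sum>x\<in>S. smul c (g x))"
  by (induction S rule: infinite_finite_induct) (auto simp: smul_add_right)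

lemma smul_sum_left: "smul (\<Sum>x\<in>S. g x) w = (\<Sum>x\<in>S. smul (g x) w)"
  by (induction S rule: infinite_finite_induct) (auto simp: smul_add_left)

definition linear_op :: "(wvec \<Rightarrow> wvec) \<Rightarrow> bool" where
  "linear_op L \<longleftrightarrow> (\<forall>v w. L (v + w) = L v + L w) \<and> (\<forall>c v. L (smul c v) = smul c (L v))"

lemma linear_op_add: "linear_op L \<Longrightarrow> L (v + w) = L v + L w"
  and linear_op_smul: "linear_op L \<Longrightarrow> L (smul c v) = smul c (L v)"
  by (auto simp: linear_op_def)

lemma linear_op_0: "linear_op L \<Longrightarrow> L 0 = 0"
  by (metis linear_op_smul smul_0_left)

lemma linear_op_sum: "linear_op L \<Longrightarrow> L (\<Sum>x\<in>S. g x) = (\<Sum>x\<in>S. L (g x))"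
  by (induction S rule: infinite_finite_induct) (auto simp: linear_op_0 linear_op_add)

lemma linear_op_id: "linear_op (\<lambda>w. w)" and linear_op_zero: "linear_op (\<lambda>w. 0)"
  by (auto simp: linear_op_def)

lemma linear_op_comp: "linear_op L \<Longrightarrow> linear_op K \<Longrightarrow> linear_op (\<lambda>w. L (K w))"
  by (auto simp: linear_op_def)

lemma linear_op_plus: "linear_op L \<Longrightarrow> linear_op K \<Longrightarrow> linear_op (\<lambda>w. L w + K w)"
  by (auto simp: linear_op_def smul_add_right)

lemma linear_op_scale: "linear_op L \<Longrightarrow> linear_op (\<lambda>w. smul c (L w))"
  by (auto simp: linear_op_def smul_add_right mult.commute)

lemma poly_mapping_sum_single: "x = (\<Sum>k\<in>Poly_Mapping.keys x. Poly_Mapping.single k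
    (Poly_Mapping.lookup x k))"
  by (rule poly_mapping_eqI)
     (auto simp: lookup_sum lookup_single when_def sum.If_cases in_keys_iff)

lemma poly_mapping_additive_induct [case_names zero single add]:
  assumes "P 0" "\<And>k c. P (Poly_Mapping.single k c)" "\<And>x y. P x \<Longrightarrow> P y \<Longrightarrow> P (x + y)"
  shows "P (x :: 'a \<Rightarrow>\<^sub>0 'b::comm_monoid_add)"
proof -
  have "P (\<Sum>k\<in>S. Poly_Mapping.single k (Poly_Mapping.lookup x k))" if "finite S" for S
    using that by (induction S) (auto intro: assms)
  then show ?thesis
    using poly_mapping_sum_single[of x] finite_keys by metis
qed

lemma single_eq_smul_vb: "Poly_Mapping.single C c = smul c (vb C)"
  by (rule poly_mapping_eqI) (auto simp: vb_def lookup_single when_def)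

lemma linear_op_eqI:
  assumes "linear_op L" "linear_op K" "\<And>C. L (vb C) = K (vb C)"
  shows "L w = K w"
  by (induction w rule: poly_mapping_additive_induct)
     (auto simp: linear_op_0 linear_op_add linear_op_smul assms single_eq_smul_vb)

text \<open>Serves for a generator acting on W, with columns as basis, and for the free algebra
  acting on a fixed vector, with words as basis. Both kinds of linearity come from the same
  lemmas.\<close>

definition lext :: "('k \<Rightarrow> wvec) \<Rightarrow> ('k \<Rightarrow>\<^sub>0 cq) \<Rightarrow> wvec" where
  "lext h x = (\<Sum>k\<in>Poly_Mapping.keys x. smul (Poly_Mapping.lookup x k) (h k))"

lemma lext_add: "lext h (x + y) = lext h x + lext h y"
  unfolding lext_def by (rule setsum_keys_plus_distrib) (auto simp: smul_add_left)

lemma lext_single [simp]: "lext h (Poly_Mapping.single k c) = smul c (h k)"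
  by (auto simp: lext_def)

lemma lext_0 [simp]: "lext h 0 = 0"
  by (simp add: lext_def)

lemma lext_uminus: "lext h (- x) = - lext h x"
  by (metis add_eq_0_iff lext_0 lext_add)

lemma lext_diff: "lext h (x - y) = lext h x - lext h y"
  by (metis add_diff_cancel_right' diff_add_cancel lext_add)

lemma lext_vb [simp]: "lext h (vb C) = h C"
  by (simp add: vb_def)

lemma linear_op_lext: "linear_op (lext h)"
proof -
  have "lext h (smul c w) = smul c (lext h w)" for c w
  proof (induction w rule: poly_mapping_additive_induct)
    case (single k d)
    have "smul c (Poly_Mapping.single k d) = Poly_Mapping.single k (c * d)"
      by (simp add: single_eq_smul_vb)
    then show ?case by simp
  qed (auto simp: lext_add smul_add_right)
  then show ?thesis
    by (simp add: linear_op_def lext_add)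
qed

lemma lext_op_add: "(\<And>k. h k = g k + f k) \<Longrightarrow> lext h x = lext g x + lext f x"
  by (simp add: lext_def smul_add_right sum.distrib)

lemma lext_op_smul: "(\<And>k. h k = smul c (g k)) \<Longrightarrow> lext h x = smul c (lext g x)"
  by (simp add: lext_def smul_sum_right mult.commute)

lemma gen_act_lext: "gen_act n g = lext (gen_col n g)"
  by (rule ext) (simp add: gen_act_def lext_def)

lemma free_act_lext: "free_act n x w = lext (\<lambda>m. word_act n m w) x"
  by (simp add: free_act_def lext_def)

lemma linear_op_gen_act: "linear_op (gen_act n g)"
  by (simp add: gen_act_lext linear_op_lext)

lemma gen_act_vb: "gen_act n g (vb C) = gen_col n g C"
  by (simp add: gen_act_lext)

lemma linear_op_word_act: "linear_op (word_act n m)"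
proof -
  have "linear_op (\<lambda>w. foldr (gen_act n) l w)" for l
    by (induction l) (auto intro: linear_op_id linear_op_comp linear_op_gen_act)
  then show ?thesis unfolding word_act_def .
qed

lemma word_act_add: "word_act n (k + l) w = word_act n k (word_act n l w)"
  by (simp add: word_act_def plus_fmon_def)

lemma linear_op_free_act: "linear_op (free_act n x)"
  unfolding linear_op_def free_act_lext
  using linear_op_word_act[of n]
  by (auto intro!: lext_op_add lext_op_smul simp: linear_op_def)

lemma free_act_0 [simp]: "free_act n 0 w = 0"
  by (simp add: free_act_lext)

lemma free_act_add: "free_act n (x + y) w = free_act n x w + free_act n y w"
  by (simp add: free_act_lext lext_add)

lemma free_act_diff: "free_act n (x - y) w = free_act n x w - free_act n y w"
  by (simp add: free_act_lext lext_diff)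

lemma free_act_uminus: "free_act n (- x) w = - free_act n x w"
  by (simp add: free_act_lext lext_uminus)

lemma free_act_sum: "free_act n (\<Sum>s\<in>S. g s) w = (\<Sum>s\<in>S. free_act n (g s) w)"
  by (induction S rule: infinite_finite_induct) (auto simp: free_act_add)

lemma free_act_mult: "free_act n (x * y) w = free_act n x (free_act n y w)"
proof (induction x rule: poly_mapping_additive_induct)
  case (single k c)
  show ?case
  proof (induction y rule: poly_mapping_additive_induct)
    case (single l d)
    show ?case
      using linear_op_word_act[of n k]
      by (simp add: mult_single free_act_lext word_act_add linear_op_def)
  next
    case (add x y)
    then show ?case
      by (simp add: distrib_left free_act_add linear_op_add[OF linear_op_free_act])
  qed (simp add: linear_op_0[OF linear_op_free_act])
qed (auto simp: distrib_right free_act_add)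

lemma free_act_scal [simp]: "free_act n (scal c) w = smul c w"
  by (simp add: scal_def free_act_lext word_act_def zero_fmon_def)

lemma free_act_1 [simp]: "free_act n 1 w = w"
  using free_act_scal[of n 1 w] by (simp add: scal_def)

lemma free_act_gelt [simp]: "free_act n (gelt g) w = gen_act n g w"
  by (simp add: gelt_def free_act_lext word_act_def)

lemma free_act_power: "free_act n (x ^ k) w = ((free_act n x) ^^ k) w"
  by (induction k) (auto simp: free_act_mult)

lemma free_act_sign: "free_act n ((- 1) ^ k * x) w = smul ((- 1) ^ k) (free_act n x w)"
  by (induction k) (auto simp: free_act_uminus smul_minus_left)

section \<open>The bar involution on the free algebra\<close>

lemma bar_free_add: "bar_free (x + y) = bar_free x + bar_free y"
  unfolding bar_free_def by (rule setsum_keys_plus_distrib) (auto simp: single_add)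

lemma bar_free_0 [simp]: "bar_free 0 = 0"
  by (simp add: bar_free_def)

lemma bar_free_single:
  "bar_free (Poly_Mapping.single k c) = Poly_Mapping.single (Word (map bar_gen (letters k)))
      (bar_cq c)"
  by (simp add: bar_free_def)

lemma bar_free_uminus: "bar_free (- x) = - bar_free x"
  by (metis add_eq_0_iff bar_free_0 bar_free_add)

lemma bar_free_diff: "bar_free (x - y) = bar_free x - bar_free y"
  by (metis add_diff_cancel_right' diff_add_cancel bar_free_add)

lemma bar_free_sum: "bar_free (\<Sum>s\<in>S. g s) = (\<Sum>s\<in>S. bar_free (g s))"
  by (induction S rule: infinite_finite_induct) (auto simp: bar_free_add)

lemma bar_free_mult: "bar_free (x * y) = bar_free x * bar_free y"
proof (induction x rule: poly_mapping_additive_induct)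
  case (single k c)
  show ?case
    by (induction y rule: poly_mapping_additive_induct)
       (auto simp: mult_single bar_free_single plus_fmon_def distrib_left bar_free_add)
qed (auto simp: distrib_right bar_free_add)

lemma bar_free_scal [simp]: "bar_free (scal c) = scal (bar_cq c)"
  by (simp add: scal_def bar_free_single zero_fmon_def)

lemma bar_free_1 [simp]: "bar_free 1 = 1"
  using bar_free_scal[of 1] by (simp add: scal_def)

lemma bar_free_gelt [simp]: "bar_free (gelt g) = gelt (bar_gen g)"
  by (simp add: gelt_def bar_free_single)

lemma bar_free_power: "bar_free (x ^ k) = bar_free x ^ k"
  by (induction k) (auto simp: bar_free_mult)

section \<open>Columns as configurations of sites\<close>

datatype site = Vac | Plus | Minus | Dbl

text \<open>Configurations on all natural numbers correspond bijectively to sets of letters, with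
  inverse \<open>sites\<close>. Positions 0 and n + 1 are thus available as neighbours, and no side
  condition on columns has to be carried along.\<close>

definition col :: "(nat \<Rightarrow> site) \<Rightarrow> letter set" where
  "col \<sigma> = {Unb x | x. \<sigma> x \<in> {Plus, Dbl}} \<union> {Bar x | x. \<sigma> x \<in> {Minus, Dbl}}"

definition sites :: "letter set \<Rightarrow> nat \<Rightarrow> site" where
  "sites C x = (if Unb x \<in> C then if Bar x \<in> C then Dbl else Plus
                else if Bar x \<in> C then Minus else Vac)"

lemma Unb_in_col [simp]: "Unb x \<in> col \<sigma> \<longleftrightarrow> \<sigma> x = Plus \<or> \<sigma> x = Dbl"
  and Bar_in_col [simp]: "Bar x \<in> col \<sigma> \<longleftrightarrow> \<sigma> x = Minus \<or> \<sigma> x = Dbl"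
  by (auto simp: col_def)

lemma letter_set_eq_iff:
  "C = D \<longleftrightarrow> (\<forall>x. Unb x \<in> C \<longleftrightarrow> Unb x \<in> D) \<and> (\<forall>x. Bar x \<in> C \<longleftrightarrow> Bar x \<in> D)"
  by (metis letter.exhaust subset_antisym subsetI)

lemma sites_col [simp]: "sites (col \<sigma>) = \<sigma>"
  by (rule ext) (auto simp: sites_def, metis site.exhaust)

lemma col_sites [simp]: "col (sites C) = C"
  by (auto simp: letter_set_eq_iff sites_def)

lemma col_eq_iff [simp]: "col \<sigma> = col \<tau> \<longleftrightarrow> \<sigma> = \<tau>"
  by (metis sites_col)

definition V :: "(nat \<Rightarrow> site) \<Rightarrow> wvec" where
  "V \<sigma> = vb (col \<sigma>)"

lemma lookup_V: "Poly_Mapping.lookup (V \<sigma>) (col \<tau>) = (if \<sigma> = \<tau> then 1 else 0)"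
  by (simp add: V_def vb_def lookup_single when_def)

lemma linear_op_eqI_V:
  assumes "linear_op L" "linear_op K" "\<And>\<sigma>. L (V \<sigma>) = K (V \<sigma>)"
  shows "L w = K w"
proof (rule linear_op_eqI[OF assms(1,2)])
  show "L (vb C) = K (vb C)" for C
    using assms(3)[of "sites C"] by (simp add: V_def)
qed

subsection \<open>The generators as operators on two neighbouring sites\<close>

text \<open>The clauses returning \<open>s\<close> imitate insertion into and deletion from a set,
  so that \<open>repl_col\<close> needs no hypothesis on which letters are present.\<close>

fun add_unb where "add_unb Vac = Plus" | "add_unb Minus = Dbl" | "add_unb s = s"
fun del_unb where "del_unb Plus = Vac" | "del_unb Dbl = Minus" | "del_unb s = s"
fun add_bar where "add_bar Vac = Minus" | "add_bar Plus = Dbl" | "add_bar s = s"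
fun del_bar where "del_bar Minus = Vac" | "del_bar Dbl = Plus" | "del_bar s = s"

lemma repl_col:
  "x \<noteq> y \<Longrightarrow> repl (col \<sigma>) (Unb x) (Unb y) = col (\<sigma>(x := del_unb (\<sigma> x), y := add_unb (\<sigma> y)))"
  "x \<noteq> y \<Longrightarrow> repl (col \<sigma>) (Bar x) (Bar y) = col (\<sigma>(x := del_bar (\<sigma> x), y := add_bar (\<sigma> y)))"
  "repl (col \<sigma>) (Unb x) (Bar x) = col (\<sigma>(x := add_bar (del_unb (\<sigma> x))))"
  "repl (col \<sigma>) (Bar x) (Unb x) = col (\<sigma>(x := add_unb (del_bar (\<sigma> x))))"
proof -
  have U: "(add_unb s = Plus \<or> add_unb s = Dbl) \<longleftrightarrow> True" "(add_unb s = Minus \<or> add_unb s = Dbl) \<longleftrightarrow>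
      (s = Minus \<or> s = Dbl)"
    "(del_unb s = Plus \<or> del_unb s = Dbl) \<longleftrightarrow> False" "(del_unb s = Minus \<or> del_unb s = Dbl) \<longleftrightarrow> (s =
        Minus \<or> s = Dbl)"
    "(add_bar s = Plus \<or> add_bar s = Dbl) \<longleftrightarrow> (s = Plus \<or> s = Dbl)" "(add_bar s = Minus \<or> add_bar s
        = Dbl) \<longleftrightarrow> True"
    "(del_bar s = Plus \<or> del_bar s = Dbl) \<longleftrightarrow> (s = Plus \<or> s = Dbl)" "(del_bar s = Minus \<or> del_bar s
        = Dbl) \<longleftrightarrow> False" for s
    by (cases s; simp)+
  show "x \<noteq> y \<Longrightarrow> repl (col \<sigma>) (Unb x) (Unb y) = col (\<sigma>(x := del_unb (\<sigma> x), y := add_unb (\<sigma> y)))"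
    "x \<noteq> y \<Longrightarrow> repl (col \<sigma>) (Bar x) (Bar y) = col (\<sigma>(x := del_bar (\<sigma> x), y := add_bar (\<sigma> y)))"
    "repl (col \<sigma>) (Unb x) (Bar x) = col (\<sigma>(x := add_bar (del_unb (\<sigma> x))))"
    "repl (col \<sigma>) (Bar x) (Unb x) = col (\<sigma>(x := add_unb (del_bar (\<sigma> x))))"
    by (auto simp: letter_set_eq_iff repl_def U)
qed

lemma inter_four:
  assumes "distinct [a, b, c, d]" and "E = C \<inter> {a, b, c, d}"
  shows "E = {a} \<longleftrightarrow> a \<in> C \<and> b \<notin> C \<and> c \<notin> C \<and> d \<notin> C"
    "E = {b} \<longleftrightarrow> a \<notin> C \<and> b \<in> C \<and> c \<notin> C \<and> d \<notin> C"
    "E = {c} \<longleftrightarrow> a \<notin> C \<and> b \<notin> C \<and> c \<in> C \<and> d \<notin> C"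
    "E = {d} \<longleftrightarrow> a \<notin> C \<and> b \<notin> C \<and> c \<notin> C \<and> d \<in> C"
    "E = {c, d, a} \<longleftrightarrow> a \<in> C \<and> b \<notin> C \<and> c \<in> C \<and> d \<in> C"
    "E = {c, d, b} \<longleftrightarrow> a \<notin> C \<and> b \<in> C \<and> c \<in> C \<and> d \<in> C"
    "E = {d, a} \<longleftrightarrow> a \<in> C \<and> b \<notin> C \<and> c \<notin> C \<and> d \<in> C"
    "E = {c, a, b} \<longleftrightarrow> a \<in> C \<and> b \<in> C \<and> c \<in> C \<and> d \<notin> C"
    "E = {d, a, b} \<longleftrightarrow> a \<in> C \<and> b \<in> C \<and> c \<notin> C \<and> d \<in> C"
    "E = {c, b} \<longleftrightarrow> a \<notin> C \<and> b \<in> C \<and> c \<in> C \<and> d \<notin> C"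
    "E = {d, b} \<longleftrightarrow> a \<notin> C \<and> b \<in> C \<and> c \<notin> C \<and> d \<in> C"
    "E = {c, a} \<longleftrightarrow> a \<in> C \<and> b \<notin> C \<and> c \<in> C \<and> d \<notin> C"
proof -
  have i: "(C \<inter> {a, b, c, d} = S) \<longleftrightarrow> (a \<in> C \<longleftrightarrow> a \<in> S) \<and> (b \<in> C \<longleftrightarrow> b \<in> S) \<and> (c \<in> C \<longleftrightarrow> c \<in> S) \<and> (d \<in> C \<longleftrightarrow>
      d \<in> S)"
    if "S \<subseteq> {a, b, c, d}" for S
    using that by blast
  show "E = {a} \<longleftrightarrow> a \<in> C \<and> b \<notin> C \<and> c \<notin> C \<and> d \<notin> C"
    "E = {b} \<longleftrightarrow> a \<notin> C \<and> b \<in> C \<and> c \<notin> C \<and> d \<notin> C"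
    "E = {c} \<longleftrightarrow> a \<notin> C \<and> b \<notin> C \<and> c \<in> C \<and> d \<notin> C"
    "E = {d} \<longleftrightarrow> a \<notin> C \<and> b \<notin> C \<and> c \<notin> C \<and> d \<in> C"
    "E = {c, d, a} \<longleftrightarrow> a \<in> C \<and> b \<notin> C \<and> c \<in> C \<and> d \<in> C"
    "E = {c, d, b} \<longleftrightarrow> a \<notin> C \<and> b \<in> C \<and> c \<in> C \<and> d \<in> C"
    "E = {d, a} \<longleftrightarrow> a \<in> C \<and> b \<notin> C \<and> c \<notin> C \<and> d \<in> C"
    "E = {c, a, b} \<longleftrightarrow> a \<in> C \<and> b \<in> C \<and> c \<in> C \<and> d \<notin> C"
    "E = {d, a, b} \<longleftrightarrow> a \<in> C \<and> b \<in> C \<and> c \<notin> C \<and> d \<in> C"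
    "E = {c, b} \<longleftrightarrow> a \<notin> C \<and> b \<in> C \<and> c \<in> C \<and> d \<notin> C"
    "E = {d, b} \<longleftrightarrow> a \<notin> C \<and> b \<in> C \<and> c \<notin> C \<and> d \<in> C"
    "E = {c, a} \<longleftrightarrow> a \<in> C \<and> b \<notin> C \<and> c \<in> C \<and> d \<notin> C"
    using assms(1) unfolding assms(2) by (subst i; auto)+
qed

text \<open>For \<open>i = n\<close> the tables fix the state at the extra position \<open>n + 1\<close>, so that every generator acts
  on two neighbouring positions.\<close>

definition ftab :: "nat \<Rightarrow> nat \<Rightarrow> site \<Rightarrow> site \<Rightarrow> (cq \<times> site \<times> site) list" where
  "ftab n i a b =
    (if i = n then (if a = Plus then [(1, Minus, b)] else [])
     else (case (a, b) of
        (Plus, Vac) \<Rightarrow> [(1, Vac, Plus)]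
      | (Dbl, Minus) \<Rightarrow> [(1, Minus, Dbl)]
      | (Dbl, Vac) \<Rightarrow> [(1, Minus, Plus)]
      | (Vac, Minus) \<Rightarrow> [(1, Minus, Vac)]
      | (Plus, Dbl) \<Rightarrow> [(1, Dbl, Plus)]
      | (Vac, Dbl) \<Rightarrow> [(inverse qv, Minus, Plus)]
      | (Plus, Minus) \<Rightarrow> [(1, Vac, Dbl), (qv, Dbl, Vac)]
      | _ \<Rightarrow> []))"

definition etab :: "nat \<Rightarrow> nat \<Rightarrow> site \<Rightarrow> site \<Rightarrow> (cq \<times> site \<times> site) list" where
  "etab n i a b =
    (if i = n then (if a = Minus then [(1, Plus, b)] else [])
     else (case (a, b) of
        (Vac, Plus) \<Rightarrow> [(1, Plus, Vac)]
      | (Minus, Dbl) \<Rightarrow> [(1, Dbl, Minus)]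
      | (Dbl, Vac) \<Rightarrow> [(1, Plus, Minus)]
      | (Minus, Vac) \<Rightarrow> [(1, Vac, Minus)]
      | (Dbl, Plus) \<Rightarrow> [(1, Plus, Dbl)]
      | (Vac, Dbl) \<Rightarrow> [(inverse qv, Plus, Minus)]
      | (Minus, Plus) \<Rightarrow> [(1, Vac, Dbl), (qv, Dbl, Vac)]
      | _ \<Rightarrow> []))"

definition loc :: "(site \<Rightarrow> site \<Rightarrow> (cq \<times> site \<times> site) list) \<Rightarrow> nat \<Rightarrow> (nat \<Rightarrow> site) \<Rightarrow> wvec" where
  "loc t i \<sigma> = (\<Sum>(c, a, b) \<leftarrow> t (\<sigma> i) (\<sigma> (Suc i)). smul c (V (\<sigma>(i := a, Suc i := b))))"

lemma loc_alt:
  "loc t i \<sigma> = (\<Sum>x\<leftarrow>t (\<sigma> i) (\<sigma> (Suc i)).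
     smul (fst x) (V (\<sigma>(i := fst (snd x), Suc i := snd (snd x)))))"
  by (simp add: loc_def split_def)

lemma fun_upd_triv2: "\<sigma>(i := a, Suc i := \<sigma> (Suc i)) = \<sigma>(i := a)"
  by auto

lemma f_col_loc: "f_col n i (col \<sigma>) = loc (ftab n i) i \<sigma>"
proof (cases "i = n")
  case True
  then show ?thesis
    by (cases "\<sigma> n") (simp_all add: f_col_def loc_def ftab_def V_def repl_col fun_upd_triv2)
next
  case False
  have d: "distinct [Unb i, Unb (i + 1), Bar (i + 1), Bar i]"
    by simp
  show ?thesis
    unfolding f_col_def Let_def inter_four[OF d refl] if_not_P[OF False] loc_def ftab_def
    by (cases "\<sigma> i"; cases "\<sigma> (Suc i)") (simp_all add: V_def repl_col fun_upd_twist[of i "Suc i"])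
qed

lemma e_col_loc: "e_col n i (col \<sigma>) = loc (etab n i) i \<sigma>"
proof (cases "i = n")
  case True
  then show ?thesis
    by (cases "\<sigma> n") (simp_all add: e_col_def loc_def etab_def V_def repl_col fun_upd_triv2)
next
  case False
  have d: "distinct [Unb i, Unb (i + 1), Bar (i + 1), Bar i]"
    by simp
  show ?thesis
    unfolding e_col_def Let_def inter_four[OF d refl] if_not_P[OF False] loc_def etab_def
    by (cases "\<sigma> i"; cases "\<sigma> (Suc i)") (simp_all add: V_def repl_col fun_upd_twist[of i "Suc i"])
qed

abbreviation Fop :: "nat \<Rightarrow> nat \<Rightarrow> wvec \<Rightarrow> wvec" where "Fop n i \<equiv> gen_act n (GenF i)"
abbreviation Eop :: "nat \<Rightarrow> nat \<Rightarrow> wvec \<Rightarrow> wvec" where "Eop n i \<equiv> gen_act n (GenE i)"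
abbreviation Hop :: "nat \<Rightarrow> nat \<Rightarrow> wvec \<Rightarrow> wvec" where "Hop n i \<equiv> gen_act n (GenH i)"
abbreviation Kop :: "nat \<Rightarrow> nat \<Rightarrow> wvec \<Rightarrow> wvec" where "Kop n i \<equiv> gen_act n (GenHinv i)"

lemma Fop_V: "Fop n i (V \<sigma>) = loc (ftab n i) i \<sigma>"
  by (simp add: V_def gen_act_vb f_col_loc)

lemma Eop_V: "Eop n i (V \<sigma>) = loc (etab n i) i \<sigma>"
  by (simp add: V_def gen_act_vb e_col_loc)

definition swt :: "site \<Rightarrow> int" where
  "swt s = (case s of Plus \<Rightarrow> 1 | Minus \<Rightarrow> -1 | _ \<Rightarrow> 0)"

definition hwt :: "nat \<Rightarrow> nat \<Rightarrow> (nat \<Rightarrow> site) \<Rightarrow> int" where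
  "hwt n i \<sigma> = swt (\<sigma> i) - (if i = n then 0 else swt (\<sigma> (Suc i)))"

lemma h_wt_col: "h_wt n i (col \<sigma>) = hwt n i \<sigma>"
  unfolding h_wt_def hwt_def swt_def
  by (cases "i = n"; cases "\<sigma> i"; cases "\<sigma> (Suc i)") (simp_all add: Int_insert_right)

lemma Hop_V: "Hop n i (V \<sigma>) = smul (qv powi hwt n i \<sigma>) (V \<sigma>)"
  by (simp add: V_def gen_act_vb h_wt_col)

lemma Kop_V: "Kop n i (V \<sigma>) = smul (qv powi (- hwt n i \<sigma>)) (V \<sigma>)"
  by (simp add: V_def gen_act_vb h_wt_col)

lemma linear_op_sum_list: "linear_op L \<Longrightarrow> L (\<Sum>x\<leftarrow>xs. g x) = (\<Sum>x\<leftarrow>xs. L (g x))"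
  by (induction xs) (auto simp: linear_op_0 linear_op_add)

lemma sum_list_swap:
  "(\<Sum>x\<leftarrow>xs. \<Sum>y\<leftarrow>ys. g x y) = (\<Sum>y\<leftarrow>ys. \<Sum>x\<leftarrow>xs. (g x y :: 'a::comm_monoid_add))"
  by (induction xs) (auto simp: sum_list_addf)

text \<open>The two operators rewrite disjoint pairs of positions, with coefficients depending only
  on these pairs, so the double sums agree after exchanging the order of summation.\<close>

lemma loc_commute:
  assumes L: "linear_op L" "\<And>\<sigma>. L (V \<sigma>) = loc s i \<sigma>"
    and K: "linear_op K" "\<And>\<sigma>. K (V \<sigma>) = loc t j \<sigma>"
    and far: "Suc i < j \<or> Suc j < i"
  shows "L (K w) = K (L w)"
proof (rule linear_op_eqI_V[of "\<lambda>w. L (K w)" "\<lambda>w. K (L w)"])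
  fix \<sigma> :: "nat \<Rightarrow> site"
  have ne: "i \<noteq> j" "i \<noteq> Suc j" "Suc i \<noteq> j" "j \<noteq> i" "Suc j \<noteq> i" "j \<noteq> Suc i"
    using far by auto
  have tw: "\<sigma>(j := a, Suc j := b, i := c, Suc i := d) = \<sigma>(i := c, Suc i := d, j := a, Suc j := b)"
      for a b c d
    using far by (auto simp: fun_eq_iff)
  have "L (K (V \<sigma>)) = (\<Sum>y\<leftarrow>t (\<sigma> j) (\<sigma> (Suc j)). \<Sum>x\<leftarrow>s (\<sigma> i) (\<sigma> (Suc i)).
      smul (fst y * fst x) (V (\<sigma>(j := fst (snd y), Suc j := snd (snd y), i := fst (snd x), Suc i
          := snd (snd x)))))"
    by (simp add: ne L K loc_alt linear_op_sum_list[OF L(1)] linear_op_smul[OF L(1)]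
        linear_op_sum_list[OF linear_op_scale[OF linear_op_id]])
  also have "\<dots> = K (L (V \<sigma>))"
    unfolding sum_list_swap[of _ _ "t _ _"] tw
    by (simp add: ne L K loc_alt linear_op_sum_list[OF K(1)] linear_op_smul[OF K(1)]
        linear_op_sum_list[OF linear_op_scale[OF linear_op_id]] mult.commute)
  finally show "L (K (V \<sigma>)) = K (L (V \<sigma>))" .
qed (auto intro: linear_op_comp L K)

text \<open>Relations between generators with equal or adjacent indices involve at most three
  consecutive positions. Fixing the rest of \<sigma> turns each of them into a finite check over the
  states of these positions.\<close>

definition V3 :: "nat \<Rightarrow> (nat \<Rightarrow> site) \<Rightarrow> site \<Rightarrow> site \<Rightarrow> site \<Rightarrow> wvec" where
  "V3 i \<sigma> a b c = V (\<sigma>(i := a, Suc i := b, Suc (Suc i) := c))"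

lemma op_V3_left:
  assumes "\<And>\<sigma>. L (V \<sigma>) = loc t i \<sigma>"
  shows "L (V3 i \<sigma> a b c) = (\<Sum>(k, a', b') \<leftarrow> t a b. smul k (V3 i \<sigma> a' b' c))"
proof -
  have "\<sigma>(i := a, Suc i := b, Suc (Suc i) := c, i := a', Suc i := b')
      = \<sigma>(i := a', Suc i := b', Suc (Suc i) := c)" for a' b'
    by auto
  then show ?thesis
    by (simp add: V3_def assms loc_def)
qed

lemma op_V3_right:
  assumes "\<And>\<sigma>. L (V \<sigma>) = loc t j \<sigma>" and j: "j = Suc i"
  shows "L (V3 i \<sigma> a b c) = (\<Sum>(k, b', c') \<leftarrow> t b c. smul k (V3 i \<sigma> a b' c'))"
proof -
  have "\<sigma>(i := a, Suc i := b, Suc (Suc i) := c, Suc i := b', Suc (Suc i) := c')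
      = \<sigma>(i := a, Suc i := b', Suc (Suc i) := c')" for b' c'
    by auto
  then show ?thesis
    by (simp add: V3_def assms loc_def)
qed

lemmas V3_simps =
  op_V3_left[OF Fop_V] op_V3_right[OF Fop_V] op_V3_left[OF Eop_V] op_V3_right[OF Eop_V]

lemma V_eq_V3: "V \<sigma> = V3 i \<sigma> (\<sigma> i) (\<sigma> (Suc i)) (\<sigma> (Suc (Suc i)))"
  by (simp add: V3_def)

lemma linear_op_eqI_V3:
  assumes "linear_op L" "linear_op K" "\<And>\<sigma> a b c. L (V3 i \<sigma> a b c) = K (V3 i \<sigma> a b c)"
  shows "L w = K w"
  by (rule linear_op_eqI_V[OF assms(1,2)]) (simp only: V_eq_V3[of _ i] assms(3))

lemmas linear_op_intros = linear_op_comp[OF linear_op_gen_act] linear_op_plus linear_op_scale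
  linear_op_gen_act linear_op_id linear_op_zero

lemmas gen_act_linear = linear_op_add[OF linear_op_gen_act] linear_op_smul[OF linear_op_gen_act]
  linear_op_0[OF linear_op_gen_act]

section \<open>The relations of the quantum group\<close>

lemma swt_simps [simp]: "swt Vac = 0" "swt Plus = 1" "swt Minus = -1" "swt Dbl = 0"
  by (simp_all add: swt_def)

lemma ftab_weight:
  assumes "(c, a', b') \<in> set (ftab n j a b)"
  shows "swt a' = swt a - (if j = n then 2 else 1)" "swt b' = swt b + (if j = n then 0 else 1)"
  using assms unfolding ftab_def by (cases a; cases b; auto split: if_splits)+

lemma etab_weight:
  assumes "(c, a', b') \<in> set (etab n j a b)"
  shows "swt a' = swt a + (if j = n then 2 else 1)" "swt b' = swt b - (if j = n then 0 else 1)"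
  using assms unfolding etab_def by (cases a; cases b; auto split: if_splits)+

text \<open>The parameter d is the sign of the generator, 1 for e and -1 for f. The hypotheses say
  that the weight changes by d times the simple root, which is eps_j - eps_(j+1) for j < n and 2
  eps_n for j = n; \<open>hwt n i\<close> pairs a weight with the i-th coroot.\<close>

lemma hwt_upd_cartan:
  assumes "swt a' = swt (\<sigma> j) + d * (if j = n then 2 else 1)"
    "swt b' = swt (\<sigma> (Suc j)) - d * (if j = n then 0 else 1)" "i \<le> n" "j \<le> n"
  shows "hwt n i (\<sigma>(j := a', Suc j := b')) = hwt n i \<sigma> + d * cartan n i j"
proof -
  consider "i = j" | "i = Suc j" | "j = Suc i" | "Suc i < j" | "Suc j < i" by linarith
  then show ?thesis
    by cases (use assms in \<open>simp_all add: hwt_def cartan_def\<close>)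
qed

lemma weight_step:
  assumes "(c, a, b) \<in> set (ftab n j (\<sigma> j) (\<sigma> (Suc j)))" "i \<le> n" "j \<le> n"
  shows "hwt n i (\<sigma>(j := a, Suc j := b)) = hwt n i \<sigma> - cartan n i j"
proof -
  have "hwt n i (\<sigma>(j := a, Suc j := b)) = hwt n i \<sigma> + (-1) * cartan n i j"
  proof (rule hwt_upd_cartan)
    show "swt a = swt (\<sigma> j) + (-1) * (if j = n then 2 else 1)"
      unfolding ftab_weight(1)[OF assms(1)] by (cases "j = n") simp_all
    show "swt b = swt (\<sigma> (Suc j)) - (-1) * (if j = n then 0 else 1)"
      unfolding ftab_weight(2)[OF assms(1)] by (cases "j = n") simp_all
  qed (fact assms)+
  then show ?thesis by simp
qed

lemma weight_step_e:
  assumes "(c, a, b) \<in> set (etab n j (\<sigma> j) (\<sigma> (Suc j)))" "i \<le> n" "j \<le> n"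
  shows "hwt n i (\<sigma>(j := a, Suc j := b)) = hwt n i \<sigma> + cartan n i j"
proof -
  have "hwt n i (\<sigma>(j := a, Suc j := b)) = hwt n i \<sigma> + (1) * cartan n i j"
  proof (rule hwt_upd_cartan)
    show "swt a = swt (\<sigma> j) + (1) * (if j = n then 2 else 1)"
      unfolding etab_weight(1)[OF assms(1)] by (cases "j = n") simp_all
    show "swt b = swt (\<sigma> (Suc j)) - (1) * (if j = n then 0 else 1)"
      unfolding etab_weight(2)[OF assms(1)] by (cases "j = n") simp_all
  qed (fact assms)+
  then show ?thesis by simp
qed

lemma Hop_Kop [simp]: "Hop n i (Kop n i w) = w" "Kop n i (Hop n i w) = w"
proof -
  show "Hop n i (Kop n i w) = w"
    by (rule linear_op_eqI_V[of "\<lambda>w. Hop n i (Kop n i w)"])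
       (auto intro!: linear_op_intros simp: Hop_V Kop_V gen_act_linear power_int_minus)
  show "Kop n i (Hop n i w) = w"
    by (rule linear_op_eqI_V[of "\<lambda>w. Kop n i (Hop n i w)"])
       (auto intro!: linear_op_intros simp: Hop_V Kop_V gen_act_linear power_int_minus)
qed

lemma torus_commute:
  assumes "g \<in> {GenH i, GenHinv i}" "h \<in> {GenH j, GenHinv j}"
  shows "gen_act n g (gen_act n h w) = gen_act n h (gen_act n g w)"
  by (rule linear_op_eqI_V[of "\<lambda>w. gen_act n g (gen_act n h w)" "\<lambda>w. gen_act n h (gen_act n g w)"])
     (use assms in \<open>auto intro!: linear_op_intros simp: Hop_V Kop_V gen_act_linear mult.commute\<close>)

text \<open>Every term produced by L raises the weight by d, so conjugation by the torus contributes
  the ratio of two powers of q. The second claim treats the bar images of the torus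
  relators.\<close>

lemma conjugate_loc:
  assumes "linear_op L" "\<And>\<sigma>. L (V \<sigma>) = loc t j \<sigma>"
    and "\<And>\<sigma> c a b. (c, a, b) \<in> set (t (\<sigma> j) (\<sigma> (Suc j))) \<Longrightarrow>
           hwt n i (\<sigma>(j := a, Suc j := b)) = hwt n i \<sigma> + d"
  shows "Hop n i (L (Kop n i w)) = smul (qv powi d) (L w)"
    and "Kop n i (L (Hop n i w)) = smul (qv powi (- d)) (L w)"
proof -
  have sl: "smul c (\<Sum>x\<leftarrow>xs. g x) = (\<Sum>x\<leftarrow>xs. smul c (g x))" for c and xs :: "(cq \<times> site \<times> site) list"
      and g
    by (rule linear_op_sum_list) (rule linear_op_scale[OF linear_op_id])
  have HLK: "Hop n i (L (Kop n i w)) = smul (qv powi d) (L w)" for w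
  proof (rule linear_op_eqI_V[of "\<lambda>w. Hop n i (L (Kop n i w))" "\<lambda>w. smul (qv powi d) (L w)"])
    fix \<sigma>
    have "Hop n i (L (Kop n i (V \<sigma>))) = (\<Sum>x\<leftarrow>t (\<sigma> j) (\<sigma> (Suc j)).
        smul (qv powi (- hwt n i \<sigma>) * fst x * qv powi (hwt n i (\<sigma>(j := fst (snd x), Suc j := snd
            (snd x)))))
          (V (\<sigma>(j := fst (snd x), Suc j := snd (snd x)))))"
      by (simp add: Kop_V linear_op_smul[OF assms(1)] assms(2) loc_alt gen_act_linear
          linear_op_sum_list[OF linear_op_gen_act] Hop_V sl mult.assoc)
    also have "\<dots> = (\<Sum>x\<leftarrow>t (\<sigma> j) (\<sigma> (Suc j)).
        smul (qv powi d * fst x) (V (\<sigma>(j := fst (snd x), Suc j := snd (snd x)))))"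
    proof (rule arg_cong[of _ _ sum_list], rule map_cong[OF refl])
      fix x assume x: "x \<in> set (t (\<sigma> j) (\<sigma> (Suc j)))"
      have "hwt n i (\<sigma>(j := fst (snd x), Suc j := snd (snd x))) = hwt n i \<sigma> + d"
        using assms(3)[of "fst x" "fst (snd x)" "snd (snd x)" \<sigma>] x by simp
      then show "smul (qv powi (- hwt n i \<sigma>) * fst x * qv powi (hwt n i (\<sigma>(j := fst (snd x), Suc j
          := snd (snd x)))))
          (V (\<sigma>(j := fst (snd x), Suc j := snd (snd x)))) = smul (qv powi d * fst x) (V (\<sigma>(j :=
              fst (snd x), Suc j := snd (snd x))))"
        by (simp add: power_int_add power_int_minus field_simps)
    qed
    also have "\<dots> = smul (qv powi d) (L (V \<sigma>))"
      by (simp add: assms(2) loc_alt sl)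
    finally show "Hop n i (L (Kop n i (V \<sigma>))) = smul (qv powi d) (L (V \<sigma>))" .
  qed (intro linear_op_intros linear_op_comp[OF assms(1)] assms(1))+
  then show "Hop n i (L (Kop n i w)) = smul (qv powi d) (L w)" .
  show "Kop n i (L (Hop n i w)) = smul (qv powi (- d)) (L w)"
  proof -
    have "smul (qv powi d) (L (Hop n i w)) = Hop n i (L w)"
      by (metis Hop_Kop(2) HLK)
    then have "smul (qv powi d) (Kop n i (L (Hop n i w))) = L w"
      by (metis Hop_Kop(2) gen_act_linear(2))
    then have "smul (qv powi (- d)) (smul (qv powi d) (Kop n i (L (Hop n i w)))) = smul (qv powi
        (- d)) (L w)"
      by simp
    then show ?thesis
      by (simp add: power_int_minus)
  qed
qed

lemma conjugate_F:
  assumes "i \<le> n" "j \<le> n"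
  shows "Hop n i (Fop n j (Kop n i w)) = smul (qv powi (- cartan n i j)) (Fop n j w)"
    and "Kop n i (Fop n j (Hop n i w)) = smul (qv powi cartan n i j) (Fop n j w)"
  using conjugate_loc[where L = "Fop n j" and t = "ftab n j" and j = j and n = n and i = i
      and d = "- cartan n i j" and w = w, OF linear_op_gen_act Fop_V] weight_step[OF _ assms]
  by simp_all

lemma conjugate_E:
  assumes "i \<le> n" "j \<le> n"
  shows "Hop n i (Eop n j (Kop n i w)) = smul (qv powi cartan n i j) (Eop n j w)"
    and "Kop n i (Eop n j (Hop n i w)) = smul (qv powi (- cartan n i j)) (Eop n j w)"
  using conjugate_loc[where L = "Eop n j" and t = "etab n j" and j = j and n = n and i = i
      and d = "cartan n i j" and w = w, OF linear_op_gen_act Eop_V] weight_step_e[OF _ assms]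
  by simp_all

lemma E_F_commute:
  assumes "i \<noteq> j" "i \<le> n" "j \<le> n"
  shows "Eop n i (Fop n j w) = Fop n j (Eop n i w)"
proof -
  consider "Suc i < j \<or> Suc j < i" | "j = Suc i" | "i = Suc j"
    using assms(1) by linarith
  then show ?thesis
  proof cases
    case 1
    then show ?thesis
      by (intro loc_commute[OF linear_op_gen_act Eop_V linear_op_gen_act Fop_V])
  next
    case 2
    then have ne: "i \<noteq> n" using assms by simp
    show ?thesis
    proof (rule linear_op_eqI_V3[of "\<lambda>w. Eop n i (Fop n j w)" "\<lambda>w. Fop n j (Eop n i w)" i])
      show "Eop n i (Fop n j (V3 i \<sigma> a b c)) = Fop n j (Eop n i (V3 i \<sigma> a b c))" for \<sigma> a b c
        by (cases a; cases b; cases c; cases "Suc i = n")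
           (simp_all add: 2 ne V3_simps gen_act_linear ftab_def etab_def)
    qed (intro linear_op_intros)+
  next
    case 3
    then have ne: "j \<noteq> n" using assms by simp
    show ?thesis
    proof (rule linear_op_eqI_V3[of "\<lambda>w. Eop n i (Fop n j w)" "\<lambda>w. Fop n j (Eop n i w)" j])
      show "Eop n i (Fop n j (V3 j \<sigma> a b c)) = Fop n j (Eop n i (V3 j \<sigma> a b c))" for \<sigma> a b c
        by (cases a; cases b; cases c; cases "Suc j = n")
           (simp_all add: 3 ne V3_simps gen_act_linear ftab_def etab_def)
    qed (intro linear_op_intros)+
  qed
qed

lemma F_F_commute:
  assumes "Suc i < j \<or> Suc j < i"
  shows "Fop n i (Fop n j w) = Fop n j (Fop n i w)"
  using assms by (intro loc_commute[OF linear_op_gen_act Fop_V linear_op_gen_act Fop_V])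

lemma E_E_commute:
  assumes "Suc i < j \<or> Suc j < i"
  shows "Eop n i (Eop n j w) = Eop n j (Eop n i w)"
  using assms by (intro loc_commute[OF linear_op_gen_act Eop_V linear_op_gen_act Eop_V])

lemma Fop_n_Fop_n [simp]: "Fop n n (Fop n n w) = 0"
  by (rule linear_op_eqI_V3[of "\<lambda>w. Fop n n (Fop n n w)" "\<lambda>w. 0" n])
     (auto intro!: linear_op_intros simp: V3_simps gen_act_linear ftab_def)

lemma Eop_n_Eop_n [simp]: "Eop n n (Eop n n w) = 0"
  by (rule linear_op_eqI_V3[of "\<lambda>w. Eop n n (Eop n n w)" "\<lambda>w. 0" n])
     (auto intro!: linear_op_intros simp: V3_simps gen_act_linear etab_def)

text \<open>Each application lowers \<open>swt\<close> at position i by 1, and \<open>swt\<close>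
  takes only the values -1, 0, 1. For i = n the step is 2, so there already the square
  vanishes.\<close>

lemma Fop_cube: "i \<noteq> n \<Longrightarrow> Fop n i (Fop n i (Fop n i w)) = 0"
proof (rule linear_op_eqI_V3[of "\<lambda>w. Fop n i (Fop n i (Fop n i w))" "\<lambda>w. 0" i])
  show "Fop n i (Fop n i (Fop n i (V3 i \<sigma> a b c))) = 0" if "i \<noteq> n" for \<sigma> a b c
    using that by (cases a; cases b) (simp_all add: V3_simps gen_act_linear ftab_def)
qed (intro linear_op_intros)+

lemma Eop_cube: "i \<noteq> n \<Longrightarrow> Eop n i (Eop n i (Eop n i w)) = 0"
proof (rule linear_op_eqI_V3[of "\<lambda>w. Eop n i (Eop n i (Eop n i w))" "\<lambda>w. 0" i])
  show "Eop n i (Eop n i (Eop n i (V3 i \<sigma> a b c))) = 0" if "i \<noteq> n" for \<sigma> a b c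
    using that by (cases a; cases b) (simp_all add: V3_simps gen_act_linear etab_def)
qed (intro linear_op_intros)+

text \<open>At the double bond the Serre sums vanish term by term. These are the mixed monomials;
  the others contain the square of \<open>Fop n n\<close> or the cube of
  \<open>Fop n j\<close>.\<close>

lemma F_serre_short:
  shows "Suc j = n \<Longrightarrow> Fop n n (Fop n j (Fop n n w)) = 0"
    and "Suc j = n \<Longrightarrow> Fop n j (Fop n j (Fop n n (Fop n j w))) = 0"
    and "Suc j = n \<Longrightarrow> Fop n j (Fop n n (Fop n j (Fop n j w))) = 0"
proof -
  assume n: "Suc j = n"
  then have ne: "j \<noteq> n" "n = Suc j" by simp_all
  show "Fop n n (Fop n j (Fop n n w)) = 0"
  proof (rule linear_op_eqI_V3[of "\<lambda>w. Fop n n (Fop n j (Fop n n w))" "\<lambda>w. 0" j])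
    show "Fop n n (Fop n j (Fop n n (V3 j \<sigma> a b c))) = 0" for \<sigma> a b c
      by (cases a; cases b) (simp_all add: ne(2) V3_simps gen_act_linear ftab_def)
  qed (intro linear_op_intros)+
  show "Fop n j (Fop n j (Fop n n (Fop n j w))) = 0"
  proof (rule linear_op_eqI_V3[of "\<lambda>w. Fop n j (Fop n j (Fop n n (Fop n j w)))" "\<lambda>w. 0" j])
    show "Fop n j (Fop n j (Fop n n (Fop n j (V3 j \<sigma> a b c)))) = 0" for \<sigma> a b c
      by (cases a; cases b) (simp_all add: ne(2) V3_simps gen_act_linear ftab_def)
  qed (intro linear_op_intros)+
  show "Fop n j (Fop n n (Fop n j (Fop n j w))) = 0"
  proof (rule linear_op_eqI_V3[of "\<lambda>w. Fop n j (Fop n n (Fop n j (Fop n j w)))" "\<lambda>w. 0" j])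
    show "Fop n j (Fop n n (Fop n j (Fop n j (V3 j \<sigma> a b c)))) = 0" for \<sigma> a b c
      by (cases a; cases b) (simp_all add: ne(2) V3_simps gen_act_linear ftab_def)
  qed (intro linear_op_intros)+
qed

lemma E_serre_short:
  shows "Suc j = n \<Longrightarrow> Eop n n (Eop n j (Eop n n w)) = 0"
    and "Suc j = n \<Longrightarrow> Eop n j (Eop n j (Eop n n (Eop n j w))) = 0"
    and "Suc j = n \<Longrightarrow> Eop n j (Eop n n (Eop n j (Eop n j w))) = 0"
proof -
  assume n: "Suc j = n"
  then have ne: "j \<noteq> n" "n = Suc j" by simp_all
  show "Eop n n (Eop n j (Eop n n w)) = 0"
  proof (rule linear_op_eqI_V3[of "\<lambda>w. Eop n n (Eop n j (Eop n n w))" "\<lambda>w. 0" j])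
    show "Eop n n (Eop n j (Eop n n (V3 j \<sigma> a b c))) = 0" for \<sigma> a b c
      by (cases a; cases b) (simp_all add: ne(2) V3_simps gen_act_linear etab_def)
  qed (intro linear_op_intros)+
  show "Eop n j (Eop n j (Eop n n (Eop n j w))) = 0"
  proof (rule linear_op_eqI_V3[of "\<lambda>w. Eop n j (Eop n j (Eop n n (Eop n j w)))" "\<lambda>w. 0" j])
    show "Eop n j (Eop n j (Eop n n (Eop n j (V3 j \<sigma> a b c)))) = 0" for \<sigma> a b c
      by (cases a; cases b) (simp_all add: ne(2) V3_simps gen_act_linear etab_def)
  qed (intro linear_op_intros)+
  show "Eop n j (Eop n n (Eop n j (Eop n j w))) = 0"
  proof (rule linear_op_eqI_V3[of "\<lambda>w. Eop n j (Eop n n (Eop n j (Eop n j w)))" "\<lambda>w. 0" j])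
    show "Eop n j (Eop n n (Eop n j (Eop n j (V3 j \<sigma> a b c)))) = 0" for \<sigma> a b c
      by (cases a; cases b) (simp_all add: ne(2) V3_simps gen_act_linear etab_def)
  qed (intro linear_op_intros)+
qed

text \<open>At a simple bond the monomials do not vanish separately. This is the Serre relation
  cleared of the denominator [2]!, checked on the 64 states of three positions.\<close>

lemma F_serre:
  assumes "j = Suc i \<or> i = Suc j" "i \<noteq> n" "j \<noteq> n"
  shows "Fop n i (Fop n i (Fop n j w)) + Fop n j (Fop n i (Fop n i w))
    = smul (qv + inverse qv) (Fop n i (Fop n j (Fop n i w)))"
  using assms(1)
proof
  assume j: "j = Suc i"
  show ?thesis
  proof (rule linear_op_eqI_V3[of "\<lambda>w. Fop n i (Fop n i (Fop n j w)) + Fop n j (Fop n i (Fop n i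
      w))"
        "\<lambda>w. smul (qv + inverse qv) (Fop n i (Fop n j (Fop n i w)))" i])
    show "Fop n i (Fop n i (Fop n j (V3 i \<sigma> a b c))) + Fop n j (Fop n i (Fop n i (V3 i \<sigma> a b c)))
      = smul (qv + inverse qv) (Fop n i (Fop n j (Fop n i (V3 i \<sigma> a b c))))" for \<sigma> a b c
      using assms(2,3) unfolding j
      by (cases a; cases b; cases c;
          simp add: V3_simps gen_act_linear ftab_def;
          simp add: smul_add_left smul_add_right distrib_left distrib_right add_ac)
  qed (intro linear_op_intros)+
next
  assume i: "i = Suc j"
  show ?thesis
  proof (rule linear_op_eqI_V3[of "\<lambda>w. Fop n i (Fop n i (Fop n j w)) + Fop n j (Fop n i (Fop n i
      w))"
        "\<lambda>w. smul (qv + inverse qv) (Fop n i (Fop n j (Fop n i w)))" j])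
    show "Fop n i (Fop n i (Fop n j (V3 j \<sigma> a b c))) + Fop n j (Fop n i (Fop n i (V3 j \<sigma> a b c)))
      = smul (qv + inverse qv) (Fop n i (Fop n j (Fop n i (V3 j \<sigma> a b c))))" for \<sigma> a b c
      using assms(2,3) unfolding i
      by (cases a; cases b; cases c;
          simp add: V3_simps gen_act_linear ftab_def;
          simp add: smul_add_left smul_add_right distrib_left distrib_right add_ac)
  qed (intro linear_op_intros)+
qed

lemma E_serre:
  assumes "j = Suc i \<or> i = Suc j" "i \<noteq> n" "j \<noteq> n"
  shows "Eop n i (Eop n i (Eop n j w)) + Eop n j (Eop n i (Eop n i w))
    = smul (qv + inverse qv) (Eop n i (Eop n j (Eop n i w)))"
  using assms(1)
proof
  assume j: "j = Suc i"
  show ?thesis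
  proof (rule linear_op_eqI_V3[of "\<lambda>w. Eop n i (Eop n i (Eop n j w)) + Eop n j (Eop n i (Eop n i
      w))"
        "\<lambda>w. smul (qv + inverse qv) (Eop n i (Eop n j (Eop n i w)))" i])
    show "Eop n i (Eop n i (Eop n j (V3 i \<sigma> a b c))) + Eop n j (Eop n i (Eop n i (V3 i \<sigma> a b c)))
      = smul (qv + inverse qv) (Eop n i (Eop n j (Eop n i (V3 i \<sigma> a b c))))" for \<sigma> a b c
      using assms(2,3) unfolding j
      by (cases a; cases b; cases c;
          simp add: V3_simps gen_act_linear etab_def;
          simp add: smul_add_left smul_add_right distrib_left distrib_right add_ac)
  qed (intro linear_op_intros)+
next
  assume i: "i = Suc j"
  show ?thesis
  proof (rule linear_op_eqI_V3[of "\<lambda>w. Eop n i (Eop n i (Eop n j w)) + Eop n j (Eop n i (Eop n i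
      w))"
        "\<lambda>w. smul (qv + inverse qv) (Eop n i (Eop n j (Eop n i w)))" j])
    show "Eop n i (Eop n i (Eop n j (V3 j \<sigma> a b c))) + Eop n j (Eop n i (Eop n i (V3 j \<sigma> a b c)))
      = smul (qv + inverse qv) (Eop n i (Eop n j (Eop n i (V3 j \<sigma> a b c))))" for \<sigma> a b c
      using assms(2,3) unfolding i
      by (cases a; cases b; cases c;
          simp add: V3_simps gen_act_linear etab_def;
          simp add: smul_add_left smul_add_right distrib_left distrib_right add_ac)
  qed (intro linear_op_intros)+
qed

lemma Hop_V3:
  "Hop n i (V3 i \<sigma> a b c) = smul (qv powi (swt a - (if i = n then 0 else swt b))) (V3 i \<sigma> a b c)"
  "Kop n i (V3 i \<sigma> a b c) = smul (qv powi (- (swt a - (if i = n then 0 else swt b)))) (V3 i \<sigma> a b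
      c)"
  by (simp_all add: V3_def Hop_V Kop_V hwt_def)

lemma quantum_integer_values:
  "(qv powi 2 - qv powi (- 2)) / (qv - inverse qv) = qv + inverse qv"
  "(qv powi (- 2) - qv powi 2) / (qv - inverse qv) = - (qv + inverse qv)"
proof -
  have "qv powi 2 - qv powi (- 2) = (qv + inverse qv) * (qv - inverse qv)"
    by (simp add: power_int_minus power2_eq_square algebra_simps)
  moreover have "qv - inverse qv \<noteq> 0"
    using qi_neq_inverse[of 0 1] by (simp add: qi_def)
  ultimately show "(qv powi 2 - qv powi (- 2)) / (qv - inverse qv) = qv + inverse qv"
    by simp
  then show "(qv powi (- 2) - qv powi 2) / (qv - inverse qv) = - (qv + inverse qv)"
    by (metis minus_diff_eq minus_divide_left)
qed

text \<open>On a configuration of weight m the last term is multiplication by the quantum integer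
  [m]_i. For i = n the weight is -1, 0 or 1; for i < n it can also be 2 or -2, which contributes q +
  q^-1 up to sign.\<close>

lemma E_F_cartan:
  "Eop n i (Fop n i w) = Fop n i (Eop n i w)
     + smul (inverse (qi n i - inverse (qi n i))) (free_act n (tgen n i) w - free_act n (tgen_inv
         n i) w)"
    (is "?L w = ?R w")
proof (cases "i = n")
  case True
  define r where "r = inverse (qv ^ 2 - inverse (qv ^ 2))"
  have r: "r * (qv ^ 2 - inverse (qv ^ 2)) = 1" 
    using qi_neq_inverse[of n n] by (simp add: qi_def r_def)
  have t: "free_act n (tgen n i) w = Hop n n (Hop n n w)"
    "free_act n (tgen_inv n i) w = Kop n n (Kop n n w)" for w
    using True by (simp_all add: tgen_def tgen_inv_def power2_eq_square free_act_mult)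
  have lin: "linear_op ?R"
    \<comment> \<open>The difference is written as a sum with a scalar -1, so that the closure rules
      for linear operators apply.\<close>
    unfolding t diff_conv_add_uminus smul_minus_left[of 1, simplified, symmetric]
    by (intro linear_op_intros)
  show ?thesis
  proof (rule linear_op_eqI_V3[of ?L ?R i])
    show "?L (V3 i \<sigma> a b c) = ?R (V3 i \<sigma> a b c)" for \<sigma> a b c
    proof -
      have "smul r (smul (qv ^ 2) v - smul (inverse (qv ^ 2)) v) = v" for v
        by (simp add: r flip: smul_diff_left)
      moreover have "smul r (smul (inverse (qv ^ 2)) v - smul (qv ^ 2) v) = - v" for v
      proof -
        have "r * (inverse (qv ^ 2) - qv ^ 2) = - 1"
          using r by (simp add: algebra_simps)
        then show ?thesis
          by (metis smul_1 smul_diff_left smul_minus_left smul_smul)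
      qed
      ultimately show ?thesis
        unfolding t using True
        by (cases a)
           (simp_all add: V3_simps Hop_V3 gen_act_linear ftab_def etab_def qi_def power_int_minus
             r_def power2_eq_square)
    qed
  qed (rule lin | intro linear_op_intros)+
next
  case False
  define r where "r = inverse (qv - inverse qv)"
  have r: "r * (qv - inverse qv) = 1" 
    using qi_neq_inverse[of 0 1] by (simp add: qi_def r_def)
  have r2: "r * (qv ^ 2 - inverse (qv ^ 2)) = qv + inverse qv"
    using quantum_integer_values(1) by (simp add: r_def field_simps power_int_minus)
  have t: "free_act n (tgen n i) w = Hop n i w" "free_act n (tgen_inv n i) w = Kop n i w" for w
    using False by (simp_all add: tgen_def tgen_inv_def)
  have lin: "linear_op ?R"
    unfolding t diff_conv_add_uminus smul_minus_left[of 1, simplified, symmetric]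
    by (intro linear_op_intros)
  show ?thesis
  proof (rule linear_op_eqI_V3[of ?L ?R i])
    show "?L (V3 i \<sigma> a b c) = ?R (V3 i \<sigma> a b c)" for \<sigma> a b c
    proof -
      have 1: "smul r (smul qv v - smul (inverse qv) v) = v" for v
        by (metis r smul_1 smul_diff_left smul_smul)
      have 2: "smul r (smul (inverse qv) v - smul qv v) = - v" for v
        by (subst (2) 1[symmetric]) (simp only: smul_diff_right minus_diff_eq)
      have 3: "smul r (smul (qv ^ 2) v - smul (inverse (qv ^ 2)) v) = smul (qv + inverse qv) v"
          for v
        by (metis r2 smul_diff_left smul_smul)
      have 4: "smul r (smul (inverse (qv ^ 2)) v - smul (qv ^ 2) v) = - smul (qv + inverse qv) v"
          for v
        unfolding 3[symmetric] by (simp only: smul_diff_right minus_diff_eq)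
      have qi: "inverse (qi n i - inverse (qi n i)) = r"
        using False by (simp add: qi_def r_def)
      show ?thesis
        unfolding t qi using False
        by (cases a; cases b;
            simp add: V3_simps Hop_V3 gen_act_linear ftab_def etab_def power_int_minus 1 2 3 4;
            simp add: smul_add_left smul_add_right add_ac)
    qed
  qed (rule lin | intro linear_op_intros)+
qed

lemma free_act_serre:
  assumes "b = nat (1 - cartan n i j)"
  shows "free_act n (serre n g i j) w = (\<Sum>k\<in>{0..b}.
    smul ((- 1) ^ k * (inverse (qfact n i k) * inverse (qfact n i (b - k))))
      ((gen_act n (g i) ^^ k) (gen_act n (g j) ((gen_act n (g i) ^^ (b - k)) w))))"
proof -
  have f: "free_act n (gelt h) = gen_act n h" for h
    by (rule ext) simp
  have lin: "linear_op (gen_act n h ^^ k)" for h k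
    by (induction k) (auto simp: linear_op_def gen_act_linear)
  show ?thesis
    unfolding serre_def Let_def assms[symmetric]
    by (simp add: free_act_sum divpow_def mult.assoc free_act_sign)
       (simp add: free_act_mult free_act_power f gen_act_linear linear_op_smul[OF lin])
qed

lemma serre_kills_F:
  assumes "i \<noteq> j" "i \<le> n" "j \<le> n"
  shows "free_act n (serre n GenF i j) w = 0"
proof -
  consider "Suc i < j \<or> Suc j < i" | "j = Suc i \<or> i = Suc j" "i \<noteq> n" "j \<noteq> n"
    | "i = n" "Suc j = n" | "j = n" "Suc i = n"
    using assms by linarith
  then show ?thesis
  proof cases
    case 1
    then have "1 = nat (1 - cartan n i j)"
      by (auto simp: cartan_def)
    from free_act_serre[OF this] show ?thesis
      by (simp add: F_F_commute[OF 1] smul_minus_left)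
  next
    case 2
    then have "2 = nat (1 - cartan n i j)"
      by (auto simp: cartan_def)
    \<comment> \<open>Multiplication by [2]! removes the denominators of the second divided powers;
      the factor is cancelled at the end.\<close>
    from free_act_serre[OF this, of GenF w]
    have "smul (qv + inverse qv) (free_act n (serre n GenF i j) w)
      = Fop n j (Fop n i (Fop n i w)) - smul (qv + inverse qv) (Fop n i (Fop n j (Fop n i w)))
        + Fop n i (Fop n i (Fop n j w))"
      using 2 by (simp add: numeral_2_eq_2 atLeastAtMostSuc_conv qfact_2[unfolded numeral_2_eq_2]
          qi_def
          smul_add_right smul_diff_right smul_minus_left right_inverse[OF qv_add_inverse_nonzero])
    also have "\<dots> = 0"
      using F_serre[OF 2] by (simp add: algebra_simps)
    finally have "smul (inverse (qv + inverse qv)) (smul (qv + inverse qv) (free_act n (serre n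
        GenF i j) w)) = 0"
      by (simp only: smul_0_right)
    then show ?thesis
      by (simp only: smul_smul left_inverse[OF qv_add_inverse_nonzero] smul_1)
  next
    case 3
    then have "2 = nat (1 - cartan n i j)"
      by (auto simp: cartan_def)
    from free_act_serre[OF this, of GenF w] show ?thesis
      using 3 by (simp add: numeral_2_eq_2 atLeastAtMostSuc_conv gen_act_linear F_serre_short)
  next
    case 4
    then have "3 = nat (1 - cartan n i j)"
      by (auto simp: cartan_def)
    from free_act_serre[OF this, of GenF w] show ?thesis
      using 4 by (simp add: numeral_3_eq_3 atLeastAtMostSuc_conv gen_act_linear F_serre_short
          Fop_cube)
  qed
qed

lemma serre_kills_E:
  assumes "i \<noteq> j" "i \<le> n" "j \<le> n"
  shows "free_act n (serre n GenE i j) w = 0"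
proof -
  consider "Suc i < j \<or> Suc j < i" | "j = Suc i \<or> i = Suc j" "i \<noteq> n" "j \<noteq> n"
    | "i = n" "Suc j = n" | "j = n" "Suc i = n"
    using assms by linarith
  then show ?thesis
  proof cases
    case 1
    then have "1 = nat (1 - cartan n i j)"
      by (auto simp: cartan_def)
    from free_act_serre[OF this] show ?thesis
      by (simp add: E_E_commute[OF 1] smul_minus_left)
  next
    case 2
    then have "2 = nat (1 - cartan n i j)"
      by (auto simp: cartan_def)
    from free_act_serre[OF this, of GenE w]
    have "smul (qv + inverse qv) (free_act n (serre n GenE i j) w)
      = Eop n j (Eop n i (Eop n i w)) - smul (qv + inverse qv) (Eop n i (Eop n j (Eop n i w)))
        + Eop n i (Eop n i (Eop n j w))"
      using 2 by (simp add: numeral_2_eq_2 atLeastAtMostSuc_conv qfact_2[unfolded numeral_2_eq_2]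
          qi_def
          smul_add_right smul_diff_right smul_minus_left right_inverse[OF qv_add_inverse_nonzero])
    also have "\<dots> = 0"
      using E_serre[OF 2] by (simp add: algebra_simps)
    finally have "smul (inverse (qv + inverse qv)) (smul (qv + inverse qv) (free_act n (serre n
        GenE i j) w)) = 0"
      by (simp only: smul_0_right)
    then show ?thesis
      by (simp only: smul_smul left_inverse[OF qv_add_inverse_nonzero] smul_1)
  next
    case 3
    then have "2 = nat (1 - cartan n i j)"
      by (auto simp: cartan_def)
    from free_act_serre[OF this, of GenE w] show ?thesis
      using 3 by (simp add: numeral_2_eq_2 atLeastAtMostSuc_conv gen_act_linear E_serre_short)
  next
    case 4
    then have "3 = nat (1 - cartan n i j)"
      by (auto simp: cartan_def)
    from free_act_serre[OF this, of GenE w] show ?thesis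
      using 4 by (simp add: numeral_3_eq_3 atLeastAtMostSuc_conv gen_act_linear E_serre_short
          Eop_cube)
  qed
qed

lemma bar_free_divpow [simp]: "bar_free (divpow n i (gelt g) k) = divpow n i (gelt (bar_gen g)) k"
  by (simp add: divpow_def bar_free_mult bar_free_power)

lemma bar_free_serre:
  assumes "\<And>i. bar_gen (g i) = g i"
  shows "bar_free (serre n g i j) = serre n g i j"
proof -
  have "bar_free ((- 1) ^ k) = (- 1) ^ k" for k
    by (simp add: bar_free_power bar_free_uminus)
  then show ?thesis
    by (simp add: serre_def Let_def bar_free_sum bar_free_mult assms)
qed

text \<open>The bar image is included because the involution of the quotient sends a coset to its
  image: for \<open>act\<close> to be well defined on \<open>u\<close> and on
  \<open>bar_Uq u\<close>, the relations and their bar images must act by zero.\<close>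

definition kills :: "nat \<Rightarrow> free_elt \<Rightarrow> bool" where
  "kills n x \<longleftrightarrow> (\<forall>w. free_act n x w = 0) \<and> (\<forall>w. free_act n (bar_free x) w = 0)"

lemma bar_free_tgen [simp]: "bar_free (tgen n i) = tgen_inv n i" "bar_free (tgen_inv n i) = tgen n
    i"
  by (simp_all add: tgen_def tgen_inv_def bar_free_power)

lemma relators_kill:
  assumes "r \<in> relators n"
  shows "kills n r"
proof -
  note fa = free_act_diff free_act_mult free_act_add
  note bf = bar_free_diff bar_free_mult bar_free_add
  consider (inv) i where "i \<in> {1..n}"
      "r \<in> {gelt (GenH i) * gelt (GenHinv i) - 1, gelt (GenHinv i) * gelt (GenH i) - 1}"
    | (tor) i j g h where "r = gelt g * gelt h - gelt h * gelt g" "g \<in> {GenH i, GenHinv i}" "h \<in>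
        {GenH j, GenHinv j}"
    | (we) i j where "i \<in> {1..n}" "j \<in> {1..n}"
       "r = gelt (GenH i) * gelt (GenE j) * gelt (GenHinv i) - scal (qv powi cartan n i j) * gelt
           (GenE j)"
    | (wf) i j where "i \<in> {1..n}" "j \<in> {1..n}"
       "r = gelt (GenH i) * gelt (GenF j) * gelt (GenHinv i) - scal (qv powi (- cartan n i j)) *
           gelt (GenF j)"
    | (ef) i j where "i \<in> {1..n}" "j \<in> {1..n}"
       "r = gelt (GenE i) * gelt (GenF j) - gelt (GenF j) * gelt (GenE i)
          - (if i = j then scal (inverse (qi n i - inverse (qi n i))) * (tgen n i - tgen_inv n i)
              else 0)"
    | (se) i j where "i \<in> {1..n}" "j \<in> {1..n}" "i \<noteq> j" "r \<in> {serre n GenE i j, serre n GenF i j}"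
    using assms unfolding relators_def by blast
  then show ?thesis
  proof cases
    case inv
    then show ?thesis
      by (auto simp: kills_def fa bf)
  next
    case tor
    have "bar_gen g \<in> {GenH i, GenHinv i}" "bar_gen h \<in> {GenH j, GenHinv j}"
      using tor by auto
    then show ?thesis
      using tor torus_commute[of g i h j n] torus_commute[of "bar_gen g" i "bar_gen h" j n]
      by (simp add: kills_def fa bf)
  next
    case we
    have "bar_cq (qv powi k) = qv powi (- k)" for k
      by (simp add: power_int_def power_inverse)
    then show ?thesis
      using we conjugate_E[of i n j] by (simp add: kills_def fa bf)
  next
    case wf
    have "bar_cq (qv powi k) = qv powi (- k)" for k
      by (simp add: power_int_def power_inverse)
    then show ?thesis
      using wf conjugate_F[of i n j] by (simp add: kills_def fa bf)
  next
    case ef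
    show ?thesis
    proof (cases "i = j")
      case True
      \<comment> \<open>The bar image exchanges t_i with its inverse and changes the sign of the
        denominator; the two signs cancel.\<close>
      have "smul (inverse (inverse (qi n i) - qi n i)) v = - smul (inverse (qi n i - inverse (qi n
          i))) v" for v
        by (metis inverse_minus_eq minus_diff_eq smul_minus_left)
      then show ?thesis
        using ef(3) True E_F_cartan[of n i]
        by (simp add: kills_def fa bf bar_cq_qi smul_diff_right)
    next
      case False
      then show ?thesis
        using ef E_F_commute[OF False] by (simp add: kills_def fa bf)
    qed
  next
    case se
    then show ?thesis
      using serre_kills_E[of i j n] serre_kills_F[of i j n]
      by (auto simp: kills_def bar_free_serre)
  qed
qed

subsection \<open>The quotient algebra\<close>

lemma free_alg_simps [simp]:
  "mult (free_alg n) = (*)" "one (free_alg n) = 1" "zero (free_alg n) = 0" "add (free_alg n) = (+)"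
  by (simp_all add: free_alg_def)

lemma in_free_alg:
  "x \<in> carrier (free_alg n) \<longleftrightarrow> (\<forall>w\<in>Poly_Mapping.keys x. set (letters w) \<subseteq> gens n)"
  by (simp add: free_alg_def)

lemma free_alg_add: "x \<in> carrier (free_alg n) \<Longrightarrow> y \<in> carrier (free_alg n) \<Longrightarrow> x + y \<in> carrier
    (free_alg n)"
  unfolding in_free_alg using keys_add[of x y] by blast

lemma free_alg_uminus: "x \<in> carrier (free_alg n) \<Longrightarrow> - x \<in> carrier (free_alg n)"
  unfolding in_free_alg by (simp add: in_keys_iff)

lemma free_alg_diff: "x \<in> carrier (free_alg n) \<Longrightarrow> y \<in> carrier (free_alg n) \<Longrightarrow> x - y \<in> carrier
    (free_alg n)"
  using free_alg_add[of x n "- y"] free_alg_uminus by simp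

lemma free_alg_mult: "x \<in> carrier (free_alg n) \<Longrightarrow> y \<in> carrier (free_alg n) \<Longrightarrow> x * y \<in> carrier
    (free_alg n)"
  unfolding in_free_alg using keys_mult[of x y] by (fastforce simp: plus_fmon_def)

lemma free_alg_scal: "scal c \<in> carrier (free_alg n)"
  by (simp add: in_free_alg scal_def zero_fmon_def)

lemma free_alg_0: "0 \<in> carrier (free_alg n)"
  by (simp add: in_free_alg)

lemma free_alg_1: "1 \<in> carrier (free_alg n)"
  using free_alg_scal[of 1] by (simp add: scal_def)

lemma free_alg_power: "x \<in> carrier (free_alg n) \<Longrightarrow> x ^ k \<in> carrier (free_alg n)"
  by (induction k) (auto intro: free_alg_1 free_alg_mult)

lemma free_alg_sum: "(\<And>s. s \<in> S \<Longrightarrow> g s \<in> carrier (free_alg n)) \<Longrightarrow> sum g S \<in> carrier (free_alg n)"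
  by (induction S rule: infinite_finite_induct) (auto intro: free_alg_0 free_alg_add)

lemma free_alg_gelt: "g \<in> gens n \<Longrightarrow> gelt g \<in> carrier (free_alg n)"
  by (simp add: in_free_alg gelt_def)

lemmas free_alg_closed = free_alg_add free_alg_uminus free_alg_diff free_alg_mult free_alg_scal
  free_alg_0 free_alg_1 free_alg_power free_alg_gelt free_alg_sum

lemma gens_simps [simp]:
  "GenE i \<in> gens n \<longleftrightarrow> i \<in> {1..n}" "GenF i \<in> gens n \<longleftrightarrow> i \<in> {1..n}"
  "GenH i \<in> gens n \<longleftrightarrow> i \<in> {1..n}" "GenHinv i \<in> gens n \<longleftrightarrow> i \<in> {1..n}"
  by (auto simp: gens_def)

lemma divpow_closed: "g \<in> gens n \<Longrightarrow> divpow n i (gelt g) k \<in> carrier (free_alg n)"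
  by (auto simp: divpow_def intro!: free_alg_closed)

lemma relators_closed: "relators n \<subseteq> carrier (free_alg n)"
proof -
  have "serre n g i j \<in> carrier (free_alg n)" if "g i \<in> gens n" "g j \<in> gens n" for g i j
    unfolding serre_def Let_def using that by (intro free_alg_closed divpow_closed)
  moreover have "tgen n i \<in> carrier (free_alg n)" "tgen_inv n i \<in> carrier (free_alg n)"
    if "i \<in> {1..n}" for i
    using that by (auto simp: tgen_def tgen_inv_def intro!: free_alg_closed)
  ultimately show ?thesis
    unfolding relators_def by (auto intro!: free_alg_closed)
qed

lemma ring_free_alg: "ring (free_alg n)"
proof (rule ringI)
  show "abelian_group (free_alg n)"
  proof (rule abelian_groupI)
    show "\<exists>y\<in>carrier (free_alg n). y \<oplus>\<^bsub>free_alg n\<^esub> x = \<zero>\<^bsub>free_alg n\<^esub>" if "x \<in> carrier (free_alg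
        n)" for x
      using free_alg_uminus[OF that] by (intro bexI[of _ "- x"]) simp_all
  qed (auto intro: free_alg_closed simp: add_ac)
  show "Group.monoid (free_alg n)"
    by (rule Group.monoidI) (auto intro: free_alg_closed simp: mult.assoc)
qed (auto simp: distrib_left distrib_right)

lemma free_alg_a_inv:
  assumes "x \<in> carrier (free_alg n)"
  shows "\<ominus>\<^bsub>free_alg n\<^esub> x = - x"
proof -
  interpret R: ring "free_alg n" by (rule ring_free_alg)
  show ?thesis
    by (rule R.minus_equality) (use assms free_alg_uminus in auto)
qed

lemma ideal_kills: "ideal {x \<in> carrier (free_alg n). kills n x} (free_alg n)"
proof -
  interpret R: ring "free_alg n" by (rule ring_free_alg)
  show ?thesis
  proof (rule idealI[OF ring_free_alg])
    show "subgroup {x \<in> carrier (free_alg n). kills n x} (add_monoid (free_alg n))"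
    proof (rule R.add.subgroupI)
      show "{x \<in> carrier (free_alg n). kills n x} \<noteq> {}"
        using free_alg_0 by (auto simp: kills_def intro!: exI[of _ 0])
    qed (auto simp: free_alg_a_inv kills_def free_act_add free_act_uminus bar_free_add
        bar_free_uminus
          intro: free_alg_closed)
  qed (auto simp: kills_def free_act_mult bar_free_mult linear_op_0[OF linear_op_free_act]
        intro: free_alg_closed)
qed

text \<open>The elements that kill form an ideal containing the relators, and
  \<open>rel_ideal\<close> is the least such ideal.\<close>

lemma rel_ideal_kills: "x \<in> rel_ideal n \<Longrightarrow> kills n x"
proof -
  interpret R: ring "free_alg n" by (rule ring_free_alg)
  have "rel_ideal n \<subseteq> {x \<in> carrier (free_alg n). kills n x}"
    unfolding rel_ideal_def
    by (rule R.genideal_minimal[OF ideal_kills]) (use relators_closed relators_kill in blast)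
  then show "x \<in> rel_ideal n \<Longrightarrow> kills n x" by blast
qed

lemma ideal_rel_ideal: "ideal (rel_ideal n) (free_alg n)"
  unfolding rel_ideal_def by (rule ring.genideal_ideal[OF ring_free_alg relators_closed])

lemma cls_eq: "cls n x = (\<lambda>h. h + x) ` rel_ideal n"
  unfolding cls_def a_r_coset_def' by auto

text \<open>Representatives differ by elements that act by zero, and 0 lies in the ideal, so the set
  to which \<open>the_elem\<close> is applied is indeed a singleton.\<close>

lemma act_cls: "act n (cls n x) w = free_act n x w"
proof -
  have "(\<lambda>x. free_act n x w) ` cls n x = {free_act n x w}"
    using rel_ideal_kills additive_subgroup.zero_closed[OF ideal.axioms(1)[OF ideal_rel_ideal], of
        n]
    by (force simp: cls_eq image_image free_act_add kills_def)
  then show ?thesis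
    by (simp add: act_def)
qed

lemma act_bar_cls: "act n (bar_Uq (cls n x)) w = free_act n (bar_free x) w"
proof -
  have "(\<lambda>x. free_act n x w) ` bar_Uq (cls n x) = {free_act n (bar_free x) w}"
    using rel_ideal_kills additive_subgroup.zero_closed[OF ideal.axioms(1)[OF ideal_rel_ideal], of
        n]
    by (force simp: cls_eq bar_Uq_def image_image free_act_add bar_free_add kills_def)
  then show ?thesis
    by (simp add: act_def)
qed

lemma cls_ring_hom: "ring_hom_ring (free_alg n) (Uq n) (cls n)"
  unfolding Uq_def cls_def[abs_def] by (rule ideal.rcos_ring_hom_ring[OF ideal_rel_ideal])

text \<open>The property P will later relate an element to its bar image, which is computed in the
  free algebra. Hence this induction over the generated subring yields representatives and not only
  cosets.\<close>

lemma UminusQ_rep: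
  assumes "u \<in> UminusQ n"
    and one: "P 1"
    and scal: "\<And>a. a \<in> rat_laurent \<Longrightarrow> P (scal a)"
    and divpow: "\<And>i k. i \<in> {1..n} \<Longrightarrow> P (divpow n i (gelt (GenF i)) k)"
    and uminus: "\<And>x. P x \<Longrightarrow> P (- x)"
    and add: "\<And>x y. P x \<Longrightarrow> P y \<Longrightarrow> P (x + y)"
    and mult: "\<And>x y. P x \<Longrightarrow> P y \<Longrightarrow> P (x * y)"
  shows "\<exists>x\<in>carrier (free_alg n). u = cls n x \<and> P x"
proof -
  interpret h: ring_hom_ring "free_alg n" "Uq n" "cls n" by (rule cls_ring_hom)
  show ?thesis
    using assms(1) unfolding UminusQ_def
  proof (induction rule: generate_ring.induct)
    case one
    then show ?case
      using h.hom_one free_alg_1 assms(2) by (intro bexI[of _ 1]) simp_all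
  next
    case (incl h)
    then show ?case
      using scal divpow divpow_closed[of "GenF _" n] free_alg_scal by (auto; blast?)
  next
    case (a_inv h)
    then obtain x where x: "x \<in> carrier (free_alg n)" "h = cls n x" "P x" by blast
    then have "\<ominus>\<^bsub>Uq n\<^esub> h = cls n (- x)"
      using h.hom_a_inv[of x] by (simp add: free_alg_a_inv)
    then show ?case
      using x free_alg_uminus uminus by blast
  next
    case (eng_add h1 h2)
    then obtain x y where x: "x \<in> carrier (free_alg n)" "h1 = cls n x" "P x"
      and y: "y \<in> carrier (free_alg n)" "h2 = cls n y" "P y" by blast
    then have "h1 \<oplus>\<^bsub>Uq n\<^esub> h2 = cls n (x + y)"
      using h.hom_add[of x y] by simp
    then show ?case
      using x y free_alg_add add by blast
  next
    case (eng_mult h1 h2)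
    then obtain x y where x: "x \<in> carrier (free_alg n)" "h1 = cls n x" "P x"
      and y: "y \<in> carrier (free_alg n)" "h2 = cls n y" "P y" by blast
    then have "h1 \<otimes>\<^bsub>Uq n\<^esub> h2 = cls n (x * y)"
      using h.hom_mult[of x y] by simp
    then show ?case
      using x y free_alg_mult mult by blast
  qed
qed

lemma cls_in_Uq: "x \<in> carrier (free_alg n) \<Longrightarrow> cls n x \<in> carrier (Uq n)"
proof -
  interpret h: ring_hom_ring "free_alg n" "Uq n" "cls n" by (rule cls_ring_hom)
  show "x \<in> carrier (free_alg n) \<Longrightarrow> cls n x \<in> carrier (Uq n)" by simp
qed

section \<open>Arc operators\<close>

text \<open>The value 0 on an occupied position makes these operators commute on all vectors, also
  at equal positions. A diagram can then be a product of arc operators over a set, in no particular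
  order.\<close>

definition add_pair :: "nat \<Rightarrow> wvec \<Rightarrow> wvec" where
  "add_pair x = lext (\<lambda>C. if sites C x = Vac then V ((sites C)(x := Dbl)) else 0)"

lemma linear_op_add_pair: "linear_op (add_pair x)"
  by (simp add: add_pair_def linear_op_lext)

lemma add_pair_V: "add_pair x (V \<sigma>) = (if \<sigma> x = Vac then V (\<sigma>(x := Dbl)) else 0)"
  by (simp add: add_pair_def V_def)

definition arc :: "nat \<Rightarrow> nat \<Rightarrow> wvec \<Rightarrow> wvec" where
  "arc u x w = add_pair x w + smul qv (add_pair u w)"

lemma linear_op_arc: "linear_op (arc u x)"
  unfolding arc_def[abs_def] by (intro linear_op_intros linear_op_add_pair)

lemma arc_V:
  assumes "\<sigma> u = Vac" "\<sigma> x = Vac"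
  shows "arc u x (V \<sigma>) = V (\<sigma>(x := Dbl)) + smul qv (V (\<sigma>(u := Dbl)))"
  using assms by (simp add: arc_def add_pair_V)

lemma add_pair_commute: "add_pair x (add_pair y w) = add_pair y (add_pair x w)"
proof (rule linear_op_eqI_V[of "\<lambda>w. add_pair x (add_pair y w)" "\<lambda>w. add_pair y (add_pair x w)"])
  show "add_pair x (add_pair y (V \<sigma>)) = add_pair y (add_pair x (V \<sigma>))" for \<sigma>
    by (cases "x = y") (auto simp: add_pair_V linear_op_0[OF linear_op_add_pair] fun_upd_twist)
qed (intro linear_op_comp[OF linear_op_add_pair] linear_op_add_pair)+

lemma arc_commute: "arc u x (arc v y w) = arc v y (arc u x w)"
  unfolding arc_def
  by (simp add: linear_op_add[OF linear_op_add_pair] linear_op_smul[OF linear_op_add_pair]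
      smul_add_right
      add_pair_commute[of x v] add_pair_commute[of x y] add_pair_commute[of u v]
          add_pair_commute[of u y] add_ac)

abbreviation arcs :: "wvec \<Rightarrow> (nat \<times> nat) set \<Rightarrow> wvec" where
  "arcs z M \<equiv> Finite_Set.fold (\<lambda>(u, x). arc u x) z M"

interpretation arcs: comp_fun_commute "\<lambda>(u, x). arc u x"
  by standard (auto simp: fun_eq_iff arc_commute)

lemma arcs_insert:
  assumes "finite M" "(u, x) \<notin> M"
  shows "arcs z (insert (u, x) M) = arc u x (arcs z M)"
  using arcs.fold_insert[OF assms] by simp

lemma arcs_insert2:
  assumes "finite M" "(u, x) \<notin> M"
  shows "arcs z (insert (u, x) M) = arcs (arc u x z) M"
  using arcs.fold_insert2[OF assms] by simp

lemma linear_op_arcs: "finite M \<Longrightarrow> linear_op (\<lambda>z. arcs z M)"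
proof (induction M rule: finite_induct)
  case (insert m M)
  obtain u x where m: "m = (u, x)" by (cases m)
  show ?case
    using linear_op_comp[OF linear_op_arc insert.IH, of u x] insert.hyps
    by (simp add: m arcs_insert)
qed (simp add: linear_op_id)

section \<open>Local moves of the lowering operators\<close>

lemma Fop_add_pair:
  assumes "x \<noteq> i" "x \<noteq> Suc i"
  shows "Fop n i (add_pair x w) = add_pair x (Fop n i w)"
proof (rule linear_op_eqI_V[of "\<lambda>w. Fop n i (add_pair x w)" "\<lambda>w. add_pair x (Fop n i w)"])
  fix \<sigma> :: "nat \<Rightarrow> site"
  have "\<sigma>(i := a, Suc i := b, x := Dbl) = \<sigma>(x := Dbl, i := a, Suc i := b)" for a b
    using assms by auto
  then show "Fop n i (add_pair x (V \<sigma>)) = add_pair x (Fop n i (V \<sigma>))"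
    using assms
    by (simp add: add_pair_V Fop_V loc_alt linear_op_sum_list[OF linear_op_add_pair]
        linear_op_smul[OF linear_op_add_pair] gen_act_linear)
qed (intro linear_op_comp[OF linear_op_add_pair] linear_op_comp[OF linear_op_gen_act]
    linear_op_add_pair linear_op_gen_act)+

lemma Fop_arc:
  assumes "x \<notin> {i, Suc i}" "u \<notin> {i, Suc i}"
  shows "Fop n i (arc u x w) = arc u x (Fop n i w)"
  using assms by (simp add: arc_def gen_act_linear Fop_add_pair)

lemma Fop_arcs:
  assumes "finite M" "\<And>u x. (u, x) \<in> M \<Longrightarrow> u \<notin> {i, Suc i} \<and> x \<notin> {i, Suc i}"
  shows "Fop n i (arcs z M) = arcs (Fop n i z) M"
  using assms
proof (induction M rule: finite_induct)
  case (insert m M)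
  obtain u x where m: "m = (u, x)" by (cases m)
  have "Fop n i (arcs z M) = arcs (Fop n i z) M"
    by (rule insert.IH) (use insert.prems in blast)
  then show ?case
    using insert.prems[of u x] insert.hyps by (simp add: m arcs_insert Fop_arc)
qed simp

text \<open>A pattern on which \<open>Fop n i\<close> vanishes and which persists when empty
  positions are filled by pairs. A killed background therefore gives a killed diagram, whatever arcs
  are placed on it.\<close>

definition killed :: "nat \<Rightarrow> nat \<Rightarrow> (nat \<Rightarrow> site) \<Rightarrow> bool" where
  "killed n i \<tau> \<longleftrightarrow> (if i = n then \<tau> n \<noteq> Plus else \<tau> i = Minus \<or> \<tau> (Suc i) = Plus)"

lemma Fop_killed: "killed n i \<tau> \<Longrightarrow> Fop n i (V \<tau>) = 0"
  unfolding killed_def Fop_V loc_def ftab_def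
  by (cases "\<tau> i"; cases "\<tau> (Suc i)") (auto split: if_splits)

text \<open>Peeling off one arc leaves backgrounds in which one empty position has been filled, and
  these are still killed.\<close>

lemma Fop_arcs_killed:
  assumes "finite M" "killed n i A"
  shows "Fop n i (arcs (V A) M) = 0"
  using assms
proof (induction M arbitrary: A rule: finite_induct)
  case (insert m M)
  obtain u x where m: "m = (u, x)" by (cases m)
  have k: "killed n i (A(y := Dbl))" if "A y = Vac" for y
    using insert.prems that by (auto simp: killed_def split: if_splits)
  have p: "Fop n i (arcs (add_pair y (V A)) M) = 0" for y
  proof (cases "A y = Vac")
    case True
    then show ?thesis
      using insert.IH[OF k[OF True]] by (simp only: add_pair_V True simp_thms if_True)
  next
    case False
    then show ?thesis
      using linear_op_0[OF linear_op_arcs[OF insert.hyps(1)]] by (simp add: add_pair_V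
          gen_act_linear)
  qed
  have "arcs (V A) (insert m M) = arcs (add_pair x (V A) + smul qv (add_pair u (V A))) M"
    using arcs_insert2[of M u x] insert.hyps by (simp add: m arc_def[of u x "V A"])
  then show ?case
    using insert.hyps p
    by (simp add: linear_op_add[OF linear_op_arcs] linear_op_smul[OF linear_op_arcs] gen_act_linear)
qed (simp add: Fop_killed)

lemma V_eqI: "(\<And>t. \<sigma> t = \<tau> t) \<Longrightarrow> V \<sigma> = V \<tau>"
  by (metis ext)

text \<open>The coefficients 1 and q that the module prescribes for an unbarred letter at i next to
  a barred one at i + 1 are those of an arc; this is where arcs come from.\<close>

lemma Fop_cup:
  assumes "i \<noteq> n" "A i = Plus" "A (Suc i) = Minus"
  shows "Fop n i (V A) = arc i (Suc i) (V (A(i := Vac, Suc i := Vac)))"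
  using assms by (auto simp: Fop_V loc_def ftab_def arc_V intro!: arg_cong2[of _ _ _ _ "(+)"]
      arg_cong[of _ _ "smul qv"] V_eqI)

text \<open>The term with the pair at i + 1 receives q^-1 from the table, the term with the pair at
  i brings the q of the arc: this is the origin of the loop value q + q^-1.\<close>

lemma Fop_cap:
  assumes "i \<noteq> n" "A i = Vac" "A (Suc i) = Vac"
  shows "Fop n i (arc i (Suc i) (V A)) = smul (qv + inverse qv) (V (A(i := Minus, Suc i := Plus)))"
  using assms by (simp add: Fop_V loc_def ftab_def arc_V gen_act_linear fun_upd_twist[of i "Suc i"]
      add.commute[of "inverse qv"] flip: smul_add_left)

text \<open>Terms in which i and i + 1 are both empty or both doubled die. In the surviving ones the
  factor q^-1 for a pair at i + 1 restores the coefficients 1 and q of a single arc between the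
  outer ends. In the last two identities one end is unmatched, and the outer end of the only arc is
  left empty.\<close>

lemma Fop_join:
  assumes "i \<noteq> n" "A i = Vac" "A (Suc i) = Vac" "A x = Vac" "A y = Vac" "distinct [x, y, i, Suc i]"
  shows "Fop n i (arc i x (arc (Suc i) y (V A))) = arc y x (V (A(i := Minus, Suc i := Plus)))"
    and "Fop n i (arc x i (arc y (Suc i) (V A))) = arc y x (V (A(i := Minus, Suc i := Plus)))"
    and "Fop n i (arc x i (arc (Suc i) y (V A))) = arc x y (V (A(i := Minus, Suc i := Plus)))"
    and "Fop n i (arc (Suc i) y (V A)) = V (A(i := Minus, Suc i := Plus))"
    and "Fop n i (arc x i (V A)) = V (A(i := Minus, Suc i := Plus))"
proof -
  have ne: "x \<noteq> y" "y \<noteq> x" "x \<noteq> i" "i \<noteq> x" "x \<noteq> Suc i" "Suc i \<noteq> x" "y \<noteq> i" "i \<noteq> y" "y \<noteq> Suc i"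
      "Suc i \<noteq> y"
    using assms by auto
  have tw: "A(x := a, i := b, Suc i := c) = A(i := b, Suc i := c, x := a)"
    "A(y := a, i := b, Suc i := c) = A(i := b, Suc i := c, y := a)"
    "A(x := a, Suc i := c, i := b) = A(i := b, Suc i := c, x := a)"
    "A(y := a, Suc i := c, i := b) = A(i := b, Suc i := c, y := a)"
    "A(i := b', x := a, i := b, Suc i := c) = A(i := b, Suc i := c, x := a)"
    "A(i := b', y := a, i := b, Suc i := c) = A(i := b, Suc i := c, y := a)"
    "A(Suc i := c', x := a, i := b, Suc i := c) = A(i := b, Suc i := c, x := a)"
    "A(Suc i := c', y := a, i := b, Suc i := c) = A(i := b, Suc i := c, y := a)"
    "A(Suc i := c', i := b, Suc i := c) = A(i := b, Suc i := c)" for a b b' c c'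
    using ne by (auto simp: fun_eq_iff)
  note S = Fop_V loc_def ftab_def arc_V gen_act_linear linear_op_add[OF linear_op_arc]
    linear_op_smul[OF linear_op_arc] ne assms tw
  show "Fop n i (arc i x (arc (Suc i) y (V A))) = arc y x (V (A(i := Minus, Suc i := Plus)))"
    "Fop n i (arc x i (arc y (Suc i) (V A))) = arc y x (V (A(i := Minus, Suc i := Plus)))"
    "Fop n i (arc x i (arc (Suc i) y (V A))) = arc x y (V (A(i := Minus, Suc i := Plus)))"
    "Fop n i (arc (Suc i) y (V A)) = V (A(i := Minus, Suc i := Plus))"
    "Fop n i (arc x i (V A)) = V (A(i := Minus, Suc i := Plus))"
    by (simp_all add: S smul_add_right add_ac mult.assoc)
qed

text \<open>The unbarred letter trades places, with coefficient 1, with whatever stands at i + 1, be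
  it nothing or a pair. An arc ending at i + 1 is therefore dragged along to i.\<close>

lemma Fop_shift_plus:
  assumes "i \<noteq> n" "A i = Plus" "A (Suc i) = Vac"
  shows "Fop n i (V A) = V (A(i := Vac, Suc i := Plus))"
    and "A x = Vac \<Longrightarrow> x \<noteq> Suc i \<Longrightarrow> Fop n i (arc (Suc i) x (V A)) = arc i x (V (A(i := Vac, Suc i :=
        Plus)))"
    and "A x = Vac \<Longrightarrow> x \<noteq> Suc i \<Longrightarrow> Fop n i (arc x (Suc i) (V A)) = arc x i (V (A(i := Vac, Suc i :=
        Plus)))"
proof -
  show "Fop n i (V A) = V (A(i := Vac, Suc i := Plus))"
    using assms by (simp add: Fop_V loc_def ftab_def)
  assume x: "A x = Vac" "x \<noteq> Suc i"
  then have ne: "x \<noteq> i" "i \<noteq> x" "Suc i \<noteq> x" "x \<noteq> Suc i" using assms by auto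
  have tw: "A(x := a, i := b, Suc i := c) = A(i := b, Suc i := c, x := a)"
    "A(Suc i := c', i := b, Suc i := c) = A(i := b, Suc i := c)"
    "A(i := b', Suc i := c, i := b) = A(i := b, Suc i := c)" for a b c c' b'
    using ne by (auto simp: fun_eq_iff)
  note S = Fop_V loc_def ftab_def arc_V gen_act_linear ne assms x tw
  show "Fop n i (arc (Suc i) x (V A)) = arc i x (V (A(i := Vac, Suc i := Plus)))"
    "Fop n i (arc x (Suc i) (V A)) = arc x i (V (A(i := Vac, Suc i := Plus)))"
    by (simp_all add: S)
qed

lemma Fop_shift_minus:
  assumes "i \<noteq> n" "A i = Vac" "A (Suc i) = Minus"
  shows "Fop n i (V A) = V (A(i := Minus, Suc i := Vac))"
    and "A x = Vac \<Longrightarrow> x \<noteq> i \<Longrightarrow> Fop n i (arc i x (V A)) = arc (Suc i) x (V (A(i := Minus, Suc i :=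
        Vac)))"
    and "A x = Vac \<Longrightarrow> x \<noteq> i \<Longrightarrow> Fop n i (arc x i (V A)) = arc x (Suc i) (V (A(i := Minus, Suc i :=
        Vac)))"
proof -
  show "Fop n i (V A) = V (A(i := Minus, Suc i := Vac))"
    using assms by (simp add: Fop_V loc_def ftab_def)
  assume x: "A x = Vac" "x \<noteq> i"
  then have ne: "x \<noteq> i" "i \<noteq> x" "Suc i \<noteq> x" "x \<noteq> Suc i" using assms by auto
  have tw: "A(x := a, i := b, Suc i := c) = A(i := b, Suc i := c, x := a)"
    "A(Suc i := c', i := b, Suc i := c) = A(i := b, Suc i := c)"
    "A(i := b', Suc i := c, i := b) = A(i := b, Suc i := c)" for a b c c' b'
    using ne by (auto simp: fun_eq_iff)
  note S = Fop_V loc_def ftab_def arc_V gen_act_linear ne assms x tw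
  show "Fop n i (arc i x (V A)) = arc (Suc i) x (V (A(i := Minus, Suc i := Vac)))"
    "Fop n i (arc x i (V A)) = arc x (Suc i) (V (A(i := Minus, Suc i := Vac)))"
    by (simp_all add: S)
qed

lemma Fop_last: "A n = Plus \<Longrightarrow> Fop n n (V A) = V (A(n := Minus))"
  by (simp add: Fop_V loc_def ftab_def fun_upd_triv2)

section \<open>Noncrossing diagrams\<close>

text \<open>The third clause is noncrossing, the fourth forbids unmatched empty positions below an
  arc. Together they make the arcs the parenthesis matching of the leading column, which is what
  \<open>u_of\<close> computes. Pairs arise from arcs only, so the background has none.\<close>

definition valid :: "nat \<Rightarrow> (nat \<times> nat) set \<Rightarrow> (nat \<Rightarrow> site) \<Rightarrow> bool" where
  "valid n M A \<longleftrightarrow>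
    (\<forall>u x. (u, x) \<in> M \<longrightarrow> 1 \<le> u \<and> u < x \<and> x \<le> n \<and> A u = Vac \<and> A x = Vac) \<and>
    (\<forall>u x v y. (u, x) \<in> M \<longrightarrow> (v, y) \<in> M \<longrightarrow> u = v \<or> u = y \<or> x = v \<or> x = y \<longrightarrow> u = v \<and> x = y) \<and>
    (\<forall>u x v y. (u, x) \<in> M \<longrightarrow> (v, y) \<in> M \<longrightarrow> u < v \<longrightarrow> v < x \<longrightarrow> y < x) \<and>
    (\<forall>u x t. (u, x) \<in> M \<longrightarrow> u < t \<longrightarrow> t < x \<longrightarrow> A t = Vac \<longrightarrow> (\<exists>y. (t, y) \<in> M \<or> (y, t) \<in> M)) \<and>
    (\<forall>t. A t \<noteq> Dbl) \<and> (\<forall>t. t \<notin> {1..n} \<longrightarrow> A t = Vac)"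

lemma validD:
  assumes "valid n M A"
  shows "(u, x) \<in> M \<Longrightarrow> 1 \<le> u \<and> u < x \<and> x \<le> n \<and> A u = Vac \<and> A x = Vac"
    and "(u, x) \<in> M \<Longrightarrow> (v, y) \<in> M \<Longrightarrow> u = v \<or> u = y \<or> x = v \<or> x = y \<Longrightarrow> u = v \<and> x = y"
    and "(u, x) \<in> M \<Longrightarrow> (v, y) \<in> M \<Longrightarrow> u < v \<Longrightarrow> v < x \<Longrightarrow> y < x"
    and "(u, x) \<in> M \<Longrightarrow> u < t \<Longrightarrow> t < x \<Longrightarrow> A t = Vac \<Longrightarrow> \<exists>y. (t, y) \<in> M \<or> (y, t) \<in> M"
    and "A t \<noteq> Dbl" and "t \<notin> {1..n} \<Longrightarrow> A t = Vac"
  using assms unfolding valid_def by blast+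

lemma validI:
  assumes "\<And>u x. (u, x) \<in> M \<Longrightarrow> 1 \<le> u \<and> u < x \<and> x \<le> n \<and> A u = Vac \<and> A x = Vac"
    and "\<And>u x v y. (u, x) \<in> M \<Longrightarrow> (v, y) \<in> M \<Longrightarrow> u = v \<or> u = y \<or> x = v \<or> x = y \<Longrightarrow> u = v \<and> x = y"
    and "\<And>u x v y. (u, x) \<in> M \<Longrightarrow> (v, y) \<in> M \<Longrightarrow> u < v \<Longrightarrow> v < x \<Longrightarrow> y < x"
    and "\<And>u x t. (u, x) \<in> M \<Longrightarrow> u < t \<Longrightarrow> t < x \<Longrightarrow> A t = Vac \<Longrightarrow> \<exists>y. (t, y) \<in> M \<or> (y, t) \<in> M"
    and "\<And>t. A t \<noteq> Dbl" and "\<And>t. t \<notin> {1..n} \<Longrightarrow> A t = Vac"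
  shows "valid n M A"
  using assms unfolding valid_def by blast

lemma valid_finite: "valid n M A \<Longrightarrow> finite M"
proof (rule finite_subset)
  assume v: "valid n M A"
  show "M \<subseteq> {1..n} \<times> {1..n}"
  proof
    fix z assume "z \<in> M"
    then show "z \<in> {1..n} \<times> {1..n}"
      using validD(1)[OF v, of "fst z" "snd z"] by (cases z) auto
  qed
qed simp

lemma valid_ends:
  assumes v: "valid n M A" and ux: "(u, x) \<in> M"
  shows "(u, z) \<in> M \<longleftrightarrow> z = x" "(z, x) \<in> M \<longleftrightarrow> z = u" "(z, u) \<notin> M" "(x, z) \<notin> M"
proof -
  have "u < x"
    using validD(1)[OF v ux] by simp
  then show "(u, z) \<in> M \<longleftrightarrow> z = x" "(z, x) \<in> M \<longleftrightarrow> z = u" "(z, u) \<notin> M" "(x, z) \<notin> M"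
    using validD(2)[OF v ux] ux less_irrefl by blast+
qed

section \<open>Stability of diagrams under the local moves\<close>

lemma valid_cup:
  assumes v: "valid n M A" and i: "1 \<le> i" "i < n" "A i = Plus" "A (Suc i) = Minus"
  shows "valid n (insert (i, Suc i) M) (A(i := Vac, Suc i := Vac))"
proof -
  note d = validD[OF v]
  have ni: "(i, y) \<notin> M" "(y, i) \<notin> M" "(Suc i, y) \<notin> M" "(y, Suc i) \<notin> M" for y
    using d(1)[of i y] d(1)[of y i] d(1)[of "Suc i" y] d(1)[of y "Suc i"] i by auto
  show ?thesis
  proof (rule validI, goal_cases)
    case (1 u x)
    then show ?case using d(1)[of u x] i by auto
  next
    case (2 u x v y)
    then show ?case using d(2)[of u x v y] ni by auto
  next
    case (3 u x v y)
    then have "x \<noteq> Suc i" using ni by (metis less_antisym insert_iff not_less_eq old.prod.inject)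
    then show ?case using 3 d(3)[of u x v y] ni by auto
  next
    case (4 u x t)
    then show ?case using d(4)[of u x t] ni by (auto split: if_splits)
  qed (use d(5,6) i in \<open>auto split: if_splits\<close>)
qed

lemma valid_cap:
  assumes v: "valid n M A" and i: "1 \<le> i" "i < n" "(i, Suc i) \<in> M"
  shows "valid n (M - {(i, Suc i)}) (A(i := Minus, Suc i := Plus))"
proof -
  note d = validD[OF v]
  note ni = valid_ends[OF v i(3)]
  show ?thesis
  proof (rule validI, goal_cases)
    case (1 u x)
    then have m: "(u, x) \<in> M" "(u, x) \<noteq> (i, Suc i)"
      by auto
    then have "u \<noteq> i" "u \<noteq> Suc i" "x \<noteq> i" "x \<noteq> Suc i"
      using ni by auto
    then show ?case using d(1)[OF m(1)] by simp
  next
    case (2 u x v y)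
    then show ?case by (intro d(2)) auto
  next
    case (3 u x v y)
    then show ?case by (intro d(3)[of u x v y]) auto
  next
    case (4 u x t)
    then have "A t = Vac" "t \<noteq> i" "t \<noteq> Suc i" "(u, x) \<in> M"
      by (auto split: if_splits)
    then show ?case using d(4)[of u x t] 4(2,3) by auto
  qed (use d(5,6) i in \<open>auto split: if_splits\<close>)
qed

text \<open>The unmatched empty position moves from i + 1 to i. It cannot slip below an arc, since
  an arc over i would have covered i + 1 as well.\<close>

lemma valid_shift_plus_free:
  assumes v: "valid n M A" and i: "1 \<le> i" "i < n" "A i = Plus" "A (Suc i) = Vac"
    and free: "\<And>y. (Suc i, y) \<notin> M" "\<And>y. (y, Suc i) \<notin> M"
  shows "valid n M (A(i := Vac, Suc i := Plus))"
proof -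
  note d = validD[OF v]
  have ni: "(i, y) \<notin> M" "(y, i) \<notin> M" for y
    using d(1)[of i y] d(1)[of y i] i by auto
  have no: "\<not> (u < i \<and> i < x)" if "(u, x) \<in> M" for u x
  proof
    assume "u < i \<and> i < x"
    moreover have "x \<noteq> Suc i" using that free by auto
    ultimately show False using d(4)[OF that, of "Suc i"] i free by auto
  qed
  show ?thesis
  proof (rule validI, goal_cases)
    case (1 u x)
    then show ?case using d(1)[of u x] ni free by auto
  next
    case (4 u x t)
    then show ?case using d(4)[of u x t] no[of u x] by (auto split: if_splits)
  next
    case (2 u x v y)
    then show ?case by (rule d(2))
  next
    case (3 u x v y)
    then show ?case by (rule d(3))
  qed (use d(5,6) i in \<open>auto split: if_splits\<close>)
qed

lemma valid_shift_minus_free: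
  assumes v: "valid n M A" and i: "1 \<le> i" "i < n" "A i = Vac" "A (Suc i) = Minus"
    and free: "\<And>y. (i, y) \<notin> M" "\<And>y. (y, i) \<notin> M"
  shows "valid n M (A(i := Minus, Suc i := Vac))"
proof -
  note d = validD[OF v]
  have ni: "(Suc i, y) \<notin> M" "(y, Suc i) \<notin> M" for y
    using d(1)[of "Suc i" y] d(1)[of y "Suc i"] i by auto
  have no: "\<not> (u < Suc i \<and> Suc i < x)" if "(u, x) \<in> M" for u x
  proof
    assume "u < Suc i \<and> Suc i < x"
    moreover have "u \<noteq> i" using that free by auto
    ultimately show False using d(4)[OF that, of i] i free by auto
  qed
  show ?thesis
  proof (rule validI, goal_cases)
    case (1 u x)
    then show ?case using d(1)[of u x] ni free by auto
  next
    case (4 u x t)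
    then show ?case using d(4)[of u x t] no[of u x] by (auto split: if_splits)
  next
    case (2 u x v y)
    then show ?case by (rule d(2))
  next
    case (3 u x v y)
    then show ?case by (rule d(3))
  qed (use d(5,6) i in \<open>auto split: if_splits\<close>)
qed

lemma valid_last:
  assumes v: "valid n M A" and n: "1 \<le> n" "A n = Plus"
  shows "valid n M (A(n := Minus))"
proof -
  note d = validD[OF v]
  show ?thesis
  proof (rule validI, goal_cases)
    case (1 u x)
    then show ?case using d(1)[of u x] n by auto
  next
    case (4 u x t)
    then show ?case using d(4)[of u x t] by (auto split: if_splits)
  next
    case (2 u x v y)
    then show ?case by (rule d(2))
  next
    case (3 u x v y)
    then show ?case by (rule d(3))
  qed (use d(5,6) n in \<open>auto split: if_splits\<close>)
qed

text \<open>Two arcs opening at neighbouring positions are nested, hence y < x. Anything that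
  crossed the new arc (y, x) would have crossed one of the two old arcs.\<close>

lemma valid_join_LL:
  assumes v: "valid n M A" and i: "1 \<le> i" "i < n" "(i, x) \<in> M" "(Suc i, y) \<in> M"
  shows "Suc i < y" "y < x" "valid n (insert (y, x) (M - {(i, x), (Suc i, y)})) (A(i := Minus, Suc
      i := Plus))"
proof -
  note d = validD[OF v]
  have "x \<noteq> Suc i"
    using valid_ends(4)[OF v i(3)] i(4) by auto
  moreover have "i < x" "Suc i < y"
    using d(1)[OF i(3)] d(1)[OF i(4)] by auto
  ultimately have ord: "Suc i < y" "y < x"
    using d(3)[OF i(3,4)] by auto
  then show "Suc i < y" "y < x" by auto
  note e = valid_ends[OF v i(3)] valid_ends[OF v i(4)]
  let ?M = "insert (y, x) (M - {(i, x), (Suc i, y)})"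
  have mem: "(a, b) \<in> ?M \<longleftrightarrow> a = y \<and> b = x \<or> (a, b) \<in> M \<and> (a, b) \<noteq> (i, x) \<and> (a, b) \<noteq> (Suc i, y)" for
      a b
    by auto
  have far: "a \<noteq> i \<and> b \<noteq> i \<and> a \<noteq> x \<and> b \<noteq> x \<and> a \<noteq> Suc i \<and> b \<noteq> Suc i \<and> a \<noteq> y \<and> b \<noteq> y"
    if "(a, b) \<in> M" "(a, b) \<noteq> (i, x) \<and> (a, b) \<noteq> (Suc i, y)" for a b
    using that e by blast
  show "valid n ?M (A(i := Minus, Suc i := Plus))"
  proof (rule validI, unfold mem, goal_cases)
    case (1 a b)
    then show ?case using d(1)[of a b] d(1)[OF i(3)] d(1)[OF i(4)] far[of a b] ord i by auto
  next
    case (2 a b c e)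
    then show ?case using d(2)[of a b c e] far[of a b] far[of c e] ord d(1)[of a b] d(1)[of c e] i
        by auto
  next
    case (3 a b c e)
    show ?case
    proof (cases "(a, b) = (y, x)"; cases "(c, e) = (y, x)")
      assume ab: "(a, b) = (y, x)" and ce: "(c, e) \<noteq> (y, x)"
      then have m: "(c, e) \<in> M" "(c, e) \<noteq> (i, x) \<and> (c, e) \<noteq> (Suc i, y)"
        using 3 by auto
      have order: "c < e"
        using d(1)[OF m(1)] by simp
      show "e < b"
        using 3(3,4) ab far[OF m] ord order d(3)[OF i(3) m(1)] d(3)[OF m(1) i(3)] d(3)[OF i(4)
            m(1)] d(3)[OF m(1) i(4)]
        unfolding prod.inject by presburger
    next
      assume ab: "(a, b) \<noteq> (y, x)" and ce: "(c, e) = (y, x)"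
      then have m: "(a, b) \<in> M" "(a, b) \<noteq> (i, x) \<and> (a, b) \<noteq> (Suc i, y)"
        using 3 by auto
      have order: "a < b"
        using d(1)[OF m(1)] by simp
      show "e < b"
        using 3(3,4) ce far[OF m] ord order d(3)[OF i(3) m(1)] d(3)[OF m(1) i(3)] d(3)[OF i(4)
            m(1)] d(3)[OF m(1) i(4)]
        unfolding prod.inject by presburger
    next
      assume "(a, b) \<noteq> (y, x)" "(c, e) \<noteq> (y, x)"
      then show "e < b"
        using 3 d(3)[of a b c e] by auto
    qed (use 3 ord in auto)
  next
    case (4 a b t)
    have t: "A t = Vac" "t \<noteq> i" "t \<noteq> Suc i"
      using 4(4) by (auto split: if_splits)
    \<comment> \<open>A position below the new arc lay below an old one, so it was matched in M. If
      its arc is one of those removed, then t is x or y and the new arc ends there.\<close>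
    have "\<exists>z. (t, z) \<in> M \<or> (z, t) \<in> M"
    proof (cases "(a, b) \<in> M")
      case True
      then show ?thesis using d(4)[OF True 4(2,3) t(1)] by blast
    next
      case False
      then have "a = y" "b = x" using 4(1) by auto
      then show ?thesis
        using 4(2,3) t ord d(4)[OF i(3), of t] d(4)[OF i(4), of t] by (cases "t < Suc i") auto
    qed
    then show ?case
      using e t by (metis Pair_inject)
  qed (use d(5,6) i in \<open>auto split: if_splits\<close>)
qed

text \<open>The mirror image: arcs closing at neighbouring positions are nested, and the new arc
  lies inside the outer one, (y, i + 1).\<close>

lemma valid_join_RR:
  assumes v: "valid n M A" and i: "1 \<le> i" "i < n" "(x, i) \<in> M" "(y, Suc i) \<in> M"
  shows "y < x" "x < i" "valid n (insert (y, x) (M - {(x, i), (y, Suc i)})) (A(i := Minus, Suc i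
      := Plus))"
proof -
  note d = validD[OF v]
  have "y \<noteq> i"
    using valid_ends(4)[OF v i(3)] i(4) by auto
  moreover have "x < i" "y < Suc i"
    using d(1)[OF i(3)] d(1)[OF i(4)] by auto
  moreover have "x \<noteq> y"
    using valid_ends(1)[OF v i(3), of "Suc i"] i(4) by auto
  ultimately have ord: "y < x" "x < i"
    using d(3)[OF i(3,4)] by (cases "x < y"; simp)+
  then show "y < x" "x < i" by auto
  note e = valid_ends[OF v i(3)] valid_ends[OF v i(4)]
  let ?M = "insert (y, x) (M - {(x, i), (y, Suc i)})"
  have mem: "(a, b) \<in> ?M \<longleftrightarrow> a = y \<and> b = x \<or> (a, b) \<in> M \<and> (a, b) \<noteq> (x, i) \<and> (a, b) \<noteq> (y, Suc i)" for
      a b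
    by auto
  have far: "a \<noteq> x \<and> b \<noteq> x \<and> a \<noteq> i \<and> b \<noteq> i \<and> a \<noteq> y \<and> b \<noteq> y \<and> a \<noteq> Suc i \<and> b \<noteq> Suc i"
    if "(a, b) \<in> M" "(a, b) \<noteq> (x, i) \<and> (a, b) \<noteq> (y, Suc i)" for a b
    using that e by blast
  show "valid n ?M (A(i := Minus, Suc i := Plus))"
  proof (rule validI, unfold mem, goal_cases)
    case (1 a b)
    then show ?case using d(1)[of a b] d(1)[OF i(3)] d(1)[OF i(4)] far[of a b] ord i by auto
  next
    case (2 a b c e)
    then show ?case using d(2)[of a b c e] far[of a b] far[of c e] ord d(1)[of a b] d(1)[of c e] i
        by auto
  next
    case (3 a b c e)
    show ?case
    proof (cases "(a, b) = (y, x)"; cases "(c, e) = (y, x)")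
      assume ab: "(a, b) = (y, x)" and ce: "(c, e) \<noteq> (y, x)"
      then have m: "(c, e) \<in> M" "(c, e) \<noteq> (x, i) \<and> (c, e) \<noteq> (y, Suc i)"
        using 3 by auto
      have order: "c < e"
        using d(1)[OF m(1)] by simp
      show "e < b"
        using 3(3,4) ab far[OF m] ord order d(3)[OF i(3) m(1)] d(3)[OF m(1) i(3)] d(3)[OF i(4)
            m(1)] d(3)[OF m(1) i(4)]
        unfolding prod.inject by (cases "x < e") auto
    next
      assume ab: "(a, b) \<noteq> (y, x)" and ce: "(c, e) = (y, x)"
      then have m: "(a, b) \<in> M" "(a, b) \<noteq> (x, i) \<and> (a, b) \<noteq> (y, Suc i)"
        using 3 by auto
      have order: "a < b"
        using d(1)[OF m(1)] by simp
      show "e < b"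
        using 3(3,4) ce far[OF m] ord order d(3)[OF i(3) m(1)] d(3)[OF m(1) i(3)] d(3)[OF i(4)
            m(1)] d(3)[OF m(1) i(4)]
        unfolding prod.inject by presburger
    next
      assume "(a, b) \<noteq> (y, x)" "(c, e) \<noteq> (y, x)"
      then show "e < b"
        using 3 d(3)[of a b c e] by auto
    qed (use 3 ord in auto)
  next
    case (4 a b t)
    have t: "A t = Vac" "t \<noteq> i" "t \<noteq> Suc i"
      using 4(4) by (auto split: if_splits)
    have "\<exists>z. (t, z) \<in> M \<or> (z, t) \<in> M"
    proof (cases "(a, b) \<in> M")
      case True
      then show ?thesis using d(4)[OF True 4(2,3) t(1)] by blast
    next
      case False
      then have "a = y" "b = x" using 4(1) by auto
      then show ?thesis
        using 4(2,3) t ord d(4)[OF i(3), of t] d(4)[OF i(4), of t] by (cases "t < Suc i") auto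
    qed
    then show ?case
      using e t by (metis Pair_inject)
  qed (use d(5,6) i in \<open>auto split: if_splits\<close>)
qed

text \<open>Two arcs side by side merge into one that spans both. The only positions below it that
  are neither below nor at an outer end of an old arc are i and i + 1, and these become
  occupied.\<close>

lemma valid_join_RL:
  assumes v: "valid n M A" and i: "1 \<le> i" "i < n" "(x, i) \<in> M" "(Suc i, y) \<in> M"
  shows "x < i" "Suc i < y" "valid n (insert (x, y) (M - {(x, i), (Suc i, y)})) (A(i := Minus, Suc
      i := Plus))"
proof -
  note d = validD[OF v]
  have ord: "x < i" "Suc i < y"
    using d(1)[OF i(3)] d(1)[OF i(4)] by auto
  then show "x < i" "Suc i < y" by auto
  note e = valid_ends[OF v i(3)] valid_ends[OF v i(4)]
  let ?M = "insert (x, y) (M - {(x, i), (Suc i, y)})"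
  have mem: "(a, b) \<in> ?M \<longleftrightarrow> a = x \<and> b = y \<or> (a, b) \<in> M \<and> (a, b) \<noteq> (x, i) \<and> (a, b) \<noteq> (Suc i, y)" for
      a b
    by auto
  have far: "a \<noteq> x \<and> b \<noteq> x \<and> a \<noteq> i \<and> b \<noteq> i \<and> a \<noteq> Suc i \<and> b \<noteq> Suc i \<and> a \<noteq> y \<and> b \<noteq> y"
    if "(a, b) \<in> M" "(a, b) \<noteq> (x, i) \<and> (a, b) \<noteq> (Suc i, y)" for a b
    using that e by blast
  show "valid n ?M (A(i := Minus, Suc i := Plus))"
  proof (rule validI, unfold mem, goal_cases)
    case (1 a b)
    then show ?case using d(1)[of a b] d(1)[OF i(3)] d(1)[OF i(4)] far[of a b] ord i by auto
  next
    case (2 a b c e)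
    then show ?case using d(2)[of a b c e] far[of a b] far[of c e] ord d(1)[of a b] d(1)[of c e] i
        by auto
  next
    case (3 a b c e)
    show ?case
    proof (cases "(a, b) = (x, y)"; cases "(c, e) = (x, y)")
      assume ab: "(a, b) = (x, y)" and ce: "(c, e) \<noteq> (x, y)"
      then have m: "(c, e) \<in> M" "(c, e) \<noteq> (x, i) \<and> (c, e) \<noteq> (Suc i, y)"
        using 3 by auto
      have order: "c < e"
        using d(1)[OF m(1)] by simp
      show "e < b"
        using 3(3,4) ab far[OF m] ord order d(3)[OF i(3) m(1)] d(3)[OF m(1) i(3)] d(3)[OF i(4)
            m(1)] d(3)[OF m(1) i(4)]
        unfolding prod.inject by (cases "c < i") auto
    next
      assume ab: "(a, b) \<noteq> (x, y)" and ce: "(c, e) = (x, y)"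
      then have m: "(a, b) \<in> M" "(a, b) \<noteq> (x, i) \<and> (a, b) \<noteq> (Suc i, y)"
        using 3 by auto
      have order: "a < b"
        using d(1)[OF m(1)] by simp
      show "e < b"
        using 3(3,4) ce far[OF m] ord order d(3)[OF i(3) m(1)] d(3)[OF m(1) i(3)] d(3)[OF i(4)
            m(1)] d(3)[OF m(1) i(4)]
        unfolding prod.inject by auto
    next
      assume "(a, b) \<noteq> (x, y)" "(c, e) \<noteq> (x, y)"
      then show "e < b"
        using 3 d(3)[of a b c e] by auto
    qed (use 3 ord in auto)
  next
    case (4 a b t)
    have t: "A t = Vac" "t \<noteq> i" "t \<noteq> Suc i"
      using 4(4) by (auto split: if_splits)
    have "\<exists>z. (t, z) \<in> M \<or> (z, t) \<in> M"
    proof (cases "(a, b) \<in> M")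
      case True
      then show ?thesis using d(4)[OF True 4(2,3) t(1)] by blast
    next
      case False
      then have "a = x" "b = y" using 4(1) by auto
      then show ?thesis
        using 4(2,3) t ord d(4)[OF i(3), of t] d(4)[OF i(4), of t] by (cases "t < Suc i") auto
    qed
    then show ?case
      using e t by (metis Pair_inject)
  qed (use d(5,6) i in \<open>auto split: if_splits\<close>)
qed

text \<open>The end of the arc slides onto the neighbouring position, which carried a letter and
  hence was no end; as no position lies between the two, no crossing can arise. The three lemmas
  that follow are the other combinations of end and direction.\<close>

lemma valid_shift_plus_L:
  assumes v: "valid n M A" and i: "1 \<le> i" "i < n" "(Suc i, y) \<in> M" "A i = Plus" "A (Suc i) = Vac"
  shows "Suc i < y" "valid n (insert (i, y) (M - {(Suc i, y)})) (A(i := Vac, Suc i := Plus))"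
proof -
  note d = validD[OF v]
  have ord: "Suc i < y"
    using d(1)[OF i(3)] by auto
  have ni: "(i, z) \<notin> M" "(z, i) \<notin> M" for z
    using d(1)[of i z] d(1)[of z i] i by auto
  show "Suc i < y" by (rule ord)
  note e = valid_ends[OF v i(3)]
  let ?M = "insert (i, y) (M - {(Suc i, y)})"
  have mem: "(a, b) \<in> ?M \<longleftrightarrow> a = i \<and> b = y \<or> (a, b) \<in> M \<and> (a, b) \<noteq> (Suc i, y)" for a b
    by auto
  have far: "a \<noteq> i \<and> b \<noteq> i \<and> a \<noteq> Suc i \<and> b \<noteq> Suc i \<and> a \<noteq> y \<and> b \<noteq> y"
    if "(a, b) \<in> M" "(a, b) \<noteq> (Suc i, y)" for a b
    using that e ni by blast
  show "valid n ?M (A(i := Vac, Suc i := Plus))"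
  proof (rule validI, unfold mem, goal_cases)
    case (1 a b)
    then show ?case using d(1)[of a b] d(1)[OF i(3)] far[of a b] ord i by auto
  next
    case (2 a b c e)
    then show ?case using d(2)[of a b c e] far[of a b] far[of c e] ord d(1)[of a b] d(1)[of c e] i
        by auto
  next
    case (3 a b c e)
    show ?case
    proof (cases "(a, b) = (i, y)"; cases "(c, e) = (i, y)")
      assume ab: "(a, b) = (i, y)" and ce: "(c, e) \<noteq> (i, y)"
      then have m: "(c, e) \<in> M" "(c, e) \<noteq> (Suc i, y)"
        using 3 by auto
      have order: "c < e"
        using d(1)[OF m(1)] by simp
      show "e < b"
        using 3(3,4) ab far[OF m] ord order d(3)[OF i(3) m(1)] d(3)[OF m(1) i(3)]
        unfolding prod.inject by presburger
    next
      assume ab: "(a, b) \<noteq> (i, y)" and ce: "(c, e) = (i, y)"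
      then have m: "(a, b) \<in> M" "(a, b) \<noteq> (Suc i, y)"
        using 3 by auto
      have order: "a < b"
        using d(1)[OF m(1)] by simp
      show "e < b"
        using 3(3,4) ce far[OF m] ord order d(3)[OF i(3) m(1)] d(3)[OF m(1) i(3)]
        unfolding prod.inject by presburger
    next
      assume "(a, b) \<noteq> (i, y)" "(c, e) \<noteq> (i, y)"
      then show "e < b"
        using 3 d(3)[of a b c e] by auto
    qed (use 3 ord in auto)
  next
    case (4 a b t)
    have "(A t = Vac \<and> t \<noteq> Suc i \<and> t \<noteq> i) \<or> t = i"
      using 4(4) by (auto split: if_splits)
    then show ?case
    proof
      assume t: "A t = Vac \<and> t \<noteq> Suc i \<and> t \<noteq> i"
      have "\<exists>z. (t, z) \<in> M \<or> (z, t) \<in> M"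
      proof (cases "(a, b) \<in> M")
        case True
        then show ?thesis using d(4)[OF True 4(2,3)] t by blast
      next
        case False
        then have "a = i" "b = y" using 4(1) by auto
        then show ?thesis
          using 4(2,3) t ord d(4)[OF i(3), of t] by auto
      qed
      then show ?case
        using e t by (metis Pair_inject)
    qed auto
  qed (use d(5,6) i in \<open>auto split: if_splits\<close>)
qed

lemma valid_shift_plus_R:
  assumes v: "valid n M A" and i: "1 \<le> i" "i < n" "(x, Suc i) \<in> M" "A i = Plus" "A (Suc i) = Vac"
  shows "x < i" "valid n (insert (x, i) (M - {(x, Suc i)})) (A(i := Vac, Suc i := Plus))"
proof -
  note d = validD[OF v]
  have ni: "(i, z) \<notin> M" "(z, i) \<notin> M" for z
    using d(1)[of i z] d(1)[of z i] i by auto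
  have "x \<noteq> i" "x < Suc i"
    using d(1)[OF i(3)] i by auto
  then have ord: "x < i" by simp
  show "x < i" by (rule ord)
  note e = valid_ends[OF v i(3)]
  let ?M = "insert (x, i) (M - {(x, Suc i)})"
  have mem: "(a, b) \<in> ?M \<longleftrightarrow> a = x \<and> b = i \<or> (a, b) \<in> M \<and> (a, b) \<noteq> (x, Suc i)" for a b
    by auto
  have far: "a \<noteq> i \<and> b \<noteq> i \<and> a \<noteq> x \<and> b \<noteq> x \<and> a \<noteq> Suc i \<and> b \<noteq> Suc i"
    if "(a, b) \<in> M" "(a, b) \<noteq> (x, Suc i)" for a b
    using that e ni by blast
  show "valid n ?M (A(i := Vac, Suc i := Plus))"
  proof (rule validI, unfold mem, goal_cases)
    case (1 a b)
    then show ?case using d(1)[of a b] d(1)[OF i(3)] far[of a b] ord i by auto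
  next
    case (2 a b c e)
    then show ?case using d(2)[of a b c e] far[of a b] far[of c e] ord d(1)[of a b] d(1)[of c e] i
        by auto
  next
    case (3 a b c e)
    show ?case
    proof (cases "(a, b) = (x, i)"; cases "(c, e) = (x, i)")
      assume ab: "(a, b) = (x, i)" and ce: "(c, e) \<noteq> (x, i)"
      then have m: "(c, e) \<in> M" "(c, e) \<noteq> (x, Suc i)"
        using 3 by auto
      have order: "c < e"
        using d(1)[OF m(1)] by simp
      show "e < b"
        using 3(3,4) ab far[OF m] ord order d(3)[OF i(3) m(1)] d(3)[OF m(1) i(3)]
        unfolding prod.inject by presburger
    next
      assume ab: "(a, b) \<noteq> (x, i)" and ce: "(c, e) = (x, i)"
      then have m: "(a, b) \<in> M" "(a, b) \<noteq> (x, Suc i)"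
        using 3 by auto
      have order: "a < b"
        using d(1)[OF m(1)] by simp
      show "e < b"
        using 3(3,4) ce far[OF m] ord order d(3)[OF i(3) m(1)] d(3)[OF m(1) i(3)]
        unfolding prod.inject by presburger
    next
      assume "(a, b) \<noteq> (x, i)" "(c, e) \<noteq> (x, i)"
      then show "e < b"
        using 3 d(3)[of a b c e] by auto
    qed (use 3 ord in auto)
  next
    case (4 a b t)
    have "(A t = Vac \<and> t \<noteq> Suc i \<and> t \<noteq> i) \<or> t = i"
      using 4(4) by (auto split: if_splits)
    then show ?case
    proof
      assume t: "A t = Vac \<and> t \<noteq> Suc i \<and> t \<noteq> i"
      have "\<exists>z. (t, z) \<in> M \<or> (z, t) \<in> M"
      proof (cases "(a, b) \<in> M")
        case True
        then show ?thesis using d(4)[OF True 4(2,3)] t by blast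
      next
        case False
        then have "a = x" "b = i" using 4(1) by auto
        then show ?thesis
          using 4(2,3) t ord d(4)[OF i(3), of t] by auto
      qed
      then show ?case
        using e t by (metis Pair_inject)
    qed auto
  qed (use d(5,6) i in \<open>auto split: if_splits\<close>)
qed

lemma valid_shift_minus_L:
  assumes v: "valid n M A" and i: "1 \<le> i" "i < n" "(i, y) \<in> M" "A i = Vac" "A (Suc i) = Minus"
  shows "Suc i < y" "valid n (insert (Suc i, y) (M - {(i, y)})) (A(i := Minus, Suc i := Vac))"
proof -
  note d = validD[OF v]
  have ni: "(Suc i, z) \<notin> M" "(z, Suc i) \<notin> M" for z
    using d(1)[of "Suc i" z] d(1)[of z "Suc i"] i by auto
  have "y \<noteq> Suc i" "i < y"
    using d(1)[OF i(3)] i by auto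
  then have ord: "Suc i < y" by simp
  show "Suc i < y" by (rule ord)
  note e = valid_ends[OF v i(3)]
  let ?M = "insert (Suc i, y) (M - {(i, y)})"
  have mem: "(a, b) \<in> ?M \<longleftrightarrow> a = Suc i \<and> b = y \<or> (a, b) \<in> M \<and> (a, b) \<noteq> (i, y)" for a b
    by auto
  have far: "a \<noteq> Suc i \<and> b \<noteq> Suc i \<and> a \<noteq> i \<and> b \<noteq> i \<and> a \<noteq> y \<and> b \<noteq> y"
    if "(a, b) \<in> M" "(a, b) \<noteq> (i, y)" for a b
    using that e ni by blast
  show "valid n ?M (A(i := Minus, Suc i := Vac))"
  proof (rule validI, unfold mem, goal_cases)
    case (1 a b)
    then show ?case using d(1)[of a b] d(1)[OF i(3)] far[of a b] ord i by auto
  next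
    case (2 a b c e)
    then show ?case using d(2)[of a b c e] far[of a b] far[of c e] ord d(1)[of a b] d(1)[of c e] i
        by auto
  next
    case (3 a b c e)
    show ?case
    proof (cases "(a, b) = (Suc i, y)"; cases "(c, e) = (Suc i, y)")
      assume ab: "(a, b) = (Suc i, y)" and ce: "(c, e) \<noteq> (Suc i, y)"
      then have m: "(c, e) \<in> M" "(c, e) \<noteq> (i, y)"
        using 3 by auto
      have order: "c < e"
        using d(1)[OF m(1)] by simp
      show "e < b"
        using 3(3,4) ab far[OF m] ord order d(3)[OF i(3) m(1)] d(3)[OF m(1) i(3)]
        unfolding prod.inject by presburger
    next
      assume ab: "(a, b) \<noteq> (Suc i, y)" and ce: "(c, e) = (Suc i, y)"
      then have m: "(a, b) \<in> M" "(a, b) \<noteq> (i, y)"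
        using 3 by auto
      have order: "a < b"
        using d(1)[OF m(1)] by simp
      show "e < b"
        using 3(3,4) ce far[OF m] ord order d(3)[OF i(3) m(1)] d(3)[OF m(1) i(3)]
        unfolding prod.inject by presburger
    next
      assume "(a, b) \<noteq> (Suc i, y)" "(c, e) \<noteq> (Suc i, y)"
      then show "e < b"
        using 3 d(3)[of a b c e] by auto
    qed (use 3 ord in auto)
  next
    case (4 a b t)
    have "(A t = Vac \<and> t \<noteq> Suc i \<and> t \<noteq> i) \<or> t = Suc i"
      using 4(4) by (auto split: if_splits)
    then show ?case
    proof
      assume t: "A t = Vac \<and> t \<noteq> Suc i \<and> t \<noteq> i"
      have "\<exists>z. (t, z) \<in> M \<or> (z, t) \<in> M"
      proof (cases "(a, b) \<in> M")
        case True
        then show ?thesis using d(4)[OF True 4(2,3)] t by blast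
      next
        case False
        then have "a = Suc i" "b = y" using 4(1) by auto
        then show ?thesis
          using 4(2,3) t ord d(4)[OF i(3), of t] by auto
      qed
      then show ?case
        using e t by (metis Pair_inject)
    qed auto
  qed (use d(5,6) i in \<open>auto split: if_splits\<close>)
qed

lemma valid_shift_minus_R:
  assumes v: "valid n M A" and i: "1 \<le> i" "i < n" "(x, i) \<in> M" "A i = Vac" "A (Suc i) = Minus"
  shows "x < i" "valid n (insert (x, Suc i) (M - {(x, i)})) (A(i := Minus, Suc i := Vac))"
proof -
  note d = validD[OF v]
  have ord: "x < i"
    using d(1)[OF i(3)] by auto
  have ni: "(Suc i, z) \<notin> M" "(z, Suc i) \<notin> M" for z
    using d(1)[of "Suc i" z] d(1)[of z "Suc i"] i by auto
  show "x < i" by (rule ord)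
  note e = valid_ends[OF v i(3)]
  let ?M = "insert (x, Suc i) (M - {(x, i)})"
  have mem: "(a, b) \<in> ?M \<longleftrightarrow> a = x \<and> b = Suc i \<or> (a, b) \<in> M \<and> (a, b) \<noteq> (x, i)" for a b
    by auto
  have far: "a \<noteq> Suc i \<and> b \<noteq> Suc i \<and> a \<noteq> x \<and> b \<noteq> x \<and> a \<noteq> i \<and> b \<noteq> i"
    if "(a, b) \<in> M" "(a, b) \<noteq> (x, i)" for a b
    using that e ni by blast
  show "valid n ?M (A(i := Minus, Suc i := Vac))"
  proof (rule validI, unfold mem, goal_cases)
    case (1 a b)
    then show ?case using d(1)[of a b] d(1)[OF i(3)] far[of a b] ord i by auto
  next
    case (2 a b c e)
    then show ?case using d(2)[of a b c e] far[of a b] far[of c e] ord d(1)[of a b] d(1)[of c e] i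
        by auto
  next
    case (3 a b c e)
    show ?case
    proof (cases "(a, b) = (x, Suc i)"; cases "(c, e) = (x, Suc i)")
      assume ab: "(a, b) = (x, Suc i)" and ce: "(c, e) \<noteq> (x, Suc i)"
      then have m: "(c, e) \<in> M" "(c, e) \<noteq> (x, i)"
        using 3 by auto
      have order: "c < e"
        using d(1)[OF m(1)] by simp
      show "e < b"
        using 3(3,4) ab far[OF m] ord order d(3)[OF i(3) m(1)] d(3)[OF m(1) i(3)]
        unfolding prod.inject by presburger
    next
      assume ab: "(a, b) \<noteq> (x, Suc i)" and ce: "(c, e) = (x, Suc i)"
      then have m: "(a, b) \<in> M" "(a, b) \<noteq> (x, i)"
        using 3 by auto
      have order: "a < b"
        using d(1)[OF m(1)] by simp
      show "e < b"
        using 3(3,4) ce far[OF m] ord order d(3)[OF i(3) m(1)] d(3)[OF m(1) i(3)]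
        unfolding prod.inject by presburger
    next
      assume "(a, b) \<noteq> (x, Suc i)" "(c, e) \<noteq> (x, Suc i)"
      then show "e < b"
        using 3 d(3)[of a b c e] by auto
    qed (use 3 ord in auto)
  next
    case (4 a b t)
    have "(A t = Vac \<and> t \<noteq> Suc i \<and> t \<noteq> i) \<or> t = Suc i"
      using 4(4) by (auto split: if_splits)
    then show ?case
    proof
      assume t: "A t = Vac \<and> t \<noteq> Suc i \<and> t \<noteq> i"
      have "\<exists>z. (t, z) \<in> M \<or> (z, t) \<in> M"
      proof (cases "(a, b) \<in> M")
        case True
        then show ?thesis using d(4)[OF True 4(2,3)] t by blast
      next
        case False
        then have "a = x" "b = Suc i" using 4(1) by auto
        then show ?thesis
          using 4(2,3) t ord d(4)[OF i(3), of t] by auto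
      qed
      then show ?case
        using e t by (metis Pair_inject)
    qed auto
  qed (use d(5,6) i in \<open>auto split: if_splits\<close>)
qed

section \<open>The action of the lowering operators on diagrams\<close>

lemma arcs_remove:
  assumes "finite M" "(u, x) \<in> M"
  shows "arcs z M = arcs (arc u x z) (M - {(u, x)})"
  using arcs_insert2[of "M - {(u, x)}" u x z] assms by (simp add: insert_absorb)

lemma valid_untouched: "valid n M A \<Longrightarrow> (a, b) \<in> M \<Longrightarrow> A t \<noteq> Vac \<Longrightarrow> a \<noteq> t \<and> b \<noteq> t"
  using validD(1) by blast

lemma valid_other:
  assumes "valid n M A" "(u, x) \<in> M" "(a, b) \<in> M" "(a, b) \<noteq> (u, x)"
  shows "a \<noteq> u \<and> a \<noteq> x \<and> b \<noteq> u \<and> b \<noteq> x"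
  using validD(2)[OF assms(1,2,3)] assms(4) by auto

lemma Fop_replace_none:
  assumes "valid n M A" "Fop n i (V A) = V A'"
    and "\<And>a b. (a, b) \<in> M \<Longrightarrow> a \<notin> {i, Suc i} \<and> b \<notin> {i, Suc i}"
  shows "Fop n i (arcs (V A) M) = arcs (V A') M"
  using Fop_arcs[OF valid_finite[OF assms(1)] assms(3), of n "V A"] assms(2) by simp

text \<open>Arc operators away from i and i + 1 commute with the generator, so it suffices to
  compute with the arcs in R alone. R must contain all arcs meeting these two positions, of which
  there are at most two.\<close>

lemma Fop_replace:
  assumes v: "valid n M A" and R: "R \<subseteq> M" and M0: "\<And>a b. (a, b) \<in> M - R \<Longrightarrow> a \<notin> {i, Suc i} \<and> b \<notin> {i,
      Suc i}"
    and pq: "(p, q) \<notin> M - R"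
    and loc: "Fop n i (arcs (V A) R) = arc p q (V A')"
  shows "Fop n i (arcs (V A) M) = arcs (V A') (insert (p, q) (M - R))"
proof -
  have fin: "finite M" "finite R" "finite (M - R)"
    using valid_finite[OF v] R finite_subset by auto
  have "arcs z (R \<union> N) = arcs (arcs z R) N" if "finite N" "N \<inter> R = {}" for z N
    using that
  proof (induction N rule: finite_induct)
    case (insert m N)
    obtain u x where m: "m = (u, x)" by (cases m)
    show ?case
      using insert fin arcs_insert[of "R \<union> N" u x] arcs_insert[of N u x]
      by (simp add: m)
  qed simp
  from this[of "M - R" "V A"] have "arcs (V A) M = arcs (arcs (V A) R) (M - R)"
    using R fin by (simp add: Un_absorb1 Int_commute)
  then have "Fop n i (arcs (V A) M) = arcs (arc p q (V A')) (M - R)"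
    using Fop_arcs[OF fin(3) M0] loc by simp
  then show ?thesis
    using arcs_insert2[OF fin(3) pq] by simp
qed

lemma arcs_single: "arcs z {(u, x)} = arc u x z"
  using arcs_insert[of "{}" u x z] by simp

lemma arcs_pair: "(u, x) \<noteq> (v, y) \<Longrightarrow> arcs z {(u, x), (v, y)} = arc u x (arc v y z)"
  using arcs_insert[of "{(v, y)}" u x z] by (simp add: arcs_single)

lemma Fop_replace_empty:
  assumes v: "valid n M A" and ux: "(u, x) \<in> M"
    and M0: "\<And>a b. (a, b) \<in> M - {(u, x)} \<Longrightarrow> a \<notin> {i, Suc i} \<and> b \<notin> {i, Suc i}"
    and loc: "Fop n i (arc u x (V A)) = smul c (V A')"
  shows "Fop n i (arcs (V A) M) = smul c (arcs (V A') (M - {(u, x)}))"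
proof -
  have fin: "finite M" "finite (M - {(u, x)})"
    using valid_finite[OF v] by auto
  show ?thesis
    using arcs_remove[OF fin(1) ux] Fop_arcs[OF fin(2) M0] loc
    by (simp add: linear_op_smul[OF linear_op_arcs[OF fin(2)]])
qed

text \<open>Besides the image this records what the next application does. Either the new background
  is killed, or an arc has just been created whose contraction returns to the arcs M with the factor
  q + q^-1, and only the application after that gives 0. The latter is confined to i < n in effect,
  where q + q^-1 is [2]_i!.\<close>

definition F_step_result :: "nat \<Rightarrow> nat \<Rightarrow> (nat \<times> nat) set \<Rightarrow> (nat \<Rightarrow> site) \<Rightarrow> bool" where
  "F_step_result n i M A \<longleftrightarrow>
    Fop n i (arcs (V A) M) = 0 \<or>
    (\<exists>M' A' c. valid n M' A' \<and> c \<in> {1, qv + inverse qv} \<and>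
       Fop n i (arcs (V A) M) = smul c (arcs (V A') M') \<and> killed n i A') \<or>
    (i \<noteq> n \<and> (\<exists>M' A' A''. valid n M' A' \<and> valid n M A'' \<and>
       Fop n i (arcs (V A) M) = arcs (V A') M' \<and>
       Fop n i (arcs (V A') M') = smul (qv + inverse qv) (arcs (V A'') M) \<and> killed n i A''))"

lemma F_step_resultI:
  assumes "valid n M' A'" "Fop n i (arcs (V A) M) = arcs (V A') M'" "killed n i A'"
  shows "F_step_result n i M A"
  using assms unfolding F_step_result_def by (metis insertI1 smul_1)

lemma F_step_last:
  assumes v: "valid n M A" and n: "1 \<le> n"
  shows "F_step_result n n M A"
proof (cases "A n = Plus")
  case True
  show ?thesis
  proof (rule F_step_resultI)
    show "valid n M (A(n := Minus))"
      by (rule valid_last[OF v n True])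
    show "Fop n n (arcs (V A) M) = arcs (V (A(n := Minus))) M"
    proof (rule Fop_replace_none[OF v Fop_last[of A n, OF True]])
      show "a \<notin> {n, Suc n} \<and> b \<notin> {n, Suc n}" if "(a, b) \<in> M" for a b
        using validD(1)[OF v that] True by auto
    qed
  qed (simp add: killed_def)
next
  case False
  then show ?thesis
    using Fop_arcs_killed[OF valid_finite[OF v], of n n] by (simp add: F_step_result_def killed_def)
qed

text \<open>In weight 2 the generator acts twice: the arc created at i, i + 1 is contracted again,
  which leaves M as it was and the two single letters exchanged.\<close>

lemma F_step_cup:
  assumes v: "valid n M A" and i: "1 \<le> i" "i < n" "A i = Plus" "A (Suc i) = Minus"
  shows "F_step_result n i M A"
proof -
  let ?A = "A(i := Vac, Suc i := Vac)" and ?M = "insert (i, Suc i) M"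
  have M0: "a \<notin> {i, Suc i} \<and> b \<notin> {i, Suc i}" if "(a, b) \<in> M" for a b
    using valid_untouched[OF v that, of i] valid_untouched[OF v that, of "Suc i"] i by auto
  then have nin: "(i, Suc i) \<notin> M" by blast
  have v': "valid n ?M ?A"
    by (rule valid_cup[OF v i])
  have M: "?M - {(i, Suc i)} = M"
    using nin by auto
  have 1: "Fop n i (arcs (V A) M) = arcs (V ?A) ?M"
  proof -
    have "Fop n i (arcs (V A) M) = arcs (V ?A) (insert (i, Suc i) (M - {}))"
      by (rule Fop_replace[OF v]) (use M0 nin Fop_cup[of i n A] i in auto)
    then show ?thesis by simp
  qed
  have 2: "Fop n i (arcs (V ?A) ?M) = smul (qv + inverse qv) (arcs (V (?A(i := Minus, Suc i :=
      Plus))) M)"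
  proof -
    have "Fop n i (arc i (Suc i) (V ?A)) = smul (qv + inverse qv) (V (?A(i := Minus, Suc i :=
        Plus)))"
      by (rule Fop_cap) (use i in auto)
    from Fop_replace_empty[OF v' _ _ this] show ?thesis
      unfolding M using M0 by blast
  qed
  have 3: "valid n M (?A(i := Minus, Suc i := Plus))"
    using valid_cap[OF v' i(1,2)] unfolding M by simp
  show ?thesis
    unfolding F_step_result_def using 1 2 3 v' i
    by (intro disjI2 conjI exI[of _ ?M] exI[of _ ?A] exI[of _ "?A(i := Minus, Suc i := Plus)"])
       (auto simp: killed_def)
qed

lemma F_step_shift_plus:
  assumes v: "valid n M A" and i: "1 \<le> i" "i < n" "A i = Plus" "A (Suc i) = Vac"
  shows "F_step_result n i M A"
proof -
  let ?A = "A(i := Vac, Suc i := Plus)"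
  have k: "killed n i ?A" and ne: "i \<noteq> n"
    using i by (auto simp: killed_def)
  have M0: "a \<noteq> i \<and> b \<noteq> i" if "(a, b) \<in> M" for a b
    using valid_untouched[OF v that, of i] i by auto
  consider (free) "\<And>y. (Suc i, y) \<notin> M" "\<And>y. (y, Suc i) \<notin> M"
    | (L) y where "(Suc i, y) \<in> M" | (R) x where "(x, Suc i) \<in> M" by blast
  then show ?thesis
  proof cases
    case free
    show ?thesis
    proof (rule F_step_resultI[OF valid_shift_plus_free[OF v i free] _ k])
      show "Fop n i (arcs (V A) M) = arcs (V ?A) M"
        by (rule Fop_replace_none[OF v Fop_shift_plus(1)[OF ne i(3,4)]]) (use M0 free in blast)
    qed
  next
    case L
    show ?thesis
    proof (rule F_step_resultI[OF valid_shift_plus_L(2)[OF v i(1,2) L i(3,4)] _ k])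
      show "Fop n i (arcs (V A) M) = arcs (V ?A) (insert (i, y) (M - {(Suc i, y)}))"
      proof (rule Fop_replace[OF v])
        show "Fop n i (arcs (V A) {(Suc i, y)}) = arc i y (V ?A)"
          unfolding arcs_single
          by (rule Fop_shift_plus(2)[OF ne i(3,4)]) (use validD(1)[OF v L] in auto)
      qed (use M0 L valid_other[OF v L] in auto)
    qed
  next
    case R
    show ?thesis
    proof (rule F_step_resultI[OF valid_shift_plus_R(2)[OF v i(1,2) R i(3,4)] _ k])
      show "Fop n i (arcs (V A) M) = arcs (V ?A) (insert (x, i) (M - {(x, Suc i)}))"
      proof (rule Fop_replace[OF v])
        show "Fop n i (arcs (V A) {(x, Suc i)}) = arc x i (V ?A)"
          unfolding arcs_single
          by (rule Fop_shift_plus(3)[OF ne i(3,4)]) (use validD(1)[OF v R] in auto)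
      qed (use M0 R valid_other[OF v R] in auto)
    qed
  qed
qed

lemma F_step_shift_minus:
  assumes v: "valid n M A" and i: "1 \<le> i" "i < n" "A i = Vac" "A (Suc i) = Minus"
  shows "F_step_result n i M A"
proof -
  let ?A = "A(i := Minus, Suc i := Vac)"
  have k: "killed n i ?A" and ne: "i \<noteq> n"
    using i by (auto simp: killed_def)
  have M0: "a \<noteq> Suc i \<and> b \<noteq> Suc i" if "(a, b) \<in> M" for a b
    using valid_untouched[OF v that, of "Suc i"] i by auto
  consider (free) "\<And>y. (i, y) \<notin> M" "\<And>y. (y, i) \<notin> M"
    | (L) y where "(i, y) \<in> M" | (R) x where "(x, i) \<in> M" by blast
  then show ?thesis
  proof cases
    case free
    show ?thesis
    proof (rule F_step_resultI[OF valid_shift_minus_free[OF v i free] _ k])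
      show "Fop n i (arcs (V A) M) = arcs (V ?A) M"
        by (rule Fop_replace_none[OF v Fop_shift_minus(1)[OF ne i(3,4)]]) (use M0 free in blast)
    qed
  next
    case L
    show ?thesis
    proof (rule F_step_resultI[OF valid_shift_minus_L(2)[OF v i(1,2) L i(3,4)] _ k])
      show "Fop n i (arcs (V A) M) = arcs (V ?A) (insert (Suc i, y) (M - {(i, y)}))"
      proof (rule Fop_replace[OF v])
        show "Fop n i (arcs (V A) {(i, y)}) = arc (Suc i) y (V ?A)"
          unfolding arcs_single
          by (rule Fop_shift_minus(2)[OF ne i(3,4)]) (use validD(1)[OF v L] in auto)
      qed (use M0 L valid_other[OF v L] in auto)
    qed
  next
    case R
    show ?thesis
    proof (rule F_step_resultI[OF valid_shift_minus_R(2)[OF v i(1,2) R i(3,4)] _ k])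
      show "Fop n i (arcs (V A) M) = arcs (V ?A) (insert (x, Suc i) (M - {(x, i)}))"
      proof (rule Fop_replace[OF v])
        show "Fop n i (arcs (V A) {(x, i)}) = arc x (Suc i) (V ?A)"
          unfolding arcs_single
          by (rule Fop_shift_minus(3)[OF ne i(3,4)]) (use validD(1)[OF v R] in auto)
      qed (use M0 R valid_other[OF v R] in auto)
    qed
  qed
qed

text \<open>The outer end of the removed arc becomes an unmatched empty position, so no arc may pass
  over it. An arc over the whole removed arc would also pass over the unmatched neighbour at i or i
  + 1, and an arc over only one of its ends would cross it.\<close>

lemma valid_remove:
  assumes v: "valid n M A" and i: "1 \<le> i" "i < n"
    and ux: "(u, x) \<in> M" "A i = Vac" "A (Suc i) = Vac"
    and cases: "u = Suc i \<and> (\<forall>y. (i, y) \<notin> M \<and> (y, i) \<notin> M) \<or>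
      x = i \<and> (\<forall>y. (Suc i, y) \<notin> M \<and> (y, Suc i) \<notin> M)"
  shows "valid n (M - {(u, x)}) (A(i := Minus, Suc i := Plus))"
proof -
  note d = validD[OF v]
  have ux': "u < x" using d(1)[OF ux(1)] by simp
  have M0: "a \<notin> {i, Suc i} \<and> b \<notin> {i, Suc i}" if "(a, b) \<in> M" "(a, b) \<noteq> (u, x)" for a b
    using valid_other[OF v ux(1) that] cases that by auto
  have under: "\<not> (a < u \<and> u < b)" "\<not> (a < x \<and> x < b)" if m: "(a, b) \<in> M" for a b
  proof -
    have ni: "\<not> (a < i \<and> i < b)" if "\<forall>y. (i, y) \<notin> M \<and> (y, i) \<notin> M"
      using d(4)[OF m, of i] that ux(2) by auto
    have nsi: "\<not> (a < Suc i \<and> Suc i < b)" if "\<forall>y. (Suc i, y) \<notin> M \<and> (y, Suc i) \<notin> M"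
      using d(4)[OF m, of "Suc i"] that ux(3) by auto
    show 1: "\<not> (a < u \<and> u < b)"
      using cases
    proof
      assume c: "u = Suc i \<and> (\<forall>y. (i, y) \<notin> M \<and> (y, i) \<notin> M)"
      then have "a \<noteq> i" using m by blast
      then show ?thesis using ni c by auto
    next
      assume c: "x = i \<and> (\<forall>y. (Suc i, y) \<notin> M \<and> (y, Suc i) \<notin> M)"
      then have "b \<noteq> Suc i" using m by blast
      then show ?thesis using nsi c d(3)[OF m ux(1)] ux' by auto
    qed
    show "\<not> (a < x \<and> x < b)"
    proof
      assume x: "a < x \<and> x < b"
      then have "(a, b) \<noteq> (u, x)" by auto
      from valid_other[OF v ux(1) m this] have "a \<noteq> u" by simp
      then have "u < a" using 1 x ux' by auto
      then show False using d(3)[OF ux(1) m] x by simp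
    qed
  qed
  show ?thesis
  proof (rule validI, goal_cases)
    case (1 a b)
    then have m: "(a, b) \<in> M" "(a, b) \<noteq> (u, x)" by auto
    show ?case using d(1)[OF m(1)] M0[OF m] by auto
  next
    case (2 a b c e)
    then show ?case by (intro d(2)) auto
  next
    case (3 a b c e)
    then show ?case by (intro d(3)[of a b c e]) auto
  next
    case (4 a b t)
    then have t: "A t = Vac" "(a, b) \<in> M"
      by (auto split: if_splits)
    have "t \<noteq> u" "t \<noteq> x" using under[OF t(2)] 4(2,3) by auto
    then show ?case using d(4)[OF t(2) 4(2,3) t(1)] by auto
  qed (use d(5,6) i in \<open>auto split: if_splits\<close>)
qed

lemma F_step_vac:
  assumes v: "valid n M A" and i: "1 \<le> i" "i < n" "A i = Vac" "A (Suc i) = Vac"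
  shows "F_step_result n i M A"
proof -
  let ?A = "A(i := Minus, Suc i := Plus)"
  note d = validD[OF v]
  have k: "killed n i ?A" and ne: "i \<noteq> n"
    using i by (auto simp: killed_def)
  \<comment> \<open>The two letters of a label describe i and i + 1: F for unmatched, L for a left
    end, R for a right end. FR and LF would leave an unmatched empty position below an arc, and LR
    would be a crossing.\<close>
  consider (cap) "(i, Suc i) \<in> M"
    | (FF) "\<forall>y. (i, y) \<notin> M \<and> (y, i) \<notin> M" "\<forall>y. (Suc i, y) \<notin> M \<and> (y, Suc i) \<notin> M"
    | (FL) y where "\<forall>y. (i, y) \<notin> M \<and> (y, i) \<notin> M" "(Suc i, y) \<in> M"
    | (FR) y where "\<forall>y. (i, y) \<notin> M \<and> (y, i) \<notin> M" "(y, Suc i) \<in> M"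
    | (LF) x where "(i, x) \<in> M" "x \<noteq> Suc i" "\<forall>y. (Suc i, y) \<notin> M \<and> (y, Suc i) \<notin> M"
    | (RF) x where "(x, i) \<in> M" "\<forall>y. (Suc i, y) \<notin> M \<and> (y, Suc i) \<notin> M"
    | (LL) x y where "(i, x) \<in> M" "(Suc i, y) \<in> M"
    | (LR) x y where "(i, x) \<in> M" "x \<noteq> Suc i" "(y, Suc i) \<in> M"
    | (RL) x y where "(x, i) \<in> M" "(Suc i, y) \<in> M"
    | (RR) x y where "(x, i) \<in> M" "(y, Suc i) \<in> M"
    by metis
  then show ?thesis
  proof cases
    case cap
    have "Fop n i (arcs (V A) M) = smul (qv + inverse qv) (arcs (V ?A) (M - {(i, Suc i)}))"
      by (rule Fop_replace_empty[OF v cap _ Fop_cap[OF ne i(3,4)]])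
         (use valid_other[OF v cap] in auto)
    then show ?thesis
      unfolding F_step_result_def using valid_cap[OF v i(1,2) cap] k by blast
  next
    case FF
    have "Fop n i (V A) = 0"
      using ne i by (simp add: Fop_V loc_def ftab_def)
    then have "Fop n i (arcs (V A) M) = arcs 0 M"
      using Fop_arcs[OF valid_finite[OF v], of i n "V A"] FF by auto
    then show ?thesis
      using linear_op_0[OF linear_op_arcs[OF valid_finite[OF v]]] by (simp add: F_step_result_def)
  next
    case FL
    have "Fop n i (arc (Suc i) y (V A)) = smul 1 (V ?A)"
      unfolding smul_1
      \<comment> \<open>\<open>Fop_join\<close> speaks of two outer positions. The empty position 0
        stands in for the one that is absent here, and n + 1 does so in the case RF.\<close>
      by (rule Fop_join(4)[OF ne i(3,4), of 0 y]) (use d(1)[OF FL(2)] d(6)[of 0] i in auto)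
    from Fop_replace_empty[OF v FL(2) _ this]
    have "Fop n i (arcs (V A) M) = arcs (V ?A) (M - {(Suc i, y)})"
      using valid_other[OF v FL(2)] FL(1) by auto
    then show ?thesis
      by (intro F_step_resultI[OF _ _ k]) (use valid_remove[OF v i(1,2) FL(2) i(3,4)] FL(1) in auto)
  next
    case FR
    have "y \<noteq> i" using FR by blast
    then have "y < i" using d(1)[OF FR(2)] by simp
    then show ?thesis using d(4)[OF FR(2), of i] FR(1) i by auto
  next
    case LF
    then have "Suc i < x" using d(1)[OF LF(1)] by simp
    then show ?thesis using d(4)[OF LF(1), of "Suc i"] LF(3) i by auto
  next
    case RF
    have "Fop n i (arc x i (V A)) = smul 1 (V ?A)"
      unfolding smul_1
      by (rule Fop_join(5)[OF ne i(3,4), of x "Suc n"]) (use d(1)[OF RF(1)] d(6)[of "Suc n"] i in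
          auto)
    from Fop_replace_empty[OF v RF(1) _ this]
    have "Fop n i (arcs (V A) M) = arcs (V ?A) (M - {(x, i)})"
      using valid_other[OF v RF(1)] RF(2) by auto
    then show ?thesis
      by (intro F_step_resultI[OF _ _ k]) (use valid_remove[OF v i(1,2) RF(1) i(3,4)] RF(2) in auto)
  next
    case LL
    note o = valid_join_LL[OF v i(1,2) LL]
    show ?thesis
    proof (rule F_step_resultI[OF o(3) _ k], rule Fop_replace[OF v])
      show "Fop n i (arcs (V A) {(i, x), (Suc i, y)}) = arc y x (V ?A)"
        using Fop_join(1)[OF ne i(3,4), of x y] d(1)[OF LL(1)] d(1)[OF LL(2)] o by (simp add:
            arcs_pair)
      show "(y, x) \<notin> M - {(i, x), (Suc i, y)}"
        using valid_ends[OF v LL(2)] o by auto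
    qed (use LL valid_other[OF v LL(1)] valid_other[OF v LL(2)] in auto)
  next
    case LR
    then have "y < i" "Suc i < x" using d(1)[OF LR(1)] d(1)[OF LR(3)] valid_ends(1)[OF v LR(1), of
        "Suc i"] by (auto simp: less_Suc_eq)
    then show ?thesis using d(3)[OF LR(3) LR(1)] by simp
  next
    case RL
    note o = valid_join_RL[OF v i(1,2) RL]
    show ?thesis
    proof (rule F_step_resultI[OF o(3) _ k], rule Fop_replace[OF v])
      show "Fop n i (arcs (V A) {(x, i), (Suc i, y)}) = arc x y (V ?A)"
        using Fop_join(3)[OF ne i(3,4), of x y] d(1)[OF RL(1)] d(1)[OF RL(2)] o by (simp add:
            arcs_pair)
      show "(x, y) \<notin> M - {(x, i), (Suc i, y)}"
        using valid_ends[OF v RL(1)] o by auto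
    qed (use RL valid_other[OF v RL(1)] valid_other[OF v RL(2)] in auto)
  next
    case RR
    note o = valid_join_RR[OF v i(1,2) RR]
    show ?thesis
    proof (rule F_step_resultI[OF o(3) _ k], rule Fop_replace[OF v])
      show "Fop n i (arcs (V A) {(x, i), (y, Suc i)}) = arc y x (V ?A)"
        using Fop_join(2)[OF ne i(3,4), of x y] d(1)[OF RR(1)] d(1)[OF RR(2)] o by (simp add:
            arcs_pair)
      show "(y, x) \<notin> M - {(x, i), (y, Suc i)}"
        using valid_ends[OF v RR(1)] o by auto
    qed (use RR valid_other[OF v RR(1)] valid_other[OF v RR(2)] in auto)
  qed
qed

lemma F_step:
  assumes v: "valid n M A" and i: "i \<in> {1..n}"
  shows "F_step_result n i M A"
proof (cases "i = n")
  case True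
  then show ?thesis using F_step_last[OF v] i by simp
next
  case False
  then have i': "1 \<le> i" "i < n" using i by auto
  show ?thesis
  proof (cases "killed n i A")
    case True
    then show ?thesis
      using Fop_arcs_killed[OF valid_finite[OF v]] by (simp add: F_step_result_def)
  next
    case nk: False
    \<comment> \<open>A background has no doubled positions, so excluding the killed patterns leaves
      four cases, with one lemma for each.\<close>
    have "A i = Plus \<or> A i = Vac" "A (Suc i) = Minus \<or> A (Suc i) = Vac"
      using nk False validD(5)[OF v, of i] validD(5)[OF v, of "Suc i"] unfolding killed_def
      by (metis site.exhaust)+
    then show ?thesis
      using F_step_cup[OF v i'] F_step_shift_plus[OF v i'] F_step_shift_minus[OF v i']
          F_step_vac[OF v i']
      by blast
  qed
qed

text \<open>For k at least 3 the power vanishes, and for k = 2 it survives only after the creation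
  of an arc, where q + q^-1 cancels against [2]!. The factor q + q^-1 remains only for k = 1, when
  an existing arc is contracted.\<close>

lemma divpow_step:
  assumes v: "valid n M A" and i: "i \<in> {1..n}"
  shows "\<exists>c M' A'. valid n M' A' \<and> c \<in> {0, 1, qv + inverse qv} \<and>
    free_act n (divpow n i (gelt (GenF i)) k) (arcs (V A) M) = smul c (arcs (V A') M')"
proof -
  let ?F = "Fop n i" and ?w = "arcs (V A) M"
  have F: "free_act n (divpow n i (gelt (GenF i)) k) ?w = smul (inverse (qfact n i k)) ((?F ^^ k)
      ?w)"
  proof -
    have "free_act n (gelt (GenF i)) = ?F" by (rule ext) simp
    then show ?thesis by (simp add: divpow_def free_act_mult free_act_power)
  qed
  have F0: "(?F ^^ m) 0 = 0" for m
    by (induction m) (auto simp: gen_act_linear)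
  have z: ?thesis if "(?F ^^ k) ?w = 0"
    using that v F by (intro exI[of _ 0] exI[of _ M] exI[of _ A]) simp
  consider "k = 0" | "k = 1" | m where "k = Suc (Suc m)"
    by (metis One_nat_def not0_implies_Suc)
  then show ?thesis
  proof cases
    case 1
    then show ?thesis using v F by (intro exI[of _ 1] exI[of _ M] exI[of _ A]) simp
  next
    case 2
    then have F1: "free_act n (divpow n i (gelt (GenF i)) k) ?w = ?F ?w"
      using F by simp
    show ?thesis
      using F_step[OF v i] unfolding F_step_result_def F1
      by (metis insertCI smul_0_left smul_1 v)
  next
    case 3
    have FF: "(?F ^^ k) ?w = (?F ^^ m) (?F (?F ?w))"
      by (simp only: 3 funpow_Suc_right o_apply)
    show ?thesis
      using F_step[OF v i] unfolding F_step_result_def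
    proof (elim disjE)
      assume "?F ?w = 0"
      then show ?thesis by (intro z) (simp add: FF gen_act_linear F0)
    next
      assume "\<exists>M' A' c. valid n M' A' \<and> c \<in> {1, qv + inverse qv} \<and>
       Fop n i (arcs (V A) M) = smul c (arcs (V A') M') \<and> killed n i A'"
      then obtain M' A' c where "valid n M' A'" "?F ?w = smul c (arcs (V A') M')" "killed n i A'"
        by blast
      then have "?F (?F ?w) = 0"
        by (simp add: gen_act_linear Fop_arcs_killed[OF valid_finite])
      then show ?thesis by (intro z) (simp add: FF F0)
    next
      assume "i \<noteq> n \<and> (\<exists>M' A' A''. valid n M' A' \<and> valid n M A'' \<and>
       Fop n i (arcs (V A) M) = arcs (V A') M' \<and>
       Fop n i (arcs (V A') M') = smul (qv + inverse qv) (arcs (V A'') M) \<and> killed n i A'')"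
      then obtain A'' where *: "i \<noteq> n" "valid n M A''" "killed n i A''"
        "?F (?F ?w) = smul (qv + inverse qv) (arcs (V A'') M)" by auto
      show ?thesis
      proof (cases m)
        case 0
        have "inverse (qfact n i k) * (qv + inverse qv) = 1"
          using *(1) left_inverse[OF qv_add_inverse_nonzero]
          by (simp add: 3 0 qfact_2[unfolded numeral_2_eq_2] qi_def)
        then have "free_act n (divpow n i (gelt (GenF i)) k) ?w = smul 1 (arcs (V A'') M)"
          unfolding F FF *(4) 0 by (simp only: funpow_0 smul_smul)
        then show ?thesis using *(2) by blast
      next
        case (Suc m')
        have "?F (arcs (V A'') M) = 0"
          using *(3) by (rule Fop_arcs_killed[OF valid_finite[OF v]])
        then show ?thesis
          by (intro z) (simp add: FF *(4) Suc funpow_Suc_right F0 gen_act_linear del: funpow.simps)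
      qed
    qed
  qed
qed

section \<open>Leading columns\<close>

text \<open>X is the set of arcs on which the second term of the expanded product is taken, so that
  the pair sits at the left end and a factor q is collected.\<close>

definition flip :: "(nat \<times> nat) set \<Rightarrow> (nat \<Rightarrow> site) \<Rightarrow> (nat \<times> nat) set \<Rightarrow> nat \<Rightarrow> site" where
  "flip M A X t = (if t \<in> snd ` (M - X) \<union> fst ` X then Dbl else A t)"

lemma arcs_expand:
  assumes "finite M"
    and "\<And>u x. (u, x) \<in> M \<Longrightarrow> u \<noteq> x \<and> A u = Vac \<and> A x = Vac"
    and "\<And>u x v y. (u, x) \<in> M \<Longrightarrow> (v, y) \<in> M \<Longrightarrow> u = v \<or> u = y \<or> x = v \<or> x = y \<Longrightarrow> u = v \<and> x = y"
  shows "arcs (V A) M = (\<Sum>X\<in>Pow M. smul (qv ^ card X) (V (flip M A X)))"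
  using assms
proof (induction M rule: finite_induct)
  case empty
  have "flip {} A {} = A" by (rule ext) (simp add: flip_def)
  then show ?case by simp
next
  case (insert m M)
  obtain u x where m: "m = (u, x)" by (cases m)
  have ux: "u \<noteq> x" "A u = Vac" "A x = Vac"
    using insert.prems(1)[of u x] m by auto
  have apart: "a \<noteq> u \<and> a \<noteq> x \<and> b \<noteq> u \<and> b \<noteq> x" if "(a, b) \<in> M" for a b
    using insert.prems(2)[of u x a b] insert.hyps(2) that unfolding m by auto
  have IH: "arcs (V A) M = (\<Sum>X\<in>Pow M. smul (qv ^ card X) (V (flip M A X)))"
    by (rule insert.IH) (use insert.prems in blast)+
  have step: "arc u x (V (flip M A X)) = V (flip (insert m M) A X) + smul qv (V (flip (insert m M)
      A (insert m X)))"
    if X: "X \<subseteq> M" for X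
  proof -
    \<comment> \<open>Arcs have disjoint ends, so pairs on the ends of the other arcs leave u and x
      empty.\<close>
    have vac: "flip M A X u = Vac" "flip M A X x = Vac"
      using apart X ux unfolding flip_def by (auto simp: image_iff) blast+
    have mX: "m \<notin> X" using X insert.hyps(2) by blast
    have "insert m M - X = insert m (M - X)" "insert m M - insert m X = M - X"
      using mX insert.hyps(2) by auto
    then have "(flip M A X)(x := Dbl) = flip (insert m M) A X"
      "(flip M A X)(u := Dbl) = flip (insert m M) A (insert m X)"
      by (auto simp: fun_eq_iff flip_def m)
    then show ?thesis
      using arc_V[OF vac] by simp
  qed
  have mX: "m \<notin> X" if "X \<in> Pow M" for X
    using that insert.hyps(2) by blast
  have "arcs (V A) (insert m M) = (\<Sum>X\<in>Pow M. smul (qv ^ card X) (arc u x (V (flip M A X))))"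
    using arcs_insert[of M u x] insert.hyps
    by (simp add: m IH linear_op_sum[OF linear_op_arc] linear_op_smul[OF linear_op_arc])
  also have "\<dots> = (\<Sum>X\<in>Pow M. smul (qv ^ card X) (V (flip (insert m M) A X))) +
     (\<Sum>X\<in>Pow M. smul (qv ^ card (insert m X)) (V (flip (insert m M) A (insert m X))))"
  proof -
    have "card (insert m X) = Suc (card X)" if "X \<in> Pow M" for X
      using mX[OF that] that finite_subset[of X M] insert.hyps(1) by simp
    then have "smul (qv ^ card X) (arc u x (V (flip M A X))) = smul (qv ^ card X) (V (flip (insert
        m M) A X)) +
        smul (qv ^ card (insert m X)) (V (flip (insert m M) A (insert m X)))" if "X \<in> Pow M" for X
      using that by (simp add: step smul_add_right mult.commute)
    then show ?thesis
      by (simp add: sum.distrib)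
  qed
  also have "(\<Sum>X\<in>Pow M. smul (qv ^ card (insert m X)) (V (flip (insert m M) A (insert m X))))
     = (\<Sum>X\<in>insert m ` Pow M. smul (qv ^ card X) (V (flip (insert m M) A X)))"
  proof (subst sum.reindex)
    show "inj_on (insert m) (Pow M)"
      using insert.hyps(2) by (auto simp: inj_on_def)
  qed simp
  also have "(\<Sum>X\<in>Pow M. smul (qv ^ card X) (V (flip (insert m M) A X))) +
      (\<Sum>X\<in>insert m ` Pow M. smul (qv ^ card X) (V (flip (insert m M) A X)))
     = (\<Sum>X\<in>Pow (insert m M). smul (qv ^ card X) (V (flip (insert m M) A X)))"
    unfolding Pow_insert
    by (rule sum.union_disjoint[symmetric]) (use insert.hyps in auto)
  finally show ?case .
qed

lemma valid_arcs_expand: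
  assumes "valid n M A"
  shows "arcs (V A) M = (\<Sum>X\<in>Pow M. smul (qv ^ card X) (V (flip M A X)))"
proof (rule arcs_expand[OF valid_finite[OF assms]])
  show "u \<noteq> x \<and> A u = Vac \<and> A x = Vac" if "(u, x) \<in> M" for u x
    using validD(1)[OF assms that] by auto
qed (rule validD(2)[OF assms])

abbreviation lead :: "(nat \<times> nat) set \<Rightarrow> (nat \<Rightarrow> site) \<Rightarrow> nat \<Rightarrow> site" where
  "lead M A \<equiv> flip M A {}"

lemma pairs_col: "pairs (col \<sigma>) = {t. \<sigma> t = Dbl}"
  by (auto simp: pairs_def)

lemma valid_flip_Dbl:
  assumes "valid n M A"
  shows "{t. flip M A X t = Dbl} = snd ` (M - X) \<union> fst ` X"
  using validD(5)[OF assms] by (auto simp: flip_def)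

lemma pairs_lead: "valid n M A \<Longrightarrow> pairs (col (lead M A)) = snd ` M"
  using valid_flip_Dbl[of n M A "{}"] by (simp add: pairs_col)

text \<open>The empty positions between u and x are left ends of arcs nested inside (u, x). Their
  right ends lie below x, so by induction the recursion has already spent them, and the largest
  candidate left is u.\<close>

lemma u_of_lead:
  assumes v: "valid n M A"
  shows "(u, x) \<in> M \<Longrightarrow> u_of (col (lead M A)) x = u"
proof (induction x arbitrary: u rule: less_induct)
  case (less x)
  let ?C = "col (lead M A)"
  let ?S = "free_below ?C x - (\<Union>y\<in>{y \<in> pairs ?C. y < x}. {u_of ?C y})"
  have fb: "t \<in> free_below ?C x \<longleftrightarrow> 1 \<le> t \<and> t < x \<and> A t = Vac \<and> t \<notin> snd ` M" for t
    using validD(5)[OF v, of t] by (cases "A t") (auto simp: free_below_def flip_def)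
  have used: "u_of ?C y = a" if "(a, y) \<in> M" "y < x" for a y
    using less.IH[OF that(2,1)] .
  have "Max ?S = u"
  proof (rule Max_eqI)
    show "finite ?S"
      by (rule finite_subset[of _ "{..<x}"]) (auto simp: free_below_def)
    show "u \<in> ?S"
    proof
      have "u \<notin> snd ` M"
        using valid_ends(3)[OF v less.prems] by auto
      then show "u \<in> free_below ?C x"
        using fb validD(1)[OF v less.prems] by auto
      show "u \<notin> (\<Union>y\<in>{y \<in> pairs ?C. y < x}. {u_of ?C y})"
      proof
        assume "u \<in> (\<Union>y\<in>{y \<in> pairs ?C. y < x}. {u_of ?C y})"
        then obtain y where y: "y \<in> pairs ?C" "y < x" "u = u_of ?C y" by blast
        then obtain a where "(a, y) \<in> M"
          using pairs_lead[OF v] by auto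
        then have "(u, y) \<in> M" using used y by auto
        then show False using valid_ends(1)[OF v less.prems] y(2) by auto
      qed
    qed
    show "t \<le> u" if t: "t \<in> ?S" for t
    proof (rule ccontr)
      assume "\<not> t \<le> u"
      then have ut: "u < t" by simp
      have t': "t < x" "A t = Vac" "t \<notin> snd ` M"
        using t fb by blast+
      then obtain y where y: "(t, y) \<in> M"
        using validD(4)[OF v less.prems ut t'(1,2)] by force
      then have "y < x"
        using validD(3)[OF v less.prems y ut t'(1)] by simp
      moreover have "y \<in> pairs ?C"
        using y pairs_lead[OF v] by force
      ultimately show False
        using t used[OF y] by blast
    qed
  qed
  then show ?case
    by (subst u_of.simps)
qed

text \<open>The doubled positions are the right ends and \<open>u_of\<close> gives the left ends, so
  the arcs can be read off. The background is what remains when the doubled positions are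
  emptied.\<close>

lemma lead_inj:
  assumes "valid n M A" "valid n' M' A'" "lead M A = lead M' A'"
  shows "M = M' \<and> A = A'"
proof -
  have M: "M = {(u_of (col (lead M A)) x, x) | x. x \<in> pairs (col (lead M A))}" if "valid n M A"
      for n M A
    unfolding pairs_lead[OF that] using u_of_lead[OF that] by force
  have "M = M'"
    using M[OF assms(1)] M[OF assms(2)] assms(3) by simp
  have A: "A t = (if lead M A t = Dbl then Vac else lead M A t)" if "valid n M A" for n M A t
    using validD(1)[OF that] validD(5)[OF that, of t] by (force simp: flip_def)
  have "A = A'"
    using A[OF assms(1)] A[OF assms(2)] assms(3) by (simp add: fun_eq_iff)
  then show ?thesis using \<open>M = M'\<close> by simp
qed

section \<open>Unitriangularity of diagram vectors at leading columns\<close>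

definition height :: "(nat \<Rightarrow> site) \<Rightarrow> nat" where
  "height \<tau> = \<Sum> {t. \<tau> t = Dbl}"

lemma height_flip:
  assumes v: "valid n M A" and X: "X \<subseteq> M"
  shows "height (flip M A X) = (\<Sum>m\<in>M. if m \<in> X then fst m else snd m)"
proof -
  let ?h = "\<lambda>m. if m \<in> X then fst m else snd m"
  \<comment> \<open>Distinct arcs have disjoint ends, so no position is doubled by two arcs.\<close>
  have "inj_on ?h M"
  proof (rule inj_onI)
    fix m m' assume m: "m \<in> M" "m' \<in> M" "?h m = ?h m'"
    then have "fst m = fst m' \<or> fst m = snd m' \<or> snd m = fst m' \<or> snd m = snd m'"
      by (auto split: if_splits)
    from validD(2)[OF v _ _ this] show "m = m'"
      using m(1,2) by (simp add: prod_eq_iff)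
  qed
  moreover have "?h ` M = snd ` (M - X) \<union> fst ` X"
    using X by force
  ultimately show ?thesis
    unfolding height_def valid_flip_Dbl[OF v] by (metis (no_types, lifting) sum.reindex_cong)
qed

text \<open>Each arc in X moves its pair from the right end to the smaller left end.\<close>

lemma height_flip_less:
  assumes v: "valid n M A" and X: "X \<subseteq> M" "X \<noteq> {}"
  shows "height (flip M A X) < height (lead M A)"
  unfolding height_flip[OF v X(1)] height_flip[OF v empty_subsetI]
proof (rule sum_strict_mono_ex1[OF valid_finite[OF v]])
  have lt: "fst m < snd m" if "m \<in> M" for m
    using validD(1)[OF v, of "fst m" "snd m"] that by simp
  then show "\<forall>m\<in>M. (if m \<in> X then fst m else snd m) \<le> (if m \<in> {} then fst m else snd m)"
    by (simp add: less_imp_le)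
  show "\<exists>m\<in>M. (if m \<in> X then fst m else snd m) < (if m \<in> {} then fst m else snd m)"
    using lt X by auto
qed

definition diagrams :: "nat \<Rightarrow> ((nat \<times> nat) set \<times> (nat \<Rightarrow> site)) set" where
  "diagrams n = {(M, A). valid n M A}"

abbreviation psi :: "(nat \<times> nat) set \<times> (nat \<Rightarrow> site) \<Rightarrow> wvec" where
  "psi d \<equiv> arcs (V (snd d)) (fst d)"

abbreviation leadc :: "(nat \<times> nat) set \<times> (nat \<Rightarrow> site) \<Rightarrow> (nat \<Rightarrow> site)" where
  "leadc d \<equiv> lead (fst d) (snd d)"

lemma in_diagrams: "d \<in> diagrams n \<longleftrightarrow> valid n (fst d) (snd d)"
  by (cases d) (simp add: diagrams_def)

lemma finite_diagrams: "finite (diagrams n)"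
proof -
  have "finite {A :: nat \<Rightarrow> site. \<forall>t. (t \<in> {1..n} \<longrightarrow> A t \<in> {Vac, Plus, Minus, Dbl}) \<and> (t \<notin> {1..n} \<longrightarrow>
      A t = Vac)}"
    by (rule finite_set_of_finite_funs) auto
  moreover have "diagrams n \<subseteq> Pow ({1..n} \<times> {1..n}) \<times>
      {A. \<forall>t. (t \<in> {1..n} \<longrightarrow> A t \<in> {Vac, Plus, Minus, Dbl}) \<and> (t \<notin> {1..n} \<longrightarrow> A t = Vac)}"
  proof
    fix d assume "d \<in> diagrams n"
    then have v: "valid n (fst d) (snd d)" by (simp add: in_diagrams)
    have "fst d \<subseteq> {1..n} \<times> {1..n}"
    proof
      fix m assume "m \<in> fst d"
      then show "m \<in> {1..n} \<times> {1..n}"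
        using validD(1)[OF v, of "fst m" "snd m"] by (cases m) auto
    qed
    moreover have "s \<in> {Vac, Plus, Minus, Dbl}" for s
      by (cases s) auto
    ultimately show "d \<in> Pow ({1..n} \<times> {1..n}) \<times>
      {A. \<forall>t. (t \<in> {1..n} \<longrightarrow> A t \<in> {Vac, Plus, Minus, Dbl}) \<and> (t \<notin> {1..n} \<longrightarrow> A t = Vac)}"
      using validD(6)[OF v] by (cases d) auto
  qed
  ultimately show ?thesis
    by (meson finite_Pow_iff finite_SigmaI finite_atLeastAtMost finite_subset)
qed

lemma lookup_psi:
  assumes "d \<in> diagrams n"
  shows "Poly_Mapping.lookup (psi d) (col \<tau>) =
    (\<Sum>X\<in>Pow (fst d). if flip (fst d) (snd d) X = \<tau> then qv ^ card X else 0)"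
  using valid_arcs_expand[of n "fst d" "snd d"] assms
  by (simp add: in_diagrams lookup_sum lookup_V if_distrib cong: if_cong)

lemma lookup_psi_lead:
  assumes "d \<in> diagrams n"
  shows "Poly_Mapping.lookup (psi d) (col (leadc d)) = 1"
proof -
  have v: "valid n (fst d) (snd d)" using assms by (simp add: in_diagrams)
  have "(\<Sum>X\<in>Pow (fst d). if flip (fst d) (snd d) X = leadc d then qv ^ card X else 0)
    = (\<Sum>X\<in>{{}}. if flip (fst d) (snd d) X = leadc d then qv ^ card X else 0)"
  proof (rule sum.mono_neutral_right)
    show "\<forall>X\<in>Pow (fst d) - {{}}. (if flip (fst d) (snd d) X = leadc d then qv ^ card X else 0) = 0"
      using height_flip_less[OF v] by (metis DiffE PowD less_irrefl singletonI)
  qed (use valid_finite[OF v] in auto)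
  then show ?thesis
    by (simp add: lookup_psi[OF assms])
qed

text \<open>Leading columns are distinct, so a term of \<open>psi d\<close> that lands on the
  leading column of \<open>d'\<close> has X nonempty. It then carries a factor q, and its height is
  strictly below that of the leading column of \<open>d\<close>.\<close>

lemma lookup_psi_other:
  assumes d: "d \<in> diagrams n" "d' \<in> diagrams n" "d \<noteq> d'"
  shows "height (leadc d) \<le> height (leadc d') \<Longrightarrow> Poly_Mapping.lookup (psi d) (col (leadc d')) = 0"
    and "\<exists>r\<in>regular_at_0. Poly_Mapping.lookup (psi d) (col (leadc d')) = qv * r"
proof -
  have v: "valid n (fst d) (snd d)" "valid n (fst d') (snd d')" using d by (auto simp: in_diagrams)
  have ne: "flip (fst d) (snd d) {} \<noteq> leadc d'"
    using lead_inj[OF v] d(3) by (auto simp: prod_eq_iff)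
  show "Poly_Mapping.lookup (psi d) (col (leadc d')) = 0" if "height (leadc d) \<le> height (leadc d')"
    unfolding lookup_psi[OF d(1)]
  proof (rule sum.neutral, rule ballI)
    fix X assume "X \<in> Pow (fst d)"
    then show "(if flip (fst d) (snd d) X = leadc d' then qv ^ card X else 0) = 0"
      using ne height_flip_less[OF v(1), of X] that by (cases "X = {}") auto
  qed
  have "\<exists>r\<in>regular_at_0. (if flip (fst d) (snd d) X = leadc d' then qv ^ card X else 0) = qv * r"
    if X: "X \<in> Pow (fst d)" for X
  proof (cases "flip (fst d) (snd d) X = leadc d'")
    case True
    then have "X \<noteq> {}" using ne by auto
    moreover have "finite X" using X valid_finite[OF v(1)] finite_subset by auto
    ultimately obtain k where "card X = Suc k"
      by (metis card_eq_0_iff not0_implies_Suc)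
    moreover have "qv ^ k \<in> regular_at_0"
      by (induction k) (auto intro: regular_at_0_mult)
    ultimately show ?thesis using True by auto
  qed (auto intro!: bexI[of _ 0])
  then obtain r where r: "\<And>X. X \<in> Pow (fst d) \<Longrightarrow> r X \<in> regular_at_0 \<and>
      (if flip (fst d) (snd d) X = leadc d' then qv ^ card X else 0) = qv * r X"
    by metis
  have "Poly_Mapping.lookup (psi d) (col (leadc d')) = qv * (\<Sum>X\<in>Pow (fst d). r X)"
    unfolding lookup_psi[OF d(1)] sum_distrib_left by (rule sum.cong) (use r in auto)
  moreover have "(\<Sum>X\<in>S. r X) \<in> regular_at_0" if "S \<subseteq> Pow (fst d)" for S
    using that by (induction S rule: infinite_finite_induct) (auto intro: regular_at_0_add simp: r)
  ultimately show "\<exists>r\<in>regular_at_0. Poly_Mapping.lookup (psi d) (col (leadc d')) = qv * r"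
    by blast
qed

text \<open>The diagrams on n positions are finite in number and stable under the lowering operators
  up to scalars, so one index set serves for every column height p.\<close>

definition lin :: "nat \<Rightarrow> ((nat \<times> nat) set \<times> (nat \<Rightarrow> site) \<Rightarrow> cq) \<Rightarrow> wvec" where
  "lin n a = (\<Sum>d\<in>diagrams n. smul (a d) (psi d))"

lemma lookup_lin: "Poly_Mapping.lookup (lin n a) D = (\<Sum>d\<in>diagrams n. a d * Poly_Mapping.lookup
    (psi d) D)"
  by (simp add: lin_def lookup_sum)

text \<open>The lookups at the leading columns form a unitriangular system with respect to the height.\<close>

lemma coefficients_of_lin:
  assumes K0: "0 \<in> K" and Kadd: "\<And>x y. x \<in> K \<Longrightarrow> y \<in> K \<Longrightarrow> x + y \<in> K"
    and Kneg: "\<And>x. x \<in> K \<Longrightarrow> - x \<in> K" and Kq: "\<And>x. x \<in> K \<Longrightarrow> qv * x \<in> K"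
    and look: "\<And>D. Poly_Mapping.lookup (lin n a) D \<in> K"
  shows "d \<in> diagrams n \<Longrightarrow> a d \<in> K"
proof (rule ccontr)
  assume d: "d \<in> diagrams n" "a d \<notin> K"
  let ?B = "{d \<in> diagrams n. a d \<notin> K}"
  have B: "finite ?B" "?B \<noteq> {}"
    using d finite_subset[OF _ finite_diagrams[of n], of ?B] by blast+
  \<comment> \<open>Among the coefficients outside K take one of maximal height. At its leading
    column the other bad diagrams contribute 0, and the good ones contribute polynomials in q times
    elements of K.\<close>
  obtain d0 where d0: "d0 \<in> ?B" "\<And>d. d \<in> ?B \<Longrightarrow> height (leadc d) \<le> height (leadc d0)"
    using Max_in[of "(\<lambda>d. height (leadc d)) ` ?B"] Max_ge[of "(\<lambda>d. height (leadc d)) ` ?B"] B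
    by (smt (verit, best) finite_imageI image_iff image_is_empty)
  have Ksum: "(\<Sum>x\<in>S. g x) \<in> K" if "\<And>x. x \<in> S \<Longrightarrow> g x \<in> K" for S :: "'b set" and g
    using that by (induction S rule: infinite_finite_induct) (auto intro: K0 Kadd)
  have Kqk: "qv ^ k * x \<in> K" if "x \<in> K" for k x
    using that by (induction k) (auto simp: mult.assoc intro: Kq)
  let ?S = "\<Sum>d\<in>diagrams n - {d0}. a d * Poly_Mapping.lookup (psi d) (col (leadc d0))"
  have split: "Poly_Mapping.lookup (lin n a) (col (leadc d0))
      = a d0 + ?S"
    using d0(1) lookup_psi_lead[of d0 n] by (simp add: lookup_lin sum.remove[OF finite_diagrams,
        of d0])
  have S: "?S \<in> K"
  proof (rule Ksum)
    fix d assume d: "d \<in> diagrams n - {d0}"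
    show "a d * Poly_Mapping.lookup (psi d) (col (leadc d0)) \<in> K"
    proof (cases "a d \<in> K")
      case True
      have "a d * (if P then qv ^ k else 0) \<in> K" for P k
        using Kqk[OF True, of k] K0 by (auto simp: mult.commute)
      then show ?thesis
        using d by (auto simp: lookup_psi sum_distrib_left intro!: Ksum)
    next
      case False
      then have "height (leadc d) \<le> height (leadc d0)"
        using d0(2) d by blast
      then have "Poly_Mapping.lookup (psi d) (col (leadc d0)) = 0"
        using lookup_psi_other(1)[of d n d0] d d0(1) by auto
      then show ?thesis using K0 by simp
    qed
  qed
  have "Poly_Mapping.lookup (lin n a) (col (leadc d0)) + - ?S \<in> K"
    by (rule Kadd[OF look Kneg[OF S]])
  then have "a d0 \<in> K"
    unfolding split by simp
  then show False using d0(1) by blast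
qed

section \<open>The canonical basis\<close>

lemma lin_add: "lin n (\<lambda>d. a d + b d) = lin n a + lin n b"
  by (simp add: lin_def smul_add_left sum.distrib)

lemma lin_diff: "lin n (\<lambda>d. a d - b d) = lin n a - lin n b"
  by (simp add: lin_def smul_diff_left sum_subtractf)

lemma lin_smul: "lin n (\<lambda>d. c * a d) = smul c (lin n a)"
  by (simp add: lin_def smul_sum_right)

lemma lin_unit: "d0 \<in> diagrams n \<Longrightarrow> lin n (\<lambda>d. if d = d0 then 1 else 0) = psi d0"
  by (simp add: lin_def if_distrib[of "\<lambda>c. smul c _"] finite_diagrams cong: if_cong)

text \<open>This replaces the bar involution on the span of the diagram vectors, whose linear independence
  is not used here.\<close>

definition laurent_matrix :: "nat \<Rightarrow> free_elt \<Rightarrow> bool" where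
  "laurent_matrix n x \<longleftrightarrow> (\<forall>a. (\<forall>d. a d \<in> rat_laurent) \<longrightarrow>
     (\<exists>b. (\<forall>d. b d \<in> rat_laurent) \<and> free_act n x (lin n a) = lin n b \<and>
       free_act n (bar_free x) (lin n (\<lambda>d. bar_cq (a d))) = lin n (\<lambda>d. bar_cq (b d))))"

lemma laurent_matrix_divpow:
  assumes i: "i \<in> {1..n}"
  shows "laurent_matrix n (divpow n i (gelt (GenF i)) k)"
  unfolding laurent_matrix_def
proof (intro allI impI)
  let ?x = "divpow n i (gelt (GenF i)) k"
  fix a :: "(nat \<times> nat) set \<times> (nat \<Rightarrow> site) \<Rightarrow> cq"
  assume a: "\<forall>d. a d \<in> rat_laurent"
  have "\<exists>c d'. d' \<in> diagrams n \<and> c \<in> {0, 1, qv + inverse qv} \<and> free_act n ?x (psi d) = smul c (psi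
      d')"
    if "d \<in> diagrams n" for d
    using divpow_step[OF that[unfolded in_diagrams] i, of k] by (fastforce simp: in_diagrams)
  then obtain c g where cg: "\<And>d. d \<in> diagrams n \<Longrightarrow> g d \<in> diagrams n"
      "\<And>d. d \<in> diagrams n \<Longrightarrow> c d \<in> {0, 1, qv + inverse qv}"
      "\<And>d. d \<in> diagrams n \<Longrightarrow> free_act n ?x (psi d) = smul (c d) (psi (g d))"
    by metis
  \<comment> \<open>\<open>g\<close> need not be injective, so the coefficient at \<open>e\<close>
    collects a whole fibre. The matrix is the same for every \<open>a'\<close>; below it is applied
    to \<open>a\<close> and to its conjugate.\<close>
  have act: "free_act n ?x (lin n a') = lin n (\<lambda>e. \<Sum>d\<in>{d \<in> diagrams n. g d = e}. c d * a' d)" for a'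
  proof -
    have "free_act n ?x (lin n a') = (\<Sum>d\<in>diagrams n. smul (c d * a' d) (psi (g d)))"
      unfolding lin_def
      by (simp add: linear_op_sum[OF linear_op_free_act] linear_op_smul[OF linear_op_free_act] cg
          mult.commute cong: sum.cong)
    also have "\<dots> = (\<Sum>e\<in>diagrams n. \<Sum>d\<in>{d \<in> diagrams n. g d = e}. smul (c d * a' d) (psi (g d)))"
      by (rule sum.group[symmetric]) (use finite_diagrams cg(1) in auto)
    also have "\<dots> = lin n (\<lambda>e. \<Sum>d\<in>{d \<in> diagrams n. g d = e}. c d * a' d)"
      unfolding lin_def by (simp add: smul_sum_left)
    finally show ?thesis .
  qed
  have barsum: "bar_cq (\<Sum>d\<in>S. h d) = (\<Sum>d\<in>S. bar_cq (h d))" for S :: "'b set" and h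
    by (induction S rule: infinite_finite_induct) auto
  \<comment> \<open>0, 1 and q + q^-1 are bar invariant Laurent polynomials, so conjugating the
    input conjugates the output.\<close>
  have bc: "bar_cq (c d) = c d" "c d \<in> rat_laurent" if "d \<in> diagrams n" for d
    using cg(2)[OF that] rat_laurent_add[OF qv_in_rat_laurent inverse_qv_in_rat_laurent]
    by (auto simp: add.commute)
  have bar: "bar_free ?x = ?x" by simp
  show "\<exists>b. (\<forall>d. b d \<in> rat_laurent) \<and> free_act n ?x (lin n a) = lin n b \<and>
       free_act n (bar_free ?x) (lin n (\<lambda>d. bar_cq (a d))) = lin n (\<lambda>d. bar_cq (b d))"
    unfolding bar act
    by (intro exI[of _ "\<lambda>e. \<Sum>d\<in>{d \<in> diagrams n. g d = e}. c d * a d"] conjI allI refl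
        rat_laurent_sum
        rat_laurent_mult)
       (use a bc in \<open>auto simp: barsum intro!: arg_cong[of _ _ "lin n"] sum.cong\<close>)
qed

lemma laurent_matrix_mult:
  assumes "laurent_matrix n x" "laurent_matrix n y"
  shows "laurent_matrix n (x * y)"
  unfolding laurent_matrix_def
proof (intro allI impI)
  fix a :: "(nat \<times> nat) set \<times> (nat \<Rightarrow> site) \<Rightarrow> cq"
  assume a: "\<forall>d. a d \<in> rat_laurent"
  obtain b where b: "\<forall>d. b d \<in> rat_laurent" "free_act n y (lin n a) = lin n b"
      "free_act n (bar_free y) (lin n (\<lambda>d. bar_cq (a d))) = lin n (\<lambda>d. bar_cq (b d))"
    using assms(2) a unfolding laurent_matrix_def by blast
  obtain c where c: "\<forall>d. c d \<in> rat_laurent" "free_act n x (lin n b) = lin n c"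
      "free_act n (bar_free x) (lin n (\<lambda>d. bar_cq (b d))) = lin n (\<lambda>d. bar_cq (c d))"
    using assms(1) b(1) unfolding laurent_matrix_def by blast
  show "\<exists>b. (\<forall>d. b d \<in> rat_laurent) \<and> free_act n (x * y) (lin n a) = lin n b \<and>
       free_act n (bar_free (x * y)) (lin n (\<lambda>d. bar_cq (a d))) = lin n (\<lambda>d. bar_cq (b d))"
    using b c by (auto simp: free_act_mult bar_free_mult)
qed

lemma laurent_matrix_add:
  assumes "laurent_matrix n x" "laurent_matrix n y"
  shows "laurent_matrix n (x + y)"
  unfolding laurent_matrix_def
proof (intro allI impI)
  fix a :: "(nat \<times> nat) set \<times> (nat \<Rightarrow> site) \<Rightarrow> cq"
  assume a: "\<forall>d. a d \<in> rat_laurent"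
  obtain b where b: "\<forall>d. b d \<in> rat_laurent" "free_act n y (lin n a) = lin n b"
      "free_act n (bar_free y) (lin n (\<lambda>d. bar_cq (a d))) = lin n (\<lambda>d. bar_cq (b d))"
    using assms(2) a unfolding laurent_matrix_def by blast
  obtain c where c: "\<forall>d. c d \<in> rat_laurent" "free_act n x (lin n a) = lin n c"
      "free_act n (bar_free x) (lin n (\<lambda>d. bar_cq (a d))) = lin n (\<lambda>d. bar_cq (c d))"
    using assms(1) a unfolding laurent_matrix_def by blast
  show "\<exists>b. (\<forall>d. b d \<in> rat_laurent) \<and> free_act n (x + y) (lin n a) = lin n b \<and>
       free_act n (bar_free (x + y)) (lin n (\<lambda>d. bar_cq (a d))) = lin n (\<lambda>d. bar_cq (b d))"
    by (rule exI[of _ "\<lambda>d. c d + b d"])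
       (use b c in \<open>simp add: free_act_add bar_free_add lin_add rat_laurent_add\<close>)
qed

lemma laurent_matrix_scal:
  assumes "c \<in> rat_laurent"
  shows "laurent_matrix n (scal c)"
  unfolding laurent_matrix_def
  by (intro allI impI, rule_tac x = "\<lambda>d. c * a d" in exI)
     (use assms in \<open>simp add: lin_smul rat_laurent_mult\<close>)

lemma laurent_matrix_uminus: "laurent_matrix n x \<Longrightarrow> laurent_matrix n (- x)"
  using laurent_matrix_mult[OF laurent_matrix_scal[OF rat_laurent_minus_1], of n x]
  by (simp add: scal_def single_uminus)

lemma UminusQ_laurent_matrix:
  assumes "u \<in> UminusQ n"
  shows "\<exists>x\<in>carrier (free_alg n). u = cls n x \<and> laurent_matrix n x"
proof (rule UminusQ_rep[OF assms])
  show "laurent_matrix n 1"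
    using laurent_matrix_scal[of 1 n] by (simp add: scal_def)
qed (rule laurent_matrix_scal laurent_matrix_divpow laurent_matrix_uminus
    laurent_matrix_add laurent_matrix_mult; assumption)+

text \<open>The column 1, ..., p contains no pair, so it is a diagram without arcs.\<close>

lemma hw_vec_eq_psi:
  assumes "p \<le> n"
  obtains d0 where "d0 \<in> diagrams n" "hw_vec p = psi d0"
proof
  let ?A = "\<lambda>t. if t \<in> {1..p} then Plus else Vac"
  show "({}, ?A) \<in> diagrams n"
    using assms by (simp add: in_diagrams valid_def)
  have "col ?A = Unb ` {1..p}"
    unfolding letter_set_eq_iff by auto
  then show "hw_vec p = psi ({}, ?A)"
    by (simp add: hw_vec_def V_def)
qed

text \<open>Sets of arcs correspond to subsets of K_C through their right ends, and
  \<open>u_of_lead\<close> identifies the left ends with the letters u_i. This translates diagram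
  vectors into the shape claimed for G(C).\<close>

lemma psi_eq_sum_col_subst:
  assumes v: "valid n M A"
  shows "arcs (V A) M = (\<Sum>X\<in>Pow (pairs (col (lead M A))). smul (qv ^ card X) (vb (col_subst (col
      (lead M A)) X)))"
proof -
  let ?C = "col (lead M A)"
  have inj: "inj_on snd M"
  proof (rule inj_onI)
    fix m m' assume m: "m \<in> M" "m' \<in> M" "snd m = snd m'"
    have "(fst m, snd m) \<in> M" "(fst m', snd m') \<in> M"
      unfolding prod.collapse by (fact m)+
    from validD(2)[OF v this] m(3) show "m = m'"
      by (simp add: prod_eq_iff)
  qed
  have step: "smul (qv ^ card X) (V (flip M A X)) = smul (qv ^ card (snd ` X)) (vb (col_subst ?C
      (snd ` X)))"
    if X: "X \<subseteq> M" for X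
  proof -
    have "card (snd ` X) = card X"
      using card_image inj inj_on_subset X by blast
    moreover have "col_subst ?C (snd ` X) = col (flip M A X)"
    proof -
      have U: "(\<Union>x\<in>snd ` X. {Unb (u_of ?C x), Bar (u_of ?C x)}) = Unb ` fst ` X \<union> Bar ` fst ` X"
        using u_of_lead[OF v] X by force
      have sd: "snd ` (M - X) = snd ` M - snd ` X"
        using inj X by (metis inj_on_image_set_diff Diff_subset)
      have A: "A t \<noteq> Dbl" "t \<in> snd ` X \<Longrightarrow> A t = Vac" for t
        using validD(5)[OF v] validD(1)[OF v] X by force+
      have sub: "(s, t) \<in> X \<Longrightarrow> t \<in> snd ` M" for s t
        using X by force
      have L: "lead M A t = (if t \<in> snd ` M then Dbl else A t)" for t
        by (simp add: flip_def)
      have F: "flip M A X t = (if t \<in> snd ` M \<and> t \<notin> snd ` X \<or> t \<in> fst ` X then Dbl else A t)" for t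
        by (simp add: flip_def sd)
      show ?thesis
        unfolding letter_set_eq_iff col_subst_def U
        using A sub by (auto simp: L F)
    qed
    ultimately show ?thesis by (simp add: V_def)
  qed
  have "(\<Sum>X\<in>Pow (pairs ?C). smul (qv ^ card X) (vb (col_subst ?C X)))
      = (\<Sum>X\<in>Pow M. smul (qv ^ card (snd ` X)) (vb (col_subst ?C (snd ` X))))"
  proof (rule sum.reindex_cong[of "image snd"])
    show "inj_on ((`) snd) (Pow M)"
      using inj by (simp add: inj_on_image_Pow)
    show "Pow (pairs ?C) = (`) snd ` Pow M"
      by (simp add: pairs_lead[OF v] image_Pow_surj)
  qed simp
  then show ?thesis
    using step by (simp add: valid_arcs_expand[OF v])
qed

theorem theorem3p3p2:
  fixes n p :: nat
    and \<beta> :: "wvec \<Rightarrow> wvec"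
    and G :: "letter set \<Rightarrow> wvec"
    and C :: "letter set"
  assumes "1 \<le> p" and "p \<le> n"
    and "is_bar_involution n p \<beta>"
    and "is_canonical_basis n p \<beta> G"
    and "C \<in> adm_columns n p"
  shows "G C = (\<Sum>X\<in>Pow (pairs C). smul (qv ^ card X) (vb (col_subst C X)))"
proof -
  have G: "G C \<in> VQ n p" "\<beta> (G C) = G C" "G C - vb C \<in> smul qv ` crystal_lattice n p"
    using assms(4,5) unfolding is_canonical_basis_def by blast+
  obtain d0 where d0: "d0 \<in> diagrams n" "hw_vec p = psi d0"
    using hw_vec_eq_psi[OF assms(2)] by blast
  let ?a0 = "\<lambda>d. if d = d0 then 1 else (0 :: cq)"
  have hw: "hw_vec p = lin n ?a0"
    using d0 lin_unit by simp
  obtain u where u: "u \<in> UminusQ n" "G C = act n u (hw_vec p)"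
    using G(1) unfolding VQ_def by blast
  obtain x where x: "x \<in> carrier (free_alg n)" "u = cls n x" "laurent_matrix n x"
    using UminusQ_laurent_matrix[OF u(1)] by blast
  have "\<exists>b. (\<forall>d. b d \<in> rat_laurent) \<and> free_act n x (lin n ?a0) = lin n b \<and>
      free_act n (bar_free x) (lin n (\<lambda>d. bar_cq (?a0 d))) = lin n (\<lambda>d. bar_cq (b d))"
    by (rule x(3)[unfolded laurent_matrix_def, rule_format]) simp
  \<comment> \<open>The highest weight vector has bar invariant coefficients, so x and its bar image
    start from the same vector.\<close>
  moreover have "(\<lambda>d. bar_cq (?a0 d)) = ?a0" by auto
  ultimately obtain b where b: "\<And>d. b d \<in> rat_laurent" "free_act n x (hw_vec p) = lin n b"
      "free_act n (bar_free x) (hw_vec p) = lin n (\<lambda>d. bar_cq (b d))"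
    unfolding hw by auto
  have Gb: "G C = lin n b"
    using u(2) x(2) b(2) by (simp add: act_cls)
  have "\<beta> (G C) = act n (bar_Uq u) (hw_vec p)"
    using assms(3) u(2) cls_in_Uq[OF x(1)] x(2) unfolding is_bar_involution_def by auto
  then have "lin n (\<lambda>d. bar_cq (b d)) = lin n b"
    using G(2) Gb b(3) x(2) by (simp add: act_bar_cls)
  then have "lin n (\<lambda>d. bar_cq (b d) - b d) = 0"
    by (simp add: lin_diff)
  \<comment> \<open>With K = {0} the triangular system expresses the linear independence of the
    diagram vectors.\<close>
  then have bar: "bar_cq (b d) = b d" if "d \<in> diagrams n" for d
    using coefficients_of_lin[of "{0}" n "\<lambda>d. bar_cq (b d) - b d", OF _ _ _ _ _ that] by simp
  obtain w where w: "\<And>D. Poly_Mapping.lookup w D \<in> regular_at_0" "G C - vb C = smul qv w"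
    using G(3) unfolding crystal_lattice_def by blast
  have look: "Poly_Mapping.lookup (lin n b) D = (if D = C then 1 else 0) + qv *
      Poly_Mapping.lookup w D" for D
  proof -
    have "lin n b = vb C + smul qv w"
      using w(2) Gb by (simp add: algebra_simps)
    then show ?thesis
      by (auto simp: lookup_add vb_def lookup_single when_def)
  qed
  \<comment> \<open>The same system with K the local ring at q = 0: regular lookups force regular
    coefficients.\<close>
  have reg: "b d \<in> regular_at_0" if "d \<in> diagrams n" for d
  proof (rule coefficients_of_lin[OF _ _ _ _ _ that])
    show "Poly_Mapping.lookup (lin n b) D \<in> regular_at_0" for D
      unfolding look by (intro regular_at_0_add regular_at_0_mult w) auto
  qed (auto intro: regular_at_0_add regular_at_0_uminus regular_at_0_mult)
  \<comment> \<open>The coefficient is a constant, hence determined modulo q. At the leading column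
    of d the other diagrams contribute multiples of q, and G(C) is congruent to v_C.\<close>
  have b01: "b d = (if col (leadc d) = C then 1 else 0)" if d: "d \<in> diagrams n" for d
  proof -
    obtain c where c: "b d = to_fract [:c:]"
      using bar_invariant_regular_laurent[OF b(1) reg[OF d] bar[OF d]] by blast
    have "\<forall>d'\<in>diagrams n - {d}. \<exists>r\<in>regular_at_0. b d' * Poly_Mapping.lookup (psi d') (col (leadc
        d)) = qv * r"
    proof
      fix d' assume d': "d' \<in> diagrams n - {d}"
      then obtain r where "r \<in> regular_at_0" "Poly_Mapping.lookup (psi d') (col (leadc d)) = qv * r"
        using lookup_psi_other(2)[of d' n d] d by auto
      then show "\<exists>r\<in>regular_at_0. b d' * Poly_Mapping.lookup (psi d') (col (leadc d)) = qv * r"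
        using reg[of d'] d' by (intro bexI[of _ "b d' * r"]) (auto intro: regular_at_0_mult)
    qed
    then obtain r where r: "\<And>d'. d' \<in> diagrams n - {d} \<Longrightarrow> r d' \<in> regular_at_0"
        "\<And>d'. d' \<in> diagrams n - {d} \<Longrightarrow> b d' * Poly_Mapping.lookup (psi d') (col (leadc d)) = qv * r
            d'"
      by metis
    have rs: "(\<Sum>d'\<in>S. r d') \<in> regular_at_0" if "S \<subseteq> diagrams n - {d}" for S
      using that by (induction S rule: infinite_finite_induct) (auto intro: regular_at_0_add r(1))
    have "Poly_Mapping.lookup (lin n b) (col (leadc d)) = b d + qv * (\<Sum>d'\<in>diagrams n - {d}. r d')"
      using d r(2) by (simp add: lookup_lin sum.remove[OF finite_diagrams, of d] lookup_psi_lead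
          sum_distrib_left)
    then have "b d - (if col (leadc d) = C then 1 else 0)
        = qv * (Poly_Mapping.lookup w (col (leadc d)) + - (\<Sum>d'\<in>diagrams n - {d}. r d'))"
      unfolding look by (simp add: algebra_simps)
    moreover have "b d - (if col (leadc d) = C then 1 else 0) = to_fract [:c - (if col (leadc d) =
        C then 1 else 0):]"
    proof -
      have "to_fract [:c - k:] = to_fract [:c:] - to_fract [:k:]" for k
        by (simp flip: to_fract_diff)
      then show ?thesis using c by simp
    qed
    ultimately have "c - (if col (leadc d) = C then 1 else 0) = 0"
      using regular_const_mod_qv[OF regular_at_0_add[OF w(1) regular_at_0_uminus[OF rs[OF
          order_refl]]]]
      by metis
    then show ?thesis using c by auto
  qed
  \<comment> \<open>Otherwise all coefficients vanish, and 0 would be congruent to v_C modulo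
    q.\<close>
  have "\<exists>d\<in>diagrams n. col (leadc d) = C"
  proof (rule ccontr)
    assume "\<not> ?thesis"
    then have "lin n b = 0"
      using b01 by (auto simp: lin_def intro!: sum.neutral)
    then have "- 1 = qv * Poly_Mapping.lookup w C"
      using look[of C] minus_unique by simp
    moreover have "to_fract [:- 1 :: complex:] = - 1"
      by (metis minus_pCons minus_zero to_fract_const_1 to_fract_uminus)
    ultimately have "to_fract [:- 1:] = qv * Poly_Mapping.lookup w C"
      by simp
    then show False
      using regular_const_mod_qv[OF w(1)] by fastforce
  qed
  then obtain d where d: "d \<in> diagrams n" "col (leadc d) = C" by blast
  have uniq: "col (leadc d') = C \<longleftrightarrow> d' = d" if "d' \<in> diagrams n" for d'
    using lead_inj[of n "fst d'" "snd d'" n "fst d" "snd d"] that d by (auto simp: in_diagrams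
        prod_eq_iff)
  have "lin n b = lin n (\<lambda>d'. if d' = d then 1 else 0)"
    unfolding lin_def by (rule sum.cong) (use b01 uniq in auto)
  then have "G C = psi d"
    using Gb lin_unit[OF d(1)] by simp
  then show ?thesis
    using psi_eq_sum_col_subst[of n "fst d" "snd d"] d by (simp add: in_diagrams)
qed

end
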